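(* Let $k\in\mathbb{N}$, $0\le\alpha<mn$, let $1<p_1,\dots,p_m<\infty$ with $\frac1p=\frac1{p_1}+\cdots+\frac1{p_m}$, and let $0<p\le q<\infty$ satisfy $\frac1q=\frac1p-\frac\alpha n$. Let $\vec w=(w_1,\dots,w_m)$ be an $m$-tuple of nonnegative locally integrable functions on $\mathbb{R}^n$, and put $\nu_{\vec w}=\prod_{i=1}^mw_i$. Then the following statements are equivalent: (1) $\vec w\in A_{(\vec p,q),\mathcal{R}}$; (2) $\vec w^{\,r}=(w_1^r,\dots,w_m^r)\in A_{(\frac{\vec p}{r},\frac qr),\mathcal{R}}$ for some $r>1$; (3) $\mathcal{M}_{\mathcal{R},\alpha}$ is bounded from $L^{p_1}(w_1^{p_1})\times\cdots\times L^{p_m}(w_m^{p_m})$ to $L^q(\nu_{\vec w}^q)$; (4) $\mathcal{M}_{\mathcal{R},\alpha,\Phi_{k+1}}$ is bounded from $L^{p_1}(w_1^{p_1})\times\cdots\times L^{p_m}(w_m^{p_m})$ to $L^q(\nu_{\vec w}^q)$.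
   Context: $\mathcal{R}$ is the collection of all rectangles in $\mathbb{R}^n$ with sides parallel to the coordinate axes. For exponents $\vec p=(p_1,\dots,p_m)$ with $1\le p_i<\infty$ and $q>0$, an $m$-tuple $\vec w$ of nonnegative functions satisfies $\vec w\in A_{(\vec p,q),\mathcal{R}}$ if $$[\vec w]_{A_{(\vec p,q),\mathcal{R}}}:=\sup_{R\in\mathcal{R}}\Big(\frac1{|R|}\int_R\nu_{\vec w}^q\,dx\Big)^{1/q}\prod_{i=1}^m\Big(\frac1{|R|}\int_Rw_i^{-p_i'}dx\Big)^{1/p_i'}<\infty,\qquad \nu_{\vec w}=\prod_{i=1}^mw_i,$$ where $p_i'=p_i/(p_i-1)$ and, if $p_i=1$, the $i$-th factor is understood as $(\inf_Rw_i)^{-1}$ (essential infimum). The notation $\frac{\vec p}{r}$ means $(p_1/r,\dots,p_m/r)$, whose entries must be admissible exponents. $\mathcal{M}_{\mathcal{R},\alpha}(\vec f)(x)=\sup_{R\in\mathcal{R},R\ni x}\prod_{i=1}^m\frac1{|R|^{1-\frac\alpha{mn}}}\int_R|f_i(y)|dy$. With $\log^+t=\max\{\log t,0\}$, $\Phi_{k+1}(t)=t[1+(\log^+t)^k]$ for $t>0$. For a Young function $\Phi$ and a set $E$ of finite measure, $\|f\|_{\Phi,E}=\inf\{\lambda>0:\frac1{|E|}\int_E\Phi(|f(x)|/\lambda)dx\le1\}$. Then $$\mathcal{M}_{\mathcal{R},\alpha,\Phi_{k+1}}(\vec f)(x)=\sup_{R\in\mathcal{R},R\ni x}|R|^{\alpha/n}\prod_{i=1}^m\|f_i\|_{\Phi_{k+1},R}.$$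 Boundedness of an operator $T$ from $L^{p_1}(w_1^{p_1})\times\cdots\times L^{p_m}(w_m^{p_m})$ to $L^q(\nu_{\vec w}^q)$ means that there is $C>0$ with $\big(\int|T(\vec f)|^q\nu_{\vec w}^q\,dx\big)^{1/q}\le C\prod_{i=1}^m\big(\int|f_i|^{p_i}w_i^{p_i}dx\big)^{1/p_i}$ for all $\vec f$. *)

theory Defs
  imports "HOL-Analysis.Analysis"
begin

text \<open>
  All integrals are Lebesgue integrals with values in \<^typ>\<open>ennreal\<close>, so that suprema and integrals
  which may be infinite are never replaced by a default real value. The arithmetic conventions are
  those of \<^typ>\<open>ennreal\<close>: \<open>0 * \<infinity> = 0\<close> and \<open>inverse 0 = \<infinity>\<close>. The dimension is
  \<open>n = CARD('n)\<close>, the number of functions is \<open>m = CARD('m)\<close>.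
\<close>

text \<open>Meaningful for \<open>a > 0\<close> only; it is used with no other exponents.\<close>

definition enn_powr :: "ennreal \<Rightarrow> real \<Rightarrow> ennreal" where
  "enn_powr x a = (if x = \<infinity> then \<infinity> else ennreal (enn2real x powr a))"

text \<open>Nondegenerate open axis-parallel boxes. All objects below are the same for closed boxes.\<close>

definition rectangles :: "(real ^ 'n) set set" where
  "rectangles = {box a b | a b. \<forall>i. a $ i < b $ i}"

definition avg :: "(real ^ 'n) set \<Rightarrow> (real ^ 'n \<Rightarrow> ennreal) \<Rightarrow> ennreal" where
  "avg E g = (\<integral>\<^sup>+ x\<in>E. g x \<partial>lebesgue) / emeasure lebesgue E"

definition ess_inf :: "(real ^ 'n) set \<Rightarrow> (real ^ 'n \<Rightarrow> ennreal) \<Rightarrow> ennreal" where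
  "ess_inf E g = Sup {c. AE x in lebesgue. x \<in> E \<longrightarrow> c \<le> g x}"

definition conj_exp :: "real \<Rightarrow> real" where
  "conj_exp p = p / (p - 1)"

definition locally_integrable :: "(real ^ 'n \<Rightarrow> real) \<Rightarrow> bool" where
  "locally_integrable g \<longleftrightarrow> (\<forall>K. compact K \<longrightarrow> g absolutely_integrable_on K)"

definition nu :: "('m::finite \<Rightarrow> real ^ 'n \<Rightarrow> real) \<Rightarrow> real ^ 'n \<Rightarrow> real" where
  "nu w x = (\<Prod>i\<in>UNIV. w i x)"

text \<open>
  The power \<open>w powr (-p')\<close> is written as \<open>inverse (ennreal (w powr p'))\<close>, which is \<open>\<infinity>\<close>
  (and not \<open>0\<close>) at the zeros of \<open>w\<close>.
\<close>

definition dual_factor :: "real \<Rightarrow> (real ^ 'n) set \<Rightarrow> (real ^ 'n \<Rightarrow> real) \<Rightarrow> ennreal" where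
  "dual_factor p R u =
     (if p = 1 then inverse (ess_inf R (\<lambda>x. ennreal (u x)))
      else enn_powr (avg R (\<lambda>x. inverse (ennreal (u x powr conj_exp p)))) (1 / conj_exp p))"

definition A_const :: "('m::finite \<Rightarrow> real) \<Rightarrow> real \<Rightarrow> ('m \<Rightarrow> real ^ 'n \<Rightarrow> real) \<Rightarrow> ennreal" where
  "A_const p q w =
     (SUP R\<in>rectangles. enn_powr (avg R (\<lambda>x. ennreal (nu w x powr q))) (1 / q)
                          * (\<Prod>i\<in>UNIV. dual_factor (p i) R (w i)))"

definition A_class :: "('m::finite \<Rightarrow> real) \<Rightarrow> real \<Rightarrow> ('m \<Rightarrow> real ^ 'n \<Rightarrow> real) set" where
  "A_class p q = {w. (\<forall>i x. 0 \<le> w i x) \<and> A_const p q w < \<infinity>}"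

definition max_op ::
    "real \<Rightarrow> ('m::finite \<Rightarrow> real ^ 'n \<Rightarrow> real) \<Rightarrow> real ^ 'n \<Rightarrow> ennreal" where
  "max_op \<alpha> f x =
     (SUP R\<in>{R \<in> rectangles. x \<in> R}.
        \<Prod>i\<in>UNIV. (\<integral>\<^sup>+ y\<in>R. ennreal \<bar>f i y\<bar> \<partial>lebesgue)
                  / ennreal (measure lebesgue R powr (1 - \<alpha> / (real CARD('m) * real CARD('n)))))"

text \<open>
  \<open>log_young k\<close> is $\Phi_{k+1}$. Since \<open>ln 0 = 0\<close>, it vanishes at \<open>0\<close>; and \<open>x ^ 0 = 1\<close> makes
  $\Phi_1(t) = 2t$.
\<close>

definition log_young :: "nat \<Rightarrow> real \<Rightarrow> real" where
  "log_young k t = t * (1 + (max (ln t) 0) ^ k)"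

definition luxemburg :: "(real \<Rightarrow> real) \<Rightarrow> (real ^ 'n) set \<Rightarrow> (real ^ 'n \<Rightarrow> real) \<Rightarrow> ennreal" where
  "luxemburg \<Phi> E g =
     Inf (ennreal ` {t. 0 < t \<and> avg E (\<lambda>x. ennreal (\<Phi> (\<bar>g x\<bar> / t))) \<le> 1})"

definition max_op_young ::
    "real \<Rightarrow> (real \<Rightarrow> real) \<Rightarrow> ('m::finite \<Rightarrow> real ^ 'n \<Rightarrow> real) \<Rightarrow> real ^ 'n \<Rightarrow> ennreal" where
  "max_op_young \<alpha> \<Phi> f x =
     (SUP R\<in>{R \<in> rectangles. x \<in> R}.
        ennreal (measure lebesgue R powr (\<alpha> / real CARD('n))) * (\<Prod>i\<in>UNIV. luxemburg \<Phi> R (f i)))"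

definition wnorm :: "real \<Rightarrow> (real ^ 'n \<Rightarrow> real) \<Rightarrow> (real ^ 'n \<Rightarrow> ennreal) \<Rightarrow> ennreal" where
  "wnorm p u g = enn_powr (\<integral>\<^sup>+ x. enn_powr (g x) p * ennreal (u x) \<partial>lebesgue) (1 / p)"

definition weighted_Lp :: "real \<Rightarrow> (real ^ 'n \<Rightarrow> real) \<Rightarrow> (real ^ 'n \<Rightarrow> real) set" where
  "weighted_Lp p u =
     {f. f \<in> borel_measurable lebesgue \<and> wnorm p u (\<lambda>x. ennreal \<bar>f x\<bar>) < \<infinity>}"

text \<open>
  Boundedness of \<open>T\<close> from the product of the spaces \<open>L\<^sup>p\<^sup>i(u\<^sub>i)\<close> to \<open>L\<^sup>q(v)\<close>, where the
  densities \<open>u\<^sub>i\<close> and \<open>v\<close> already contain their exponents.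
\<close>

definition multi_bounded ::
    "(('m::finite \<Rightarrow> real ^ 'n \<Rightarrow> real) \<Rightarrow> real ^ 'n \<Rightarrow> ennreal) \<Rightarrow>
     ('m \<Rightarrow> real) \<Rightarrow> ('m \<Rightarrow> real ^ 'n \<Rightarrow> real) \<Rightarrow> real \<Rightarrow> (real ^ 'n \<Rightarrow> real) \<Rightarrow> bool" where
  "multi_bounded T p u q v \<longleftrightarrow>
     (\<exists>C::real. C > 0 \<and>
        (\<forall>f. (\<forall>i. f i \<in> weighted_Lp (p i) (u i)) \<longrightarrow>
             wnorm q v (T f) \<le>
               ennreal C * (\<Prod>i\<in>UNIV. wnorm (p i) (u i) (\<lambda>x. ennreal \<bar>f i x\<bar>))))"

end

theory Submission
  imports Defs
begin

text \<open>
  Write \<open>v = \<nu>\<^sup>q\<close> and \<open>\<sigma>\<^sub>i = w\<^sub>i powr (- p\<^sub>i')\<close>. Hoelder's inequality turns (1) into linear Muckenhoupt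
  conditions over rectangles for \<open>v\<close> and for every \<open>\<sigma>\<^sub>i\<close>; unless \<open>\<nu> = 0\<close> almost everywhere, all averages
  involved are positive and finite.

  (1) implies (2) by a reverse Hoelder inequality for the \<open>\<sigma>\<^sub>i\<close>. It rests on a Bellman function of the
  averages of \<open>\<sigma>\<^sub>i\<close> and of its dual weight, which does not increase when a rectangle is halved.

  (1) implies (4): \<open>L log L\<close> averages are dominated by \<open>L\<^sup>s\<close> averages with \<open>s > 1\<close>, and with the reverse
  Hoelder inequality the averages of \<open>f\<^sub>i\<close> are bounded by those of \<open>\<bar>f\<^sub>i\<bar>w\<^sub>i\<close> to some power \<open>a\<^sub>i < p\<^sub>i\<close> and
  those of \<open>\<sigma>\<^sub>i\<close>. Hedberg's trick removes \<open>\<alpha>\<close>. The remaining factor is at most a constant times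
  \<open>(avg v) powr (- 1 / q)\<close>, and \<open>1 / avg v \<le> (avg (v powr (- \<epsilon>))) powr (1 / \<epsilon>)\<close>, so that everything is
  controlled by the linear strong maximal function on \<open>L\<^sup>t(v)\<close> with \<open>t = 1 / \<epsilon>\<close>, where \<open>v\<close> is an \<open>A\<^sub>t\<close> weight.

  The linear strong maximal theorem for \<open>A\<^sub>t\<close> weights is reduced by cell averages to a finite grid. There
  the restriction of the weights to lines is again an \<open>A\<^sub>t\<close> weight, since a line segment is a rectangle,
  and one iterates a one-dimensional inequality, which follows from the maximal ergodic lemma.

  (4) implies (3) because averages are dominated by Luxemburg norms, and (3) implies (1) by testing on
  truncations of the \<open>\<sigma>\<^sub>i\<close>.
\<close>

text \<open>Covering arguments fail for rectangles of unbounded eccentricity. What survives is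
  stability: segments of grid cells and halves of a rectangle are again rectangles, so they obey the
  Muckenhoupt condition with the same constant. On the grid, restriction to lines is a matter of
  finite sums; the constants do not depend on the mesh, so Fatou's lemma leads back to all
  rectangles. From (1) to (4), the reverse Hoelder inequality opens the gap a_i < p_i, so the
  unweighted maximal functions of (|f_i| w_i)^a_i are bounded in exponent p_i / a_i > 1; let F be
  the product of their powers 1 / a_i. With G = F^(p / t) v^(-1 / t) one has G^t v = F^p almost
  everywhere: the weight cancels from the norm of G, and this dictates the exponent 1 / t. Hedberg's
  estimate holds at every point y of a rectangle, not only where the maximal function is evaluated,
  and can therefore be moved inside the average of v^(-1 / t).\<close>

section \<open>Maximal functions on the line\<close>

text \<open>Garsia's argument: from \<open>c\<close> to \<open>Suc c\<close>, the largest block sum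
  starting at the index (the empty block included) drops by at most \<open>\<phi> c\<close> if
  \<open>c\<close> lies in the set, and does not drop otherwise. The drops telescope to a
  nonnegative total.\<close>

lemma maximal_ergodic:
  fixes \<phi> :: "nat \<Rightarrow> real"
  shows "0 \<le> (\<Sum>c\<in>{c. c < L \<and> (\<exists>u\<in>{c<..L}. 0 \<le> (\<Sum>k=c..<u. \<phi> k))}. \<phi> c)"
proof -
  define m where "m c = Max ((\<lambda>u. \<Sum>k=c..<u. \<phi> k) ` {c..L})" for c
  let ?E = "{c. c < L \<and> (\<exists>u\<in>{c<..L}. 0 \<le> (\<Sum>k=c..<u. \<phi> k))}"
  have step: "m c - m (Suc c) \<le> (if c \<in> ?E then \<phi> c else 0)" if "c < L" for c
  proof -
    have m0: "0 \<le> m (Suc c)"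
      unfolding m_def using that by (intro Max_ge) (auto intro!: image_eqI[where x="Suc c"])
    have "m c \<in> (\<lambda>u. \<Sum>k=c..<u. \<phi> k) ` {c..L}"
      unfolding m_def using that by (intro Max_in) auto
    then obtain u where u: "u \<in> {c..L}" "m c = (\<Sum>k=c..<u. \<phi> k)" by auto
    have le: "(\<Sum>k=c..<u'. \<phi> k) \<le> \<phi> c + m (Suc c)" if "u' \<in> {c<..L}" for u'
    proof -
      have "(\<Sum>k=Suc c..<u'. \<phi> k) \<le> m (Suc c)"
        unfolding m_def using that by (intro Max_ge) auto
      moreover have "(\<Sum>k=c..<u'. \<phi> k) = \<phi> c + (\<Sum>k=Suc c..<u'. \<phi> k)"
        using that by (intro sum.atLeast_Suc_lessThan) auto
      ultimately show ?thesis by simp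
    qed
    show ?thesis
    proof (cases "c \<in> ?E")
      case True
      then obtain u' where u': "u' \<in> {c<..L}" "0 \<le> (\<Sum>k=c..<u'. \<phi> k)" by auto
      have "m c \<le> \<phi> c + m (Suc c)"
      proof (cases "u = c")
        case True
        then have "m c = 0" using u by simp
        then show ?thesis using le[OF u'(1)] u' by simp
      next
        case False
        then show ?thesis using u le by auto
      qed
      then show ?thesis using True by simp
    next
      case False
      then have "m c \<le> 0" using u that
        by (cases "u = c") (auto simp: not_le dest!: bspec[of _ _ u] intro: less_imp_le)
      then show ?thesis using False m0 by simp
    qed
  qed
  have "0 \<le> m 0"
    unfolding m_def by (intro Max_ge) (auto intro!: image_eqI[where x="0"])
  also have "m L = 0" unfolding m_def by simp
  then have "m 0 = (\<Sum>c<L. m c - m (Suc c))"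
    by (simp add: sum_lessThan_telescope')
  also have "\<dots> \<le> (\<Sum>c<L. if c \<in> ?E then \<phi> c else 0)"
    by (intro sum_mono step) auto
  also have "\<dots> = (\<Sum>c\<in>?E. \<phi> c)"
    by (subst sum.inter_restrict[symmetric]) (auto intro!: sum.cong)
  finally show ?thesis .
qed

text \<open>Integrating a level inequality in \<open>x\<close> against
  \<open>(t - 1) * x powr (t - 2)\<close> turns it into one between \<open>t\<close>-th powers. The
  fundamental theorem is used in the form that asks for derivatives in the interior only: for
  \<open>t < 2\<close> the integrand is unbounded near 0.\<close>

lemma has_integral_layer:
  fixes g h t :: real
  assumes "1 < t" "0 \<le> h"
  shows "((\<lambda>x. (t - 1) * x powr (t - 2) * (g - x)) has_integral
           (g * h powr (t - 1) - (t - 1) / t * h powr t)) {0..h}"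
proof -
  define F where "F = (\<lambda>x::real. g * x powr (t - 1) - (t - 1) / t * x powr t)"
  have "((\<lambda>x. (t - 1) * x powr (t - 2) * (g - x)) has_integral F h - F 0) {0..h}"
  proof (rule fundamental_theorem_of_calculus_interior)
    show "continuous_on {0..h} F"
      unfolding F_def using assms
      by (intro continuous_on_diff continuous_on_mult_left continuous_on_powr' continuous_intros) auto
    fix x assume x: "x \<in> {0<..<h}"
    have "(F has_real_derivative g * ((t - 1) * x powr (t - 1 - 1)) - (t - 1) / t * (t * x powr (t - 1))) (at x)"
      unfolding F_def using x assms by (auto intro!: derivative_eq_intros)
    moreover have "x powr (t - 1) = x * x powr (t - 2)"
      using x powr_add[of x 1 "t - 2"] by simp
    then have "g * ((t - 1) * x powr (t - 1 - 1)) - (t - 1) / t * (t * x powr (t - 1)) = (t - 1) * x powr (t - 2) * (g - x)"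
      using assms by (simp add: field_simps)
    ultimately show "(F has_vector_derivative (t - 1) * x powr (t - 2) * (g - x)) (at x)"
      by (simp add: has_real_derivative_iff_has_vector_derivative[symmetric])
  qed (use assms in auto)
  moreover have "F 0 = 0" by (simp add: F_def)
  ultimately show ?thesis by (simp add: F_def)
qed

text \<open>The sharp one-sided averages \<open>H\<close> have \<open>x \<le> H c\<close> exactly on
  the set of \<open>maximal_ergodic\<close> for \<open>(g - x) * v\<close>. Integrating over the
  levels \<open>x\<close> bounds the sum of \<open>H powr t * v\<close> by
  \<open>t / (t - 1)\<close> times that of \<open>g * H powr (t - 1) * v\<close>, and
  \<open>H\<close> is then absorbed.\<close>

lemma right_maximal_bound:
  fixes v g :: "nat \<Rightarrow> real"
  assumes t: "1 < t" and v: "\<And>c. c < L \<Longrightarrow> 0 < v c" and g: "\<And>c. c < L \<Longrightarrow> 0 \<le> g c"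
  and h: "\<And>c. c < L \<Longrightarrow> 0 \<le> h c \<and> (\<exists>u\<in>{c<..L}. h c * (\<Sum>k=c..<u. v k) \<le> (\<Sum>k=c..<u. g k * v k))"
  shows "(\<Sum>c<L. h c powr t * v c) \<le> (2 * t / (t - 1)) powr t * (\<Sum>c<L. g c powr t * v c)"
proof -
  define A where "A c u = (\<Sum>k=c..<u. g k * v k) / (\<Sum>k=c..<u. v k)" for c u
  define H where "H c = Max (A c ` {c<..L})" for c
  have vpos: "0 < (\<Sum>k=c..<u. v k)" if "c < u" "u \<le> L" for c u
    using that v by (intro sum_pos) auto
  have hH: "h c \<le> H c" if c: "c < L" for c
  proof -
    obtain u where u: "u \<in> {c<..L}" "h c * (\<Sum>k=c..<u. v k) \<le> (\<Sum>k=c..<u. g k * v k)"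
      using h[OF c] by auto
    then have "h c \<le> A c u" unfolding A_def using vpos[of c u] by (simp add: pos_le_divide_eq)
    also have "\<dots> \<le> H c" unfolding H_def using u by (intro Max_ge) auto
    finally show ?thesis .
  qed
  have H0: "0 \<le> H c" if "c < L" for c using hH h that by force
  define B where "B = Max (insert 0 (H ` {..<L}))"
  have HB: "H c \<le> B" if "c < L" for c
    unfolding B_def using that by (intro Max_ge) auto
  define I where "I c = g c * H c powr (t - 1) - (t - 1) / t * H c powr t" for c
  define F where "F c x = (t - 1) * x powr (t - 2) * (g c - x)" for c x
  have "(F c has_integral I c) {0..H c}" if "c < L" for c
    unfolding I_def F_def by (intro has_integral_layer H0 that t)
  then have "((\<lambda>x. if x \<in> {0..H c} then F c x else 0) has_integral I c) {0..B}" if "c < L" for c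
    using HB[OF that] that by (subst has_integral_restrict) auto
  then have int: "((\<lambda>x. \<Sum>c<L. v c * (if x \<in> {0..H c} then F c x else 0)) has_integral (\<Sum>c<L. v c * I c)) {0..B}"
    by (intro has_integral_sum has_integral_mult_right) auto
  have "0 \<le> (\<Sum>c<L. v c * I c)"
  proof (rule has_integral_nonneg[OF int])
    fix x assume x: "x \<in> {0..B}"
    let ?E = "{c. c < L \<and> (\<exists>u\<in>{c<..L}. 0 \<le> (\<Sum>k=c..<u. (g k - x) * v k))}"
    have E: "x \<le> H c \<longleftrightarrow> (\<exists>u\<in>{c<..L}. 0 \<le> (\<Sum>k=c..<u. (g k - x) * v k))" if "c < L" for c
    proof -
      have "x \<le> H c \<longleftrightarrow> (\<exists>u\<in>{c<..L}. x \<le> A c u)"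
        unfolding H_def using that by (subst Max_ge_iff) auto
      also have "\<dots> \<longleftrightarrow> (\<exists>u\<in>{c<..L}. 0 \<le> (\<Sum>k=c..<u. (g k - x) * v k))"
        using vpos by (intro bex_cong refl)
          (auto simp: A_def pos_le_divide_eq algebra_simps sum_subtractf sum_distrib_left)
      finally show ?thesis .
    qed
    have "(\<Sum>c<L. v c * (if x \<in> {0..H c} then F c x else 0))
        = (\<Sum>c<L. (t - 1) * x powr (t - 2) * (if c \<in> ?E then (g c - x) * v c else 0))"
      using x by (intro sum.cong refl) (auto simp: E F_def)
    also have "\<dots> = (t - 1) * x powr (t - 2) * (\<Sum>c\<in>?E. (g c - x) * v c)"
      unfolding sum_distrib_left[symmetric]
      by (subst sum.inter_restrict[symmetric]) (auto intro!: sum.cong)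
    also have "\<dots> \<ge> 0"
      using t by (intro mult_nonneg_nonneg maximal_ergodic[where \<phi>="\<lambda>c. (g c - x) * v c"]) auto
    finally show "0 \<le> (\<Sum>c<L. v c * (if x \<in> {0..H c} then F c x else 0))" .
  qed
  then have 1: "(\<Sum>c<L. H c powr t * v c) \<le> (\<Sum>c<L. t / (t - 1) * (g c * H c powr (t - 1)) * v c)"
  proof -
    have "0 \<le> t / (t - 1) * (\<Sum>c<L. v c * I c)" using t \<open>0 \<le> (\<Sum>c<L. v c * I c)\<close> by simp
    also have "\<dots> = (\<Sum>c<L. t / (t - 1) * (g c * H c powr (t - 1)) * v c - H c powr t * v c)"
      unfolding sum_distrib_left I_def using t by (intro sum.cong refl) (simp add: field_simps)
    finally show ?thesis by (simp add: sum_subtractf)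
  qed
  define T where "T = t / (t - 1)"
  have T: "0 < T" using t by (simp add: T_def)
  \<comment> \<open>A crude Young inequality: either \<open>2 * T * g c\<close> is at most
    \<open>H c\<close> and half of \<open>H powr t\<close> suffices, or \<open>H c\<close> is below
    \<open>2 * T * g c\<close>. The half is absorbed on the left, which costs the factor 2 in
    \<open>2 * t / (t - 1)\<close>.\<close>
  have pt: "T * (g c * H c powr (t - 1)) \<le> H c powr t / 2 + (2 * T) powr t * g c powr t / 2"
    if c: "c < L" for c
  proof (cases "2 * T * g c \<le> H c")
    case True
    have "2 * T * g c * H c powr (t - 1) \<le> H c * H c powr (t - 1)"
      using True by (intro mult_right_mono) auto
    also have "\<dots> = H c powr t"
      using H0[OF c] powr_add[of "H c" 1 "t - 1"] by (cases "H c = 0") auto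
    finally have "T * (g c * H c powr (t - 1)) \<le> H c powr t / 2" by simp
    moreover have "0 \<le> (2 * T) powr t * g c powr t / 2" by simp
    ultimately show ?thesis by linarith
  next
    case False
    have g0: "0 < g c" using False T g[OF c] H0[OF c] by (cases "g c = 0") auto
    have "2 * T * g c * H c powr (t - 1) \<le> 2 * T * g c * (2 * T * g c) powr (t - 1)"
      using False T g0 t H0[OF c] by (intro mult_left_mono powr_mono2) auto
    also have "\<dots> = (2 * T * g c) powr t"
      using T g0 powr_add[of "2 * T * g c" 1 "t - 1"] by auto
    also have "\<dots> = (2 * T) powr t * g c powr t" using T g0 by (simp add: powr_mult)
    finally have "T * (g c * H c powr (t - 1)) \<le> (2 * T) powr t * g c powr t / 2" by simp
    moreover have "0 \<le> H c powr t / 2" by simp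
    ultimately show ?thesis by linarith
  qed
  have "(\<Sum>c<L. H c powr t * v c) \<le> (\<Sum>c<L. (H c powr t / 2 + (2 * T) powr t * g c powr t / 2) * v c)"
    using 1 pt v unfolding T_def[symmetric]
    by (elim order_trans, intro sum_mono mult_right_mono) (auto intro: less_imp_le)
  also have "\<dots> = (\<Sum>c<L. H c powr t * v c) / 2 + (2 * T) powr t * (\<Sum>c<L. g c powr t * v c) / 2"
    by (simp add: sum.distrib sum_distrib_left sum_divide_distrib algebra_simps)
  finally have "(\<Sum>c<L. H c powr t * v c) \<le> (2 * T) powr t * (\<Sum>c<L. g c powr t * v c)" by simp
  moreover have "(\<Sum>c<L. h c powr t * v c) \<le> (\<Sum>c<L. H c powr t * v c)"
    using h v hH t by (intro sum_mono mult_right_mono powr_mono2) (auto intro: less_imp_le)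
  ultimately show ?thesis by (simp add: T_def)
qed

text \<open>Reversal of the interval by \<open>L - Suc c\<close> makes a block ending at
  \<open>c\<close> one that starts there.\<close>

lemma left_maximal_bound:
  fixes v g :: "nat \<Rightarrow> real"
  assumes t: "1 < t" and v: "\<And>c. c < L \<Longrightarrow> 0 < v c" and g: "\<And>c. c < L \<Longrightarrow> 0 \<le> g c"
  and h: "\<And>c. c < L \<Longrightarrow> 0 \<le> h c \<and> (\<exists>l\<le>c. h c * (\<Sum>k=l..<Suc c. v k) \<le> (\<Sum>k=l..<Suc c. g k * v k))"
  shows "(\<Sum>c<L. h c powr t * v c) \<le> (2 * t / (t - 1)) powr t * (\<Sum>c<L. g c powr t * v c)"
proof -
  have rev: "(\<Sum>c<L. f (L - Suc c)) = (\<Sum>c<L. f c)" for f :: "nat \<Rightarrow> real"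
    by (rule sum.nat_diff_reindex)
  have rev': "(\<Sum>k=c..<L - l. f (L - Suc k)) = (\<Sum>k=l..<Suc (L - Suc c). f k)"
    if "c < L" "l \<le> L - Suc c" for f :: "nat \<Rightarrow> real" and c l
    using that
    by (intro sum.reindex_bij_witness[where i="\<lambda>k. L - Suc k" and j="\<lambda>k. L - Suc k"]) auto
  have "(\<Sum>c<L. h (L - Suc c) powr t * v (L - Suc c))
      \<le> (2 * t / (t - 1)) powr t * (\<Sum>c<L. g (L - Suc c) powr t * v (L - Suc c))"
  proof (rule right_maximal_bound[OF t])
    fix c assume c: "c < L"
    obtain l where l: "l \<le> L - Suc c"
      "h (L - Suc c) * (\<Sum>k=l..<Suc (L - Suc c). v k) \<le> (\<Sum>k=l..<Suc (L - Suc c). g k * v k)"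
      using h[of "L - Suc c"] c by auto
    have "L - l \<in> {c<..L}" using l c by auto
    moreover have "h (L - Suc c) * (\<Sum>k=c..<L - l. v (L - Suc k))
       \<le> (\<Sum>k=c..<L - l. g (L - Suc k) * v (L - Suc k))"
      using l(2) unfolding rev'[OF c l(1), of v] rev'[OF c l(1), of "\<lambda>k. g k * v k"] .
    ultimately show "0 \<le> h (L - Suc c) \<and> (\<exists>u\<in>{c<..L}. h (L - Suc c) * (\<Sum>k=c..<u. v (L - Suc k))
       \<le> (\<Sum>k=c..<u. g (L - Suc k) * v (L - Suc k)))"
      using h[of "L - Suc c"] c by auto
  qed (use v g in auto)
  then show ?thesis
    unfolding rev[of "\<lambda>c. h c powr t * v c"] rev[of "\<lambda>c. g c powr t * v c"] .
qed

text \<open>The factor \<open>2 powr t\<close> comes from splitting a block into its two sides, the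
  factor 2 from adding two one-sided bounds \<open>(2 * t / (t - 1)) powr t\<close>.\<close>

definition uni_const :: "real \<Rightarrow> real" where
  "uni_const t = 2 * (4 * t / (t - 1)) powr t"

lemma uni_const_nonneg: "0 \<le> uni_const t"
  by (simp add: uni_const_def)

text \<open>A block around \<open>c\<close> splits at \<open>c\<close> into a left and a right part.
  Each part has at most the \<open>v\<close>-mass of the block, so the average over the block is at
  most the sum of two one-sided averages, whatever the measure \<open>v\<close> is.\<close>

lemma weighted_maximal_bound:
  fixes v g :: "nat \<Rightarrow> real"
  assumes t: "1 < t" and v: "\<And>c. c < L \<Longrightarrow> 0 < v c" and g: "\<And>c. c < L \<Longrightarrow> 0 \<le> g c"
  and h: "\<And>c. c < L \<Longrightarrow> 0 \<le> h c \<and> (\<exists>l u. l \<le> c \<and> c < u \<and> u \<le> L \<and>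
              h c * (\<Sum>k=l..<u. v k) \<le> (\<Sum>k=l..<u. g k * v k))"
  shows "(\<Sum>c<L. h c powr t * v c) \<le> uni_const t * (\<Sum>c<L. g c powr t * v c)"
proof -
  have "\<forall>c\<in>{..<L}. \<exists>l u. l \<le> c \<and> c < u \<and> u \<le> L \<and>
              h c * (\<Sum>k=l..<u. v k) \<le> (\<Sum>k=l..<u. g k * v k)" using h by auto
  then obtain l u where lu: "\<And>c. c < L \<Longrightarrow> l c \<le> c \<and> c < u c \<and> u c \<le> L \<and>
              h c * (\<Sum>k=l c..<u c. v k) \<le> (\<Sum>k=l c..<u c. g k * v k)"
    by (metis lessThan_iff)
  define h1 where "h1 c = (\<Sum>k=c..<u c. g k * v k) / (\<Sum>k=c..<u c. v k)" for c
  define h2 where "h2 c = (\<Sum>k=l c..<Suc c. g k * v k) / (\<Sum>k=l c..<Suc c. v k)" for c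
  have p1: "0 < (\<Sum>k=c..<u c. v k)" and p2: "0 < (\<Sum>k=l c..<Suc c. v k)" 
   and p1': "0 \<le> (\<Sum>k=c..<u c. g k * v k)" and p2': "0 \<le> (\<Sum>k=l c..<Suc c. g k * v k)" if "c < L" for c
    using lu[OF that] that v g
    by (auto simp del: sum.op_ivl_Suc intro!: sum_pos sum_nonneg mult_nonneg_nonneg less_imp_le[of 0 "v _"])
  have h12: "h c \<le> h1 c + h2 c" if c: "c < L" for c
  proof -
    note lc = lu[OF c]
    have split: "(\<Sum>k=l c..<u c. f k) = (\<Sum>k=l c..<Suc c. f k) + (\<Sum>k=c..<u c. f k) - f c" for f :: "nat \<Rightarrow> real"
    proof -
      have "(\<Sum>k=l c..<u c. f k) = (\<Sum>k=l c..<Suc c. f k) + (\<Sum>k=Suc c..<u c. f k)"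
        using lc by (intro sum.atLeastLessThan_concat[symmetric]) auto
      moreover have "(\<Sum>k=c..<u c. f k) = f c + (\<Sum>k=Suc c..<u c. f k)"
        using lc by (intro sum.atLeast_Suc_lessThan) auto
      ultimately show ?thesis by simp
    qed
    let ?V = "\<Sum>k=l c..<u c. v k"
    have V: "0 < ?V" using lc c v by (intro sum_pos) auto
    have sub1: "(\<Sum>k=c..<u c. v k) \<le> ?V" and sub2: "(\<Sum>k=l c..<Suc c. v k) \<le> ?V"
      using lc c v by (intro sum_mono2; auto intro: less_imp_le)+
    have "h c * ?V \<le> (\<Sum>k=l c..<Suc c. g k * v k) + (\<Sum>k=c..<u c. g k * v k)"
      using lc split[of "\<lambda>k. g k * v k"] g[OF c] v[OF c] by (smt (verit) mult_nonneg_nonneg)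
    also have "\<dots> = h2 c * (\<Sum>k=l c..<Suc c. v k) + h1 c * (\<Sum>k=c..<u c. v k)"
      using p1[OF c] p2[OF c] by (simp add: h1_def h2_def del: sum.op_ivl_Suc)
    also have "\<dots> \<le> h2 c * ?V + h1 c * ?V"
      using p1[OF c] p2[OF c] p1'[OF c] p2'[OF c] sub1 sub2
      by (intro add_mono mult_left_mono) (auto simp: h1_def h2_def simp del: sum.op_ivl_Suc)
    finally have "h c * ?V \<le> (h1 c + h2 c) * ?V" by (simp add: algebra_simps)
    then show ?thesis using V by simp
  qed
  have nn: "0 \<le> h1 c" "0 \<le> h2 c" if "c < L" for c
    using p1 p2 p1' p2' that by (auto simp: h1_def h2_def simp del: sum.op_ivl_Suc intro!: divide_nonneg_pos)
  have b1: "(\<Sum>c<L. h1 c powr t * v c) \<le> (2 * t / (t - 1)) powr t * (\<Sum>c<L. g c powr t * v c)"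
  proof (rule right_maximal_bound[OF t v g])
    fix c assume c: "c < L"
    show "0 \<le> h1 c \<and> (\<exists>u\<in>{c<..L}. h1 c * (\<Sum>k=c..<u. v k) \<le> (\<Sum>k=c..<u. g k * v k))"
      using nn[OF c] lu[OF c] p1[OF c] by (intro conjI bexI[of _ "u c"]) (auto simp: h1_def)
  qed
  have b2: "(\<Sum>c<L. h2 c powr t * v c) \<le> (2 * t / (t - 1)) powr t * (\<Sum>c<L. g c powr t * v c)"
  proof (rule left_maximal_bound[OF t v g])
    fix c assume c: "c < L"
    show "0 \<le> h2 c \<and> (\<exists>l\<le>c. h2 c * (\<Sum>k=l..<Suc c. v k) \<le> (\<Sum>k=l..<Suc c. g k * v k))"
      using nn[OF c] lu[OF c] p2[OF c] by (intro conjI exI[of _ "l c"]) (auto simp: h2_def simp del: sum.op_ivl_Suc)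
  qed
  have "h c powr t \<le> 2 powr t * (h1 c powr t + h2 c powr t)" if c: "c < L" for c
  proof -
    have "h c \<le> 2 * max (h1 c) (h2 c)" using h12[OF c] by (simp add: max_def)
    then have "h c powr t \<le> (2 * max (h1 c) (h2 c)) powr t"
      using h[OF c] t by (intro powr_mono2) auto
    also have "\<dots> = 2 powr t * max (h1 c) (h2 c) powr t" using nn[OF c] by (simp add: powr_mult max_def)
    also have "\<dots> \<le> 2 powr t * (h1 c powr t + h2 c powr t)"
      by (intro mult_left_mono) (auto simp: max_def)
    finally show ?thesis .
  qed
  then have "(\<Sum>c<L. h c powr t * v c) \<le> (\<Sum>c<L. (2 powr t * (h1 c powr t + h2 c powr t)) * v c)"
    using v by (intro sum_mono mult_right_mono) (auto intro: less_imp_le)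
  also have "\<dots> = 2 powr t * ((\<Sum>c<L. h1 c powr t * v c) + (\<Sum>c<L. h2 c powr t * v c))"
    by (simp add: sum_distrib_left sum.distrib algebra_simps)
  also have "\<dots> \<le> 2 powr t * (2 * ((2 * t / (t - 1)) powr t * (\<Sum>c<L. g c powr t * v c)))"
    using b1 b2 by (intro mult_left_mono) auto
  also have "\<dots> = uni_const t * (\<Sum>c<L. g c powr t * v c)"
    using t powr_mult[of 2 "2 * t / (t - 1)" t] by (simp add: uni_const_def)
  finally show ?thesis .
qed

section \<open>The strong maximal function on a grid\<close>

text \<open>\<open>t / (t - 1)\<close> is the conjugate exponent: the maximal function for
  \<open>s\<close> is used in exponent \<open>t\<close>, the one for \<open>v\<close> in the
  conjugate exponent.\<close>

definition line_const :: "real \<Rightarrow> real \<Rightarrow> real" where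
  "line_const t K = K powr (t / (t - 1)) * uni_const (t / (t - 1)) * uni_const t"

lemma line_const_nonneg: "0 \<le> line_const t K"
  by (simp add: line_const_def uni_const_nonneg)

text \<open>
  Lerner's trick: \<open>M f\<close> is dominated by a composition of the two maximal functions with
  respect to the measures \<open>s\<close> and \<open>v\<close>, for which no doubling is needed.
\<close>

lemma line_Ap_bound:
  fixes v s f h :: "nat \<Rightarrow> real"
  assumes t: "1 < t" and K: "0 \<le> K"
  and v: "\<And>c. c < L \<Longrightarrow> 0 < v c" and s: "\<And>c. c < L \<Longrightarrow> 0 < s c"
  and vs: "\<And>c. c < L \<Longrightarrow> 1 \<le> v c * s c powr (t - 1)"
  and Ap: "\<And>l u. l < u \<Longrightarrow> u \<le> L \<Longrightarrow>
     (\<Sum>k=l..<u. v k) * (\<Sum>k=l..<u. s k) powr (t - 1) \<le> K * real (u - l) powr t"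
  and f: "\<And>c. c < L \<Longrightarrow> 0 \<le> f c"
  and h: "\<And>c. c < L \<Longrightarrow> 0 \<le> h c \<and> (\<exists>l u. l \<le> c \<and> c < u \<and> u \<le> L \<and>
              h c * real (u - l) \<le> (\<Sum>k=l..<u. f k))"
  shows "(\<Sum>c<L. h c powr t * v c) \<le> line_const t K * (\<Sum>c<L. f c powr t * v c)"
proof -
  define t' where "t' = t / (t - 1)"
  have t': "1 < t'" "(t - 1) * t' = t" "(t - 1) * (1 - t') = -1"
    using t by (auto simp: t'_def field_simps)
  define I where "I c = {(l, u). l \<le> c \<and> c < u \<and> u \<le> L}" for c
  have finI: "finite (I c)" for c
    by (rule finite_subset[of _ "{..L} \<times> {..L}"]) (auto simp: I_def)
  have neI: "I c \<noteq> {}" if "c < L" for c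
  proof -
    have "(c, Suc c) \<in> I c" using that by (simp add: I_def Suc_le_eq)
    then show ?thesis by blast
  qed
  define A where "A = (\<lambda>(l, u). (\<Sum>k=l..<u. f k) / (\<Sum>k=l..<u. s k))"
  \<comment> \<open>\<open>G\<close> is the maximal function of \<open>f / s\<close> with respect to
    the measure \<open>s\<close>, which cancels in the numerators.\<close>
  define G where "G c = Max (A ` I c)" for c
  have spos: "0 < (\<Sum>k=l..<u. s k)" if "l < u" "u \<le> L" for l u
    using that s by (intro sum_pos) auto
  have vpos: "0 < (\<Sum>k=l..<u. v k)" if "l < u" "u \<le> L" for l u
    using that v by (intro sum_pos) auto
  have Gin: "\<exists>l u. l \<le> c \<and> c < u \<and> u \<le> L \<and> G c = A (l, u)" if "c < L" for c
  proof -
    have "G c \<in> A ` I c" unfolding G_def using finI neI[OF that] by (intro Max_in) auto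
    then show ?thesis by (auto simp: I_def)
  qed
  have G0: "0 \<le> G c" if cL: "c < L" for c
  proof -
    obtain l u where lu: "l \<le> c" "c < u" "u \<le> L" "G c = A (l, u)" using Gin[OF cL] by auto
    then have "0 \<le> (\<Sum>k=l..<u. f k)" "0 < (\<Sum>k=l..<u. s k)"
      using f spos[of l u] by (auto intro!: sum_nonneg)
    then show ?thesis using lu by (simp add: A_def)
  qed
  have Gbound: "(\<Sum>c<L. G c powr t * s c) \<le> uni_const t * (\<Sum>c<L. (f c / s c) powr t * s c)"
  proof (rule weighted_maximal_bound[OF t s])
    fix c assume c: "c < L"
    obtain l u where lu: "l \<le> c" "c < u" "u \<le> L" "G c = A (l, u)" using Gin[OF c] by auto
    have "(\<Sum>k=l..<u. f k / s k * s k) = (\<Sum>k=l..<u. f k)"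
      using lu s by (intro sum.cong refl) (metis atLeastLessThan_iff less_le_trans nonzero_eq_divide_eq less_irrefl)
    then have "G c * (\<Sum>k=l..<u. s k) \<le> (\<Sum>k=l..<u. f k / s k * s k)"
      using spos[of l u] lu by (simp add: A_def)
    then show "0 \<le> G c \<and> (\<exists>l u. l \<le> c \<and> c < u \<and> u \<le> L \<and>
        G c * (\<Sum>k=l..<u. s k) \<le> (\<Sum>k=l..<u. f k / s k * s k))"
      using G0[OF c] lu by blast
  qed (use f s in \<open>auto intro!: divide_nonneg_pos\<close>)
  \<comment> \<open>Dividing by \<open>v\<close> turns the plain sum of
    \<open>K * G powr (t - 1)\<close> over a block into a sum against the measure \<open>v\<close>,
    whose maximal function is then used in exponent \<open>t'\<close>.\<close>
  define g where "g c = K * G c powr (t - 1) / v c" for c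
  have hbound: "(\<Sum>c<L. (h c powr (t - 1)) powr t' * v c) \<le> uni_const t' * (\<Sum>c<L. g c powr t' * v c)"
  proof (rule weighted_maximal_bound[OF t'(1) v])
    fix c assume c: "c < L"
    obtain l u where lu: "l \<le> c" "c < u" "u \<le> L" "h c * real (u - l) \<le> (\<Sum>k=l..<u. f k)"
      using h[OF c] by auto
    define n where "n = real (u - l)"
    have n: "0 < n" using lu by (simp add: n_def)
    let ?V = "\<Sum>k=l..<u. v k" and ?S = "\<Sum>k=l..<u. s k"
    have V: "0 < ?V" and S: "0 < ?S" using vpos[of l u] spos[of l u] lu by auto
    \<comment> \<open>The estimate holds for every cell \<open>k\<close> of the block, because
      \<open>G k\<close> competes over all blocks through \<open>k\<close>; it is summed over
      \<open>k\<close> below. The Muckenhoupt condition trades the masses of \<open>v\<close> and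
      \<open>s\<close> for the length of the block.\<close>
    have one: "h c powr (t - 1) * ?V \<le> n * (K * G k powr (t - 1))" if k: "k \<in> {l..<u}" for k
    proof -
      have "h c * n \<le> ?S * A (l, u)" using lu S by (simp add: A_def n_def)
      also have "A (l, u) \<le> G k" unfolding G_def using k lu finI
        by (intro Max_ge) (auto simp: I_def)
      finally have "h c * n \<le> ?S * G k" using S by simp
      then have "(h c * n) powr (t - 1) \<le> (?S * G k) powr (t - 1)"
        using t h[OF c] n by (intro powr_mono2) auto
      then have "h c powr (t - 1) * n powr (t - 1) \<le> ?S powr (t - 1) * G k powr (t - 1)"
        using h[OF c] n S G0[of k] k lu by (simp add: powr_mult)
      then have "(h c powr (t - 1) * n powr (t - 1)) * ?V \<le> (?S powr (t - 1) * G k powr (t - 1)) * ?V"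
        using V by (intro mult_right_mono) auto
      also have "\<dots> = (?V * ?S powr (t - 1)) * G k powr (t - 1)" by simp
      also have "\<dots> \<le> (K * n powr t) * G k powr (t - 1)"
        unfolding n_def using Ap[of l u] lu by (intro mult_right_mono) auto
      also have "n powr t = n * n powr (t - 1)" using n powr_add[of n 1 "t - 1"] by simp
      finally have "(h c powr (t - 1) * ?V) * n powr (t - 1) \<le> (n * (K * G k powr (t - 1))) * n powr (t - 1)"
        by (simp add: mult_ac)
      then show ?thesis using n by simp
    qed
    have "n * (h c powr (t - 1) * ?V) = (\<Sum>k=l..<u. h c powr (t - 1) * ?V)" by (simp add: n_def)
    also have "\<dots> \<le> (\<Sum>k=l..<u. n * (K * G k powr (t - 1)))" by (intro sum_mono one)
    also have "\<dots> = n * (\<Sum>k=l..<u. g k * v k)"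
      unfolding sum_distrib_left
    proof (intro sum.cong refl)
      fix k assume "k \<in> {l..<u}"
      then have "0 < v k" using v lu by auto
      then show "n * (K * G k powr (t - 1)) = n * (g k * v k)" by (simp add: g_def)
    qed
    finally have "h c powr (t - 1) * ?V \<le> (\<Sum>k=l..<u. g k * v k)" using n by simp
    then show "0 \<le> h c powr (t - 1) \<and> (\<exists>l u. l \<le> c \<and> c < u \<and> u \<le> L \<and>
        h c powr (t - 1) * (\<Sum>k=l..<u. v k) \<le> (\<Sum>k=l..<u. g k * v k))"
      using lu by auto
  qed (use v K in \<open>auto simp: g_def intro!: divide_nonneg_pos mult_nonneg_nonneg\<close>)
  \<comment> \<open>Substitutes for the identity \<open>s = v powr (1 - t')\<close>, of which cell
    averages keep only an inequality.\<close>
  have vs1: "v c powr (1 - t') \<le> s c" and vs2: "s c powr (1 - t) \<le> v c" if c: "c < L" for c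
  proof -
    have "s c powr (1 - t) * 1 \<le> s c powr (1 - t) * (v c * s c powr (t - 1))"
      using vs[OF c] by (intro mult_left_mono) auto
    also have "\<dots> = v c" using s[OF c] by (simp add: powr_add[symmetric] mult.left_commute)
    finally show *: "s c powr (1 - t) \<le> v c" by simp
    have "v c powr (1 - t') \<le> (s c powr (1 - t)) powr (1 - t')"
      using * s[OF c] t' by (intro powr_mono2') auto
    also have "\<dots> = s c powr 1" using t'(3) by (simp add: powr_powr algebra_simps)
    finally show "v c powr (1 - t') \<le> s c" using s[OF c] by simp
  qed
  have eqh: "(\<Sum>c<L. h c powr t * v c) = (\<Sum>c<L. (h c powr (t - 1)) powr t' * v c)"
    by (simp add: powr_powr t')
  have gG: "(\<Sum>c<L. g c powr t' * v c) \<le> K powr t' * (\<Sum>c<L. G c powr t * s c)"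
    unfolding sum_distrib_left
  proof (intro sum_mono)
    fix c assume "c \<in> {..<L}"
    then have c: "c < L" by simp
    have "g c powr t' * v c = K powr t' * (G c powr (t - 1)) powr t' * (v c powr - t' * v c)"
      using K G0[OF c] v[OF c] by (simp add: g_def powr_mult powr_divide powr_minus_divide)
    also have "\<dots> = K powr t' * G c powr t * v c powr (1 - t')"
      using v[OF c] powr_add[of "v c" 1 "- t'"] by (simp add: powr_powr t')
    also have "\<dots> \<le> K powr t' * G c powr t * s c"
      using vs1[OF c] by (intro mult_left_mono) auto
    finally show "g c powr t' * v c \<le> K powr t' * (G c powr t * s c)" by simp
  qed
  have ff: "(\<Sum>c<L. (f c / s c) powr t * s c) \<le> (\<Sum>c<L. f c powr t * v c)"
  proof (intro sum_mono)
    fix c assume "c \<in> {..<L}"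
    then have c: "c < L" by simp
    have "(f c / s c) powr t * s c = f c powr t * (s c powr - t * s c)"
      using f[OF c] s[OF c] by (simp add: powr_divide powr_minus_divide)
    also have "\<dots> = f c powr t * s c powr (1 - t)"
      using s[OF c] powr_add[of "s c" 1 "- t"] by simp
    also have "\<dots> \<le> f c powr t * v c"
      using vs2[OF c] by (intro mult_left_mono) auto
    finally show "(f c / s c) powr t * s c \<le> f c powr t * v c" .
  qed
  have "(\<Sum>c<L. g c powr t' * v c) \<le> K powr t' * (uni_const t * (\<Sum>c<L. f c powr t * v c))"
    using gG Gbound mult_left_mono[OF ff uni_const_nonneg[of t]]
    by (elim order_trans) (intro mult_left_mono, auto)
  then have "(\<Sum>c<L. h c powr t * v c) \<le>
      uni_const t' * (K powr t' * (uni_const t * (\<Sum>c<L. f c powr t * v c)))"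
    unfolding eqh using hbound mult_left_mono[OF _ uni_const_nonneg[of t']] order_trans by blast
  then show ?thesis by (simp add: line_const_def t'_def mult_ac)
qed

section \<open>Grid boxes and iteration over the coordinate directions\<close>

definition grid :: "nat \<Rightarrow> ('n \<Rightarrow> nat) set" where
  "grid L = {c. \<forall>i. c i < L}"

definition grid_box :: "('n \<Rightarrow> nat) \<Rightarrow> ('n \<Rightarrow> nat) \<Rightarrow> ('n \<Rightarrow> nat) set" where
  "grid_box a b = {c. \<forall>i. a i \<le> c i \<and> c i < b i}"

lemma finite_grid: "finite (grid L :: ('n::finite \<Rightarrow> nat) set)"
proof -
  have "grid L = PiE UNIV (\<lambda>_::'n. {..<L})" by (auto simp: grid_def PiE_def Pi_def extensional_def)
  then show ?thesis by (simp add: finite_PiE)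
qed

lemma grid_box_subset: "(\<And>i. b i \<le> L) \<Longrightarrow> grid_box a b \<subseteq> grid L"
  by (force simp: grid_def grid_box_def intro: less_le_trans)

lemma sum_grid_line:
  fixes F :: "('n::finite \<Rightarrow> nat) \<Rightarrow> real"
  shows "(\<Sum>c\<in>grid L. F c) = (\<Sum>c\<in>{c\<in>grid L. c j = 0}. \<Sum>k<L. F (c(j := k)))"
proof -
  have "(\<Sum>c\<in>{c\<in>grid L. c j = 0}. \<Sum>k<L. F (c(j := k)))
     = (\<Sum>(c, k)\<in>{c\<in>grid L. c j = 0} \<times> {..<L}. F (c(j := k)))"
    by (rule sum.cartesian_product)
  also have "\<dots> = (\<Sum>c\<in>grid L. F c)"
    by (rule sum.reindex_bij_witness[where i="\<lambda>c. (c(j := 0), c j)" and j="\<lambda>(c, k). c(j := k)"])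
      (auto simp: grid_def fun_eq_iff intro: le_less_trans[OF le0])
  finally show ?thesis by simp
qed

lemma sum_grid_box_line:
  fixes F :: "('n::finite \<Rightarrow> nat) \<Rightarrow> real"
  shows "(\<Sum>c\<in>grid_box a b. F c)
    = (\<Sum>k=a j..<b j. \<Sum>c\<in>grid_box (a(j := k)) (b(j := Suc k)). F c)"
proof -
  define L where "L = Max (range b)"
  have L: "b i \<le> L" for i unfolding L_def by (intro Max_ge) auto
  have fin: "finite (grid_box a b)"
    using grid_box_subset[OF L] finite_grid by (rule finite_subset)
  have fin2: "finite (grid_box (a(j := k)) (b(j := Suc k)))" if "k < b j" for k
  proof (rule finite_subset[OF grid_box_subset finite_grid])
    show "(b(j := Suc k)) i \<le> L" for i
      using L[of i] L[of j] that by simp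
  qed
  have eq: "grid_box a b = (\<Union>k\<in>{a j..<b j}. grid_box (a(j := k)) (b(j := Suc k)))"
  proof (intro equalityI subsetI)
    fix c assume "c \<in> grid_box a b"
    then have "c j \<in> {a j..<b j}" "c \<in> grid_box (a(j := c j)) (b(j := Suc (c j)))"
      by (auto simp: grid_box_def)
    then show "c \<in> (\<Union>k\<in>{a j..<b j}. grid_box (a(j := k)) (b(j := Suc k)))" by blast
  next
    fix c assume "c \<in> (\<Union>k\<in>{a j..<b j}. grid_box (a(j := k)) (b(j := Suc k)))"
    then obtain k where k: "k \<in> {a j..<b j}" "c \<in> grid_box (a(j := k)) (b(j := Suc k))" by blast
    have "a i \<le> c i \<and> c i < b i" for i
      using k(1) k(2)[unfolded grid_box_def, simplified, rule_format, of i] by (cases "i = j") auto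
    then show "c \<in> grid_box a b" by (simp add: grid_box_def)
  qed
  show ?thesis
    unfolding eq
  proof (rule sum.UNION_disjoint)
    show "\<forall>k\<in>{a j..<b j}. finite (grid_box (a(j := k)) (b(j := Suc k)))" using fin2 by auto
    have "c j = k" if "c \<in> grid_box (a(j := k)) (b(j := Suc k))" for c k
      using that[unfolded grid_box_def, simplified, rule_format, of j] by simp
    then show "\<forall>k\<in>{a j..<b j}. \<forall>l\<in>{a j..<b j}. k \<noteq> l \<longrightarrow>
        grid_box (a(j := k)) (b(j := Suc k)) \<inter> grid_box (a(j := l)) (b(j := Suc l)) = {}"
      by blast
  qed auto
qed

text \<open>Boxes through \<open>c\<close> that are one cell wide outside the directions
  \<open>J\<close>. They interpolate between the single cell, \<open>J = {}\<close>, and all boxes,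
  \<open>J = UNIV\<close>, which allows induction on \<open>J\<close>.\<close>

definition part_boxes :: "'n set \<Rightarrow> nat \<Rightarrow> ('n \<Rightarrow> nat) \<Rightarrow> (('n \<Rightarrow> nat) \<times> ('n \<Rightarrow> nat)) set" where
  "part_boxes J L c = {(a, b). \<forall>i. a i \<le> c i \<and> c i < b i \<and> b i \<le> L \<and> (i \<notin> J \<longrightarrow> a i = c i \<and> b i = Suc (c i))}"

definition box_avg :: "(('n::finite \<Rightarrow> nat) \<Rightarrow> real) \<Rightarrow> ('n \<Rightarrow> nat) \<times> ('n \<Rightarrow> nat) \<Rightarrow> real" where
  "box_avg f = (\<lambda>(a, b). (\<Sum>c\<in>grid_box a b. f c) / (\<Prod>i\<in>UNIV. real (b i - a i)))"

definition part_max :: "'n set \<Rightarrow> nat \<Rightarrow> (('n::finite \<Rightarrow> nat) \<Rightarrow> real) \<Rightarrow> ('n \<Rightarrow> nat) \<Rightarrow> real" where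
  "part_max J L f c = Max (box_avg f ` part_boxes J L c)"

lemma finite_part_boxes: "finite (part_boxes J L (c :: 'n::finite \<Rightarrow> nat))"
proof (rule finite_subset)
  show "part_boxes J L c \<subseteq> grid (Suc L) \<times> grid (Suc L)"
  proof
    fix p assume "p \<in> part_boxes J L c"
    then obtain a b where p: "p = (a, b)" and ab: "\<And>i. a i \<le> c i \<and> c i < b i \<and> b i \<le> L"
      by (auto simp: part_boxes_def)
    have "a i < Suc L \<and> b i < Suc L" for i using ab[of i] by simp
    then show "p \<in> grid (Suc L) \<times> grid (Suc L)" by (simp add: p grid_def)
  qed
qed (simp add: finite_grid)

lemma part_boxes_nonempty: "c \<in> grid L \<Longrightarrow> (c, \<lambda>i. Suc (c i)) \<in> part_boxes J L c"
  by (auto simp: part_boxes_def grid_def Suc_leI)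

lemma part_max_attained:
  assumes "c \<in> grid L"
  obtains a b where "(a, b) \<in> part_boxes J L c" "part_max J L f c = box_avg f (a, b)"
proof -
  have "part_max J L f c \<in> box_avg f ` part_boxes J L c"
    unfolding part_max_def using part_boxes_nonempty[OF assms] by (intro Max_in) (auto simp: finite_part_boxes)
  then show ?thesis using that by auto
qed

lemma part_max_ge: "(a, b) \<in> part_boxes J L c \<Longrightarrow> box_avg f (a, b) \<le> part_max J L f c"
  unfolding part_max_def by (intro Max_ge) (auto simp: finite_part_boxes)

lemma part_max_nonneg:
  assumes "c \<in> grid L" "\<And>c. c \<in> grid L \<Longrightarrow> 0 \<le> f c"
  shows "0 \<le> part_max J L f c"
proof -
  obtain a b where ab: "(a, b) \<in> part_boxes J L c" "part_max J L f c = box_avg f (a, b)"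
    using part_max_attained[OF assms(1)] .
  have "grid_box a b \<subseteq> grid L" using ab by (intro grid_box_subset) (auto simp: part_boxes_def)
  then show ?thesis unfolding ab using assms
    by (auto simp: box_avg_def intro!: divide_nonneg_nonneg sum_nonneg prod_nonneg)
qed

text \<open>An extremal box is cut into slices orthogonal to \<open>j\<close>. Each slice is
  admissible for \<open>J\<close> at \<open>c(j := k)\<close>, so the average over the box is at
  most an average along a line of the smaller maximal function.\<close>

lemma part_max_insert_le:
  fixes f :: "('n::finite \<Rightarrow> nat) \<Rightarrow> real"
  assumes c: "c \<in> grid L" and j: "j \<notin> J"
  shows "\<exists>l u. l \<le> c j \<and> c j < u \<and> u \<le> L \<and>
     part_max (insert j J) L f c * real (u - l) \<le> (\<Sum>k=l..<u. part_max J L f (c(j := k)))"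
proof -
  obtain a b where ab: "(a, b) \<in> part_boxes (insert j J) L c" "part_max (insert j J) L f c = box_avg f (a, b)"
    using part_max_attained[OF c] .
  let ?Q = "\<Prod>i\<in>UNIV - {j}. real (b i - a i)"
  have lt: "a i < b i" for i using ab by (auto simp: part_boxes_def intro: le_less_trans)
  have Q: "0 < ?Q" using lt by (intro prod_pos) auto
  have prod: "(\<Prod>i\<in>UNIV. real (b i - a i)) = real (b j - a j) * ?Q"
    by (subst prod.remove[of _ j]) auto
  have "(\<Sum>c\<in>grid_box (a(j := k)) (b(j := Suc k)). f c) \<le> ?Q * part_max J L f (c(j := k))"
    if k: "k \<in> {a j..<b j}" for k
  proof -
    have "(a(j := k), b(j := Suc k)) \<in> part_boxes J L (c(j := k))"
      using ab(1) j k by (auto simp: part_boxes_def Suc_le_eq intro: less_le_trans)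
    then have "box_avg f (a(j := k), b(j := Suc k)) \<le> part_max J L f (c(j := k))"
      by (rule part_max_ge)
    moreover have "(\<Prod>i\<in>UNIV. real ((b(j := Suc k)) i - (a(j := k)) i)) = ?Q"
      by (subst prod.remove[of _ j]) (auto intro!: prod.cong)
    ultimately show ?thesis using Q by (simp add: box_avg_def pos_divide_le_eq mult.commute)
  qed
  then have "(\<Sum>c\<in>grid_box a b. f c) \<le> (\<Sum>k=a j..<b j. ?Q * part_max J L f (c(j := k)))"
    unfolding sum_grid_box_line[of _ a b j] by (intro sum_mono) auto
  then have "(\<Sum>c\<in>grid_box a b. f c) \<le> ?Q * (\<Sum>k=a j..<b j. part_max J L f (c(j := k)))"
    by (simp add: sum_distrib_left)
  moreover have "box_avg f (a, b) * real (b j - a j) = (\<Sum>c\<in>grid_box a b. f c) / ?Q"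
    using lt[of j] Q by (simp add: box_avg_def prod)
  ultimately have "box_avg f (a, b) * real (b j - a j) \<le> (\<Sum>k=a j..<b j. part_max J L f (c(j := k)))"
    using Q by (simp add: pos_divide_le_eq mult.commute)
  then show ?thesis using ab by (intro exI[of _ "a j"] exI[of _ "b j"]) (auto simp: part_boxes_def)
qed

lemma grid_box_line:
  "(\<Sum>d\<in>grid_box (c(j := l)) (\<lambda>i. if i = j then u else Suc (c i)). F d)
    = (\<Sum>k=l..<u. F (c(j := k)))"
proof -
  have "grid_box (c(j := l)) (\<lambda>i. if i = j then u else Suc (c i)) = (\<lambda>k. c(j := k)) ` {l..<u}"
  proof (intro equalityI subsetI)
    fix d assume d: "d \<in> grid_box (c(j := l)) (\<lambda>i. if i = j then u else Suc (c i))"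
    have d: "(c(j := l)) i \<le> d i \<and> d i < (if i = j then u else Suc (c i))" for i
      using d unfolding grid_box_def by blast
    have "d i = c i" if "i \<noteq> j" for i
      using d[of i] that by simp
    then have "d = c(j := d j)" by (simp add: fun_eq_iff)
    moreover have "d j \<in> {l..<u}" using d[of j] by simp
    ultimately show "d \<in> (\<lambda>k. c(j := k)) ` {l..<u}" by blast
  qed (auto simp: grid_box_def)
  moreover have "inj_on (\<lambda>k. c(j := k)) {l..<u}"
    by (auto simp: inj_on_def fun_eq_iff split: if_splits)
  ultimately show ?thesis by (simp add: sum.reindex)
qed

text \<open>The iteration of Jessen, Marcinkiewicz and Zygmund, with weights: adding a direction to
  \<open>J\<close> means applying \<open>line_Ap_bound\<close> on every line in this direction, at
  the price of one factor \<open>line_const\<close>.\<close>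

theorem grid_strong_maximal_bound:
  fixes v s f :: "('n::finite \<Rightarrow> nat) \<Rightarrow> real"
  assumes t: "1 < t" and K: "0 \<le> K"
  and v: "\<And>c. c \<in> grid L \<Longrightarrow> 0 < v c" and s: "\<And>c. c \<in> grid L \<Longrightarrow> 0 < s c"
  and vs: "\<And>c. c \<in> grid L \<Longrightarrow> 1 \<le> v c * s c powr (t - 1)"
  and Ap: "\<And>a b. (\<And>i. a i < b i) \<Longrightarrow> (\<And>i. b i \<le> L) \<Longrightarrow>
     (\<Sum>c\<in>grid_box a b. v c) * (\<Sum>c\<in>grid_box a b. s c) powr (t - 1)
       \<le> K * (\<Prod>i\<in>UNIV. real (b i - a i)) powr t"
  and f: "\<And>c. c \<in> grid L \<Longrightarrow> 0 \<le> f c"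
  shows "(\<Sum>c\<in>grid L. part_max J L f c powr t * v c)
       \<le> line_const t K ^ card J * (\<Sum>c\<in>grid L. f c powr t * v c)"
proof -
  have "finite J" by simp
  then show ?thesis
  proof (induction J)
    case empty
    have "part_max {} L f c = f c" if c: "c \<in> grid L" for c
    proof -
      obtain a b where ab: "(a, b) \<in> part_boxes {} L c" "part_max {} L f c = box_avg f (a, b)"
        using part_max_attained[OF c] .
      then have "a = c" "b = (\<lambda>i. Suc (c i))" by (auto simp: part_boxes_def fun_eq_iff)
      moreover have "grid_box c (\<lambda>i. Suc (c i)) = {c}"
        by (auto simp: grid_box_def fun_eq_iff less_Suc_eq_le intro: antisym)
      ultimately show ?thesis using ab by (simp add: box_avg_def)
    qed
    then show ?case by simp
  next
    case (insert j J)
    have "(\<Sum>k<L. part_max (insert j J) L f (c(j := k)) powr t * v (c(j := k)))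
        \<le> line_const t K * (\<Sum>k<L. part_max J L f (c(j := k)) powr t * v (c(j := k)))"
      if c: "c \<in> grid L" "c j = 0" for c
    proof (rule line_Ap_bound[OF t K, where s="\<lambda>k. s (c(j := k))"])
      have g: "c(j := k) \<in> grid L" if "k < L" for k using c that by (auto simp: grid_def)
      fix l u :: nat assume lu: "l < u" "u \<le> L"
      let ?b = "\<lambda>i. if i = j then u else Suc (c i)"
      have "(\<Sum>d\<in>grid_box (c(j := l)) ?b. v d) * (\<Sum>d\<in>grid_box (c(j := l)) ?b. s d) powr (t - 1)
         \<le> K * (\<Prod>i\<in>UNIV. real (?b i - (c(j := l)) i)) powr t"
        using lu c by (intro Ap) (auto simp: grid_def Suc_leI)
      moreover have "(\<Prod>i\<in>UNIV. real (?b i - (c(j := l)) i)) = real (u - l)"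
        by (subst prod.remove[of _ j]) auto
      ultimately show "(\<Sum>k=l..<u. v (c(j := k))) * (\<Sum>k=l..<u. s (c(j := k))) powr (t - 1)
         \<le> K * real (u - l) powr t"
        by (simp add: grid_box_line)
    next
      fix k assume k: "k < L"
      have g: "c(j := k) \<in> grid L" for k' using c k by (auto simp: grid_def)
      show "0 < v (c(j := k))" "0 < s (c(j := k))" "1 \<le> v (c(j := k)) * s (c(j := k)) powr (t - 1)"
        "0 \<le> part_max J L f (c(j := k))"
        using g v s vs part_max_nonneg[OF g f] by auto
      show "0 \<le> part_max (insert j J) L f (c(j := k)) \<and> (\<exists>l u. l \<le> k \<and> k < u \<and> u \<le> L \<and>
         part_max (insert j J) L f (c(j := k)) * real (u - l) \<le> (\<Sum>k=l..<u. part_max J L f (c(j := k))))"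
        using part_max_insert_le[OF g insert(2), of f] part_max_nonneg[OF g f] by auto
    qed
    then have "(\<Sum>c\<in>grid L. part_max (insert j J) L f c powr t * v c)
       \<le> (\<Sum>c\<in>{c\<in>grid L. c j = 0}. line_const t K * (\<Sum>k<L. part_max J L f (c(j := k)) powr t * v (c(j := k))))"
      unfolding sum_grid_line[of _ L j] by (intro sum_mono) auto
    also have "\<dots> = line_const t K * (\<Sum>c\<in>grid L. part_max J L f c powr t * v c)"
      unfolding sum_grid_line[of "\<lambda>c. part_max J L f c powr t * v c" L j] by (simp add: sum_distrib_left)
    also have "\<dots> \<le> line_const t K * (line_const t K ^ card J * (\<Sum>c\<in>grid L. f c powr t * v c))"
      by (intro mult_left_mono insert.IH line_const_nonneg)
    finally show ?case using insert by simp
  qed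
qed

section \<open>Powers and averages of extended nonnegative functions\<close>

lemma enn_powr_ennreal: "0 \<le> r \<Longrightarrow> enn_powr (ennreal r) a = ennreal (r powr a)"
  by (simp add: enn_powr_def)

lemma enn_powr_top [simp]: "enn_powr top a = top"
  by (simp add: enn_powr_def)

lemma enn_powr_0 [simp]: "enn_powr 0 a = 0"
  by (simp add: enn_powr_def)

lemma enn_powr_1 [simp]: "enn_powr 1 a = 1"
  by (simp add: enn_powr_def)

lemma enn_powr_one [simp]: "enn_powr x 1 = x"
  by (cases x) (auto simp: enn_powr_ennreal)

lemma enn_powr_eq_0_iff [simp]: "enn_powr x a = 0 \<longleftrightarrow> x = 0"
  by (cases x) (auto simp: enn_powr_ennreal)

lemma enn_powr_eq_top_iff [simp]: "enn_powr x a = top \<longleftrightarrow> x = top"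
  by (cases x) (auto simp: enn_powr_ennreal)

lemma enn_powr_less_top_iff [simp]: "enn_powr x a < top \<longleftrightarrow> x < top"
  by (simp add: less_top[symmetric])

lemma enn_powr_pos_iff [simp]: "0 < enn_powr x a \<longleftrightarrow> 0 < x"
  by (simp add: zero_less_iff_neq_zero)

lemma enn_powr_powr: "enn_powr (enn_powr x a) b = enn_powr x (a * b)"
  by (cases x) (auto simp: enn_powr_ennreal powr_powr)

lemma enn_powr_mult: "enn_powr (x * y) a = enn_powr x a * enn_powr y a"
proof (cases "x = top \<or> y = top")
  case True
  then show ?thesis by (auto simp: ennreal_mult_top ennreal_top_mult)
next
  case False
  then show ?thesis
    by (cases x; cases y) (auto simp: enn_powr_ennreal ennreal_mult[symmetric] powr_mult)
qed

lemma enn_powr_add: "0 < a \<Longrightarrow> 0 < b \<Longrightarrow> enn_powr x (a + b) = enn_powr x a * enn_powr x b"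
  by (cases x) (auto simp: enn_powr_ennreal ennreal_mult[symmetric] powr_add)

lemma enn_powr_prod: "enn_powr (\<Prod>i\<in>I. f i) a = (\<Prod>i\<in>I. enn_powr (f i) a)"
  by (induction I rule: infinite_finite_induct) (simp_all add: enn_powr_mult)

lemma enn_powr_mono: "0 \<le> a \<Longrightarrow> x \<le> y \<Longrightarrow> enn_powr x a \<le> enn_powr y a"
  by (cases x; cases y) (auto simp: enn_powr_ennreal powr_mono2 top_unique)

lemma enn_powr_le_self: "1 \<le> x \<Longrightarrow> a \<le> 1 \<Longrightarrow> enn_powr x a \<le> x"
proof (cases x)
  case (real r)
  assume "1 \<le> x" "a \<le> 1"
  then show ?thesis using real powr_mono[of a 1 r]
    by (simp add: enn_powr_ennreal ennreal_leI ennreal_1[symmetric] del: ennreal_1)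
qed simp

lemma enn_powr_le_iff: "0 < a \<Longrightarrow> enn_powr x a \<le> y \<longleftrightarrow> x \<le> enn_powr y (1 / a)"
  using enn_powr_mono[of a x "enn_powr y (1 / a)"] enn_powr_mono[of "1 / a" "enn_powr x a" y]
  by (auto simp: enn_powr_powr)

lemma enn_powr_inverse: "0 < a \<Longrightarrow> enn_powr (inverse x) a = inverse (enn_powr x a)"
  by (cases x rule: ennreal_cases, case_tac "r = 0")
    (auto simp: enn_powr_ennreal inverse_ennreal powr_minus_divide divide_inverse inverse_powr)

lemma enn_powr_SUP: "0 < a \<Longrightarrow> enn_powr (SUP i\<in>I. f i) a = (SUP i\<in>I. enn_powr (f i) a)"
proof (intro antisym)
  assume a: "0 < a"
  show "(SUP i\<in>I. enn_powr (f i) a) \<le> enn_powr (SUP i\<in>I. f i) a"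
    using a by (intro SUP_least enn_powr_mono SUP_upper) auto
  show "enn_powr (SUP i\<in>I. f i) a \<le> (SUP i\<in>I. enn_powr (f i) a)"
    unfolding enn_powr_le_iff[OF a]
    by (intro SUP_least) (use a in \<open>auto simp: enn_powr_le_iff[symmetric] intro: SUP_upper\<close>)
qed

lemma borel_measurable_enn_powr [measurable]:
  assumes [measurable]: "f \<in> borel_measurable M"
  shows "(\<lambda>x. enn_powr (f x) a) \<in> borel_measurable M"
  unfolding enn_powr_def by measurable

lemma borel_measurable_inverse_ennreal [measurable]:
  assumes [measurable]: "f \<in> borel_measurable M"
  shows "(\<lambda>x. inverse (f x :: ennreal)) \<in> borel_measurable M"
  by (rule borel_measurable_continuous_on[OF continuous_on_inverse_ennreal[OF continuous_on_id] assms])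

lemma prod_enn_powr_le_sum:
  fixes x :: "'i \<Rightarrow> ennreal"
  assumes I: "finite I" "I \<noteq> {}" and th: "\<And>i. i \<in> I \<Longrightarrow> 0 < \<theta> i" "(\<Sum>i\<in>I. \<theta> i) = 1"
  shows "(\<Prod>i\<in>I. enn_powr (x i) (\<theta> i)) \<le> (\<Sum>i\<in>I. ennreal (\<theta> i) * x i)"
proof (cases "\<exists>i\<in>I. x i = top")
  case True
  then obtain i where "i \<in> I" "x i = top" by auto
  then have "top = ennreal (\<theta> i) * x i"
    using th(1)[of i] by (simp add: ennreal_mult_top)
  also have "\<dots> \<le> (\<Sum>i\<in>I. ennreal (\<theta> i) * x i)"
    using I \<open>i \<in> I\<close> by (intro member_le_sum) auto
  finally show ?thesis by (simp add: top_unique)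
next
  case False
  define r where "r i = enn2real (x i)" for i
  have x: "x i = ennreal (r i)" and r: "0 \<le> r i" if "i \<in> I" for i
    using False that by (auto simp: r_def less_top)
  show ?thesis
  proof (cases "\<exists>i\<in>I. r i = 0")
    case True
    then obtain i where i: "i \<in> I" "x i = 0" using x by auto
    have "(\<Prod>i\<in>I. enn_powr (x i) (\<theta> i)) = 0"
      using I i by auto
    then show ?thesis by (simp only: zero_le)
  next
    case False
    then have pos: "0 < r i" if "i \<in> I" for i using r[OF that] that by (auto simp: less_le)
    have "(\<Sum>i\<in>I. \<theta> i * ln (r i)) \<le> ln (\<Sum>i\<in>I. \<theta> i *\<^sub>R r i)"
      by (rule concave_on_sum[OF I ln_concave th(2)]) (use pos th in \<open>auto intro: less_imp_le\<close>)
    moreover have "0 < (\<Sum>i\<in>I. \<theta> i *\<^sub>R r i)"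
      using I th pos by (intro sum_pos) auto
    ultimately have "exp (\<Sum>i\<in>I. \<theta> i * ln (r i)) \<le> (\<Sum>i\<in>I. \<theta> i * r i)"
      by (simp add: ln_ge_iff)
    moreover have "exp (\<Sum>i\<in>I. \<theta> i * ln (r i)) = (\<Prod>i\<in>I. r i powr \<theta> i)"
      unfolding exp_sum[OF I(1)] by (intro prod.cong refl) (use pos in \<open>simp add: powr_def less_imp_neq[symmetric]\<close>)
    moreover have "(\<Prod>i\<in>I. enn_powr (x i) (\<theta> i)) = ennreal (\<Prod>i\<in>I. r i powr \<theta> i)"
      using x r by (subst prod_ennreal[symmetric]) (auto simp: enn_powr_ennreal)
    moreover have "(\<Sum>i\<in>I. ennreal (\<theta> i) * x i) = ennreal (\<Sum>i\<in>I. \<theta> i * r i)"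
      using x r th by (subst sum_ennreal[symmetric]) (auto simp: ennreal_mult less_imp_le intro!: sum.cong)
    ultimately show ?thesis by (simp add: ennreal_leI)
  qed
qed

text \<open>Each function is normalised by its integral and the inequality between weighted means is
  integrated. A vanishing integral is treated before an infinite one, because
  \<open>0 * \<infinity> = 0\<close> on the right.\<close>

lemma nn_integral_Holder:
  fixes g :: "'i \<Rightarrow> 'a \<Rightarrow> ennreal"
  assumes I: "finite I" "I \<noteq> {}" and th: "\<And>i. i \<in> I \<Longrightarrow> 0 < \<theta> i" "(\<Sum>i\<in>I. \<theta> i) = 1"
  and g [measurable]: "\<And>i. i \<in> I \<Longrightarrow> g i \<in> borel_measurable M"
  shows "(\<integral>\<^sup>+x. (\<Prod>i\<in>I. enn_powr (g i x) (\<theta> i)) \<partial>M) \<le> (\<Prod>i\<in>I. enn_powr (\<integral>\<^sup>+x. g i x \<partial>M) (\<theta> i))"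
proof -
  define A where "A i = (\<integral>\<^sup>+x. g i x \<partial>M)" for i
  show ?thesis
  proof (cases "\<exists>i\<in>I. A i = 0")
    case True
    then obtain i where i: "i \<in> I" "A i = 0" by auto
    then have "AE x in M. g i x = 0" using g unfolding A_def by (subst (asm) nn_integral_0_iff_AE) auto
    then have "AE x in M. (\<Prod>i\<in>I. enn_powr (g i x) (\<theta> i)) = 0"
      by eventually_elim (use i I in auto)
    then have "(\<integral>\<^sup>+x. (\<Prod>i\<in>I. enn_powr (g i x) (\<theta> i)) \<partial>M) = 0"
      by (subst nn_integral_cong_AE[where v="\<lambda>_. 0"]) auto
    then show ?thesis by simp
  next
    case False
    note nz = this
    show ?thesis
    proof (cases "\<exists>i\<in>I. A i = top")
      case True
      then have "(\<Prod>i\<in>I. enn_powr (A i) (\<theta> i)) = top"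
        using nz I by (subst ennreal_prod_eq_top) auto
      then show ?thesis by (simp add: A_def)
    next
      case False
      have eq: "A i * (g i x / A i) = g i x" if "i \<in> I" for i x
        using nz False that by (simp add: ennreal_times_divide mult.commute[of "A i"] ennreal_mult_divide_eq)
      have "(\<integral>\<^sup>+x. (\<Prod>i\<in>I. enn_powr (g i x) (\<theta> i)) \<partial>M)
         = (\<integral>\<^sup>+x. (\<Prod>i\<in>I. enn_powr (A i) (\<theta> i)) * (\<Prod>i\<in>I. enn_powr (g i x / A i) (\<theta> i)) \<partial>M)"
        unfolding prod.distrib[symmetric] enn_powr_mult[symmetric]
        by (intro nn_integral_cong prod.cong refl) (simp add: eq)
      also have "\<dots> \<le> (\<integral>\<^sup>+x. (\<Prod>i\<in>I. enn_powr (A i) (\<theta> i)) * (\<Sum>i\<in>I. ennreal (\<theta> i) * (g i x / A i)) \<partial>M)"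
        by (intro nn_integral_mono mult_left_mono prod_enn_powr_le_sum I th) auto
      also have "\<dots> = (\<Prod>i\<in>I. enn_powr (A i) (\<theta> i)) * (\<Sum>i\<in>I. ennreal (\<theta> i) * (A i / A i))"
        by (subst nn_integral_cmult; (subst nn_integral_sum)?)
          (auto simp: nn_integral_cmult nn_integral_divide A_def)
      also have "(\<Sum>i\<in>I. ennreal (\<theta> i) * (A i / A i)) = 1"
        using nz False th by (simp add: less_top sum_ennreal less_imp_le)
      finally show ?thesis by (simp add: A_def)
    qed
  qed
qed

section \<open>Averages over rectangles\<close>

lemma rectangles_measure:
  fixes R :: "(real ^ 'n) set"
  assumes "R \<in> rectangles"
  shows "R \<in> sets lebesgue" "emeasure lebesgue R = ennreal (measure lebesgue R)" "0 < measure lebesgue R"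
    "emeasure lebesgue R \<noteq> 0" "emeasure lebesgue R < top"
proof -
  obtain a b where R: "R = box a b" "\<And>i. a $ i < b $ i" using assms by (auto simp: rectangles_def)
  show 1: "R \<in> sets lebesgue" using R by simp
  have "emeasure lborel (box a b) = ennreal (\<Prod>i\<in>Basis. (b - a) \<bullet> i)"
    using R by (intro emeasure_lborel_box) (auto simp: Basis_vec_def inner_axis less_imp_le)
  moreover have "0 < (\<Prod>i\<in>Basis. (b - a) \<bullet> i)"
    using R by (intro prod_pos) (auto simp: Basis_vec_def inner_axis)
  ultimately obtain P where 2: "emeasure lebesgue R = ennreal P" "0 < P"
    using R by auto
  then show "emeasure lebesgue R = ennreal (measure lebesgue R)" "0 < measure lebesgue R"
    "emeasure lebesgue R \<noteq> 0" "emeasure lebesgue R < top"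
    unfolding measure_def by (simp_all del: emeasure_completion add: less_imp_le)
qed

lemma avg_mono_AE:
  "AE x in lebesgue. x \<in> R \<longrightarrow> f x \<le> g x \<Longrightarrow> avg R f \<le> avg R g"
  unfolding avg_def by (intro divide_right_mono_ennreal nn_integral_mono_AE) (auto elim!: eventually_mono simp: indicator_def)

lemma avg_mono: "(\<And>x. x \<in> R \<Longrightarrow> f x \<le> g x) \<Longrightarrow> avg R f \<le> avg R g"
  by (intro avg_mono_AE) auto

lemma avg_cong_AE:
  "AE x in lebesgue. x \<in> R \<longrightarrow> f x = g x \<Longrightarrow> avg R f = avg R g"
  by (intro antisym avg_mono_AE) (auto elim!: eventually_mono)

lemma avg_const: "R \<in> rectangles \<Longrightarrow> avg R (\<lambda>_. c) = c"
  using rectangles_measure[of R] by (simp add: avg_def nn_integral_cmult_indicator ennreal_mult_divide_eq)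

lemma avg_cmult:
  "R \<in> rectangles \<Longrightarrow> f \<in> borel_measurable lebesgue \<Longrightarrow> avg R (\<lambda>x. c * f x) = c * avg R f"
  using rectangles_measure[of R]
  by (simp add: avg_def mult.assoc nn_integral_cmult ennreal_times_divide)

lemma avg_add:
  "R \<in> rectangles \<Longrightarrow> f \<in> borel_measurable lebesgue \<Longrightarrow> g \<in> borel_measurable lebesgue \<Longrightarrow>
    avg R (\<lambda>x. f x + g x) = avg R f + avg R g"
  using rectangles_measure[of R]
  by (simp add: avg_def distrib_right nn_integral_add add_divide_distrib_ennreal)

lemma nn_integral_eq_avg:
  "R \<in> rectangles \<Longrightarrow> (\<integral>\<^sup>+x\<in>R. f x \<partial>lebesgue) = avg R f * emeasure lebesgue R"
  using rectangles_measure[of R] by (simp add: avg_def ennreal_divide_times)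

lemma avg_Holder:
  assumes R: "R \<in> rectangles"
  and I: "finite I" "I \<noteq> {}" and th: "\<And>i. i \<in> I \<Longrightarrow> 0 < \<theta> i" "(\<Sum>i\<in>I. \<theta> i) = 1"
  and g [measurable]: "\<And>i. i \<in> I \<Longrightarrow> g i \<in> borel_measurable lebesgue"
  shows "avg R (\<lambda>x. \<Prod>i\<in>I. enn_powr (g i x) (\<theta> i)) \<le> (\<Prod>i\<in>I. enn_powr (avg R (g i)) (\<theta> i))"
proof -
  note RM = rectangles_measure[OF R]
  note [measurable] = RM(1)
  have ind: "(\<Prod>i\<in>I. enn_powr (g i x) (\<theta> i)) * indicator R x = (\<Prod>i\<in>I. enn_powr (g i x * indicator R x) (\<theta> i))" for x
    using I by (auto simp: indicator_def)
  have "(\<integral>\<^sup>+x\<in>R. (\<Prod>i\<in>I. enn_powr (g i x) (\<theta> i)) \<partial>lebesgue)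
     \<le> (\<Prod>i\<in>I. enn_powr (\<integral>\<^sup>+x\<in>R. g i x \<partial>lebesgue) (\<theta> i))"
    unfolding ind by (intro nn_integral_Holder I th) auto
  also have "\<dots> = (\<Prod>i\<in>I. enn_powr (avg R (g i)) (\<theta> i)) * (\<Prod>i\<in>I. enn_powr (emeasure lebesgue R) (\<theta> i))"
    by (simp add: nn_integral_eq_avg[OF R] enn_powr_mult prod.distrib)
  also have "(\<Prod>i\<in>I. enn_powr (emeasure lebesgue R) (\<theta> i)) = emeasure lebesgue R"
  proof -
    have "(\<Prod>i\<in>I. enn_powr (emeasure lebesgue R) (\<theta> i)) = ennreal (\<Prod>i\<in>I. measure lebesgue R powr \<theta> i)"
      unfolding RM(2) by (subst prod_ennreal[symmetric]) (auto simp: enn_powr_ennreal)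
    also have "(\<Prod>i\<in>I. measure lebesgue R powr \<theta> i) = measure lebesgue R"
      using RM(3) th(2) I by (simp add: powr_sum[symmetric])
    finally show ?thesis using RM(2) by simp
  qed
  finally show ?thesis
    unfolding nn_integral_eq_avg[OF R] using RM(4,5)
    by (simp del: emeasure_completion add: mult.commute[of _ "emeasure lebesgue R"] ennreal_mult_le_mult_iff)
qed

lemma avg_Holder2:
  assumes R: "R \<in> rectangles" and "0 < a" "0 < b" "a + b = 1"
  and f: "f \<in> borel_measurable lebesgue" and g: "g \<in> borel_measurable lebesgue"
  shows "avg R (\<lambda>x. enn_powr (f x) a * enn_powr (g x) b) \<le> enn_powr (avg R f) a * enn_powr (avg R g) b"
  using avg_Holder[OF R, of "UNIV :: bool set" "\<lambda>i. if i then a else b" "\<lambda>i. if i then f else g"] assms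
  by (simp add: UNIV_bool mult.commute add.commute)

lemma avg_Jensen:
  assumes R: "R \<in> rectangles" and s: "1 \<le> s" and [measurable]: "f \<in> borel_measurable lebesgue"
  shows "avg R f \<le> enn_powr (avg R (\<lambda>x. enn_powr (f x) s)) (1 / s)"
proof (cases "s = 1")
  case False
  then have s1: "1 < s" using s by simp
  have "avg R (\<lambda>x. enn_powr (enn_powr (f x) s) (1 / s) * enn_powr 1 (1 - 1 / s))
    \<le> enn_powr (avg R (\<lambda>x. enn_powr (f x) s)) (1 / s) * enn_powr (avg R (\<lambda>x. 1)) (1 - 1 / s)"
    using s1 by (intro avg_Holder2 R) auto
  then show ?thesis using s1 by (simp add: enn_powr_powr avg_const[OF R])
qed (use s in auto)

lemma avg_power_mean:
  assumes R: "R \<in> rectangles" and s: "0 < s" "s \<le> s'" and [measurable]: "f \<in> borel_measurable lebesgue"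
  shows "enn_powr (avg R (\<lambda>x. enn_powr (f x) s)) (1 / s) \<le> enn_powr (avg R (\<lambda>x. enn_powr (f x) s')) (1 / s')"
proof -
  have "avg R (\<lambda>x. enn_powr (f x) s) \<le> enn_powr (avg R (\<lambda>x. enn_powr (enn_powr (f x) s) (s' / s))) (1 / (s' / s))"
    using s by (intro avg_Jensen R) auto
  then have "enn_powr (avg R (\<lambda>x. enn_powr (f x) s)) (1 / s)
     \<le> enn_powr (enn_powr (avg R (\<lambda>x. enn_powr (f x) s')) (s / s')) (1 / s)"
    using s by (intro enn_powr_mono) (auto simp: enn_powr_powr)
  then show ?thesis using s by (simp add: enn_powr_powr)
qed

section \<open>The strong maximal function for Muckenhoupt weights\<close>

definition strong_max :: "(real ^ 'n \<Rightarrow> ennreal) \<Rightarrow> real ^ 'n \<Rightarrow> ennreal" where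
  "strong_max f x = (SUP R\<in>{R \<in> rectangles. x \<in> R}. avg R f)"

lemma avg_le_strong_max: "R \<in> rectangles \<Longrightarrow> x \<in> R \<Longrightarrow> avg R f \<le> strong_max f x"
  unfolding strong_max_def by (intro SUP_upper) auto

lemma emeasure_box_cart:
  fixes a b :: "real ^ 'n"
  assumes "\<And>i. a $ i \<le> b $ i"
  shows "emeasure lebesgue (box a b) = ennreal (\<Prod>i\<in>UNIV. b $ i - a $ i)"
proof -
  have "emeasure lborel (box a b) = ennreal (\<Prod>i\<in>Basis. (b - a) \<bullet> i)"
    using assms by (intro emeasure_lborel_box) (auto simp: Basis_vec_def inner_axis)
  also have "(\<Prod>i\<in>Basis. (b - a) \<bullet> i) = (\<Prod>i\<in>UNIV. b $ i - a $ i)"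
  proof -
    have B: "Basis = range (\<lambda>i::'n. axis i (1::real))" by (auto simp: Basis_vec_def)
    have inj: "inj (\<lambda>i::'n. axis i (1::real))" by (auto simp: inj_on_def axis_eq_axis)
    show ?thesis unfolding B prod.reindex[OF inj] by (simp add: inner_axis)
  qed
  finally show ?thesis by simp
qed

text \<open>Hyperplanes are null sets. This allows switching between half-open boxes, which tile,
  and open ones, which are the members of \<open>rectangles\<close>, and ignoring the planes along
  which rectangles are cut.\<close>

lemma AE_coordinates_neq:
  "AE x in lebesgue. \<forall>i. (x :: real ^ 'n) $ i \<noteq> c i"
proof -
  have "AE x in lebesgue. (x :: real ^ 'n) $ i \<noteq> c i" for i
  proof -
    have "{x :: real ^ 'n. x $ i = c i} \<in> null_sets lebesgue"
      using negligible_standard_hyperplane[of "axis i 1 :: real ^ 'n" "c i"]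
      by (simp add: negligible_iff_null_sets inner_axis axis_in_Basis_iff)
    from AE_not_in[OF this] show ?thesis by simp
  qed
  then show ?thesis by (simp add: AE_all_countable)
qed

section \<open>Discretisation on the mesh of side 1 / N\<close>

definition mesh_point :: "nat \<Rightarrow> ('n \<Rightarrow> nat) \<Rightarrow> real ^ 'n" where
  "mesh_point N a = (\<chi> i. real (a i) / real N - real N)"

text \<open>Half-open, so that mesh cells tile exactly; \<open>mesh_rect\<close> is the
  corresponding open rectangle and differs by a null set.\<close>

definition mesh_box :: "nat \<Rightarrow> ('n \<Rightarrow> nat) \<Rightarrow> ('n \<Rightarrow> nat) \<Rightarrow> (real ^ 'n) set" where
  "mesh_box N a b = {x. \<forall>i. mesh_point N a $ i \<le> x $ i \<and> x $ i < mesh_point N b $ i}"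

definition mesh_rect :: "nat \<Rightarrow> ('n \<Rightarrow> nat) \<Rightarrow> ('n \<Rightarrow> nat) \<Rightarrow> (real ^ 'n) set" where
  "mesh_rect N a b = box (mesh_point N a) (mesh_point N b)"

abbreviation succ :: "('n \<Rightarrow> nat) \<Rightarrow> 'n \<Rightarrow> nat" where
  "succ c \<equiv> \<lambda>i. Suc (c i)"

text \<open>\<open>nat\<close> sends everything below \<open>- real N\<close> to 0, which is why
  \<open>mem_mesh_box\<close> states the lower bound on the coordinates separately.\<close>

definition mesh_index :: "nat \<Rightarrow> real ^ 'n \<Rightarrow> 'n \<Rightarrow> nat" where
  "mesh_index N x i = nat \<lfloor>(x $ i + real N) * real N\<rfloor>"

lemma mem_mesh_box:
  assumes N: "0 < N"
  shows "x \<in> mesh_box N a b \<longleftrightarrow> (\<forall>i. - real N \<le> x $ i) \<and> mesh_index N x \<in> grid_box a b"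
proof -
  have "mesh_point N a $ i \<le> x $ i \<and> x $ i < mesh_point N b $ i \<longleftrightarrow>
     - real N \<le> x $ i \<and> a i \<le> mesh_index N x i \<and> mesh_index N x i < b i" for i
  proof (cases "- real N \<le> x $ i")
    case True
    have "mesh_point N a $ i \<le> x $ i \<longleftrightarrow> real (a i) \<le> (x $ i + real N) * real N"
      using N by (simp add: mesh_point_def field_simps)
    also have "\<dots> \<longleftrightarrow> a i \<le> mesh_index N x i"
      unfolding mesh_index_def using True N by (simp add: le_nat_iff le_floor_iff)
    finally have 1: "mesh_point N a $ i \<le> x $ i \<longleftrightarrow> a i \<le> mesh_index N x i" .
    have "x $ i < mesh_point N b $ i \<longleftrightarrow> (x $ i + real N) * real N < real (b i)"
      using N by (simp add: mesh_point_def field_simps)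
    also have "\<dots> \<longleftrightarrow> mesh_index N x i < b i"
      unfolding mesh_index_def using True N by (simp add: nat_less_iff floor_less_iff)
    finally show ?thesis using True 1 by simp
  next
    case False
    moreover have "- real N \<le> mesh_point N a $ i" by (simp add: mesh_point_def)
    ultimately show ?thesis by auto
  qed
  then show ?thesis unfolding mesh_box_def grid_box_def by auto
qed

lemma grid_box_succ: "grid_box c (succ c) = {c}"
  by (auto simp: grid_box_def fun_eq_iff less_Suc_eq_le intro: antisym)

lemma mesh_box_AE: "AE x in lebesgue. x \<in> mesh_box N a b \<longleftrightarrow> x \<in> mesh_rect N a b"
  using AE_coordinates_neq[of "\<lambda>i. mesh_point N a $ i"]
proof eventually_elim
  fix x assume "\<forall>i. x $ i \<noteq> mesh_point N a $ i"
  then have le: "mesh_point N a $ i \<le> x $ i \<longleftrightarrow> mesh_point N a $ i < x $ i" for i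
    by (metis order_le_less)
  show "x \<in> mesh_box N a b \<longleftrightarrow> x \<in> mesh_rect N a b"
    unfolding mesh_box_def mesh_rect_def mem_box_cart mem_Collect_eq le ..
qed

lemma mesh_rect_rectangle:
  assumes "0 < N" "\<And>i. a i < b i"
  shows "mesh_rect N a b \<in> rectangles"
proof -
  have "mesh_point N a $ i < mesh_point N b $ i" for i
    using assms(1) assms(2)[of i] by (simp add: mesh_point_def divide_strict_right_mono)
  then show ?thesis unfolding mesh_rect_def rectangles_def by blast
qed

lemma emeasure_mesh_rect:
  fixes a b :: "'n::finite \<Rightarrow> nat"
  assumes "0 < N" "\<And>i. a i < b i"
  shows "emeasure lebesgue (mesh_rect N a b) = ennreal (\<Prod>i\<in>UNIV. real (b i - a i)) * ennreal ((1 / real N) ^ CARD('n))"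
proof -
  have "emeasure lebesgue (mesh_rect N a b) = ennreal (\<Prod>i\<in>UNIV. mesh_point N b $ i - mesh_point N a $ i)"
    unfolding mesh_rect_def using assms
    by (intro emeasure_box_cart) (simp add: mesh_point_def divide_right_mono less_imp_le)
  also have "(\<Prod>i\<in>UNIV. mesh_point N b $ i - mesh_point N a $ i) = (\<Prod>i\<in>UNIV. real (b i - a i) * (1 / real N))"
    using assms by (intro prod.cong refl) (simp add: mesh_point_def of_nat_diff less_imp_le diff_divide_distrib)
  also have "\<dots> = (\<Prod>i\<in>UNIV. real (b i - a i)) * (1 / real N) ^ CARD('n)"
    unfolding prod.distrib by simp
  finally show ?thesis by (simp add: ennreal_mult prod_nonneg)
qed

lemma mesh_box_measurable [measurable]: "mesh_box N a b \<in> sets lebesgue"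
proof -
  have "mesh_box N a b = (\<Inter>i. {x. mesh_point N a $ i \<le> x $ i} \<inter> {x. x $ i < mesh_point N b $ i})"
    by (auto simp: mesh_box_def)
  also have "\<dots> \<in> sets borel"
    by (intro sets.finite_INT sets.Int borel_closed borel_open closed_halfspace_component_ge_cart
        open_halfspace_component_lt_cart) auto
  finally show ?thesis by simp
qed

lemma nn_integral_mesh:
  fixes a b :: "'n::finite \<Rightarrow> nat"
  assumes N: "0 < N" and [measurable]: "f \<in> borel_measurable lebesgue"
  shows "(\<integral>\<^sup>+x\<in>mesh_rect N a b. f x \<partial>lebesgue)
     = (\<Sum>c\<in>grid_box a b. \<integral>\<^sup>+x\<in>mesh_rect N c (succ c). f x \<partial>lebesgue)"
proof -
  have eq: "(\<integral>\<^sup>+x\<in>mesh_rect N a b. f x \<partial>lebesgue) = (\<integral>\<^sup>+x\<in>mesh_box N a b. f x \<partial>lebesgue)" for a b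
    using mesh_box_AE[of N a b] by (intro nn_integral_cong_AE) (auto elim!: eventually_mono simp: indicator_def)
  have fin: "finite (grid_box a b)"
    by (rule finite_subset[OF grid_box_subset[of b "Max (range b)"] finite_grid]) simp
  have "indicator (mesh_box N a b) x = (\<Sum>c\<in>grid_box a b. indicator (mesh_box N c (succ c)) x :: ennreal)" for x
    using fin by (auto simp: mem_mesh_box[OF N] grid_box_succ indicator_def)
  then have "(\<integral>\<^sup>+x\<in>mesh_box N a b. f x \<partial>lebesgue)
      = (\<integral>\<^sup>+x. (\<Sum>c\<in>grid_box a b. f x * indicator (mesh_box N c (succ c)) x) \<partial>lebesgue)"
    by (simp only: sum_distrib_left)
  also have "\<dots> = (\<Sum>c\<in>grid_box a b. \<integral>\<^sup>+x\<in>mesh_box N c (succ c). f x \<partial>lebesgue)"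
    by (rule nn_integral_sum) measurable
  finally show ?thesis by (simp only: eq)
qed

lemma avg_mesh:
  fixes a b :: "'n::finite \<Rightarrow> nat"
  assumes N: "0 < N" and ab: "\<And>i. a i < b i" and f: "f \<in> borel_measurable lebesgue"
  shows "avg (mesh_rect N a b) f * ennreal (\<Prod>i\<in>UNIV. real (b i - a i))
     = (\<Sum>c\<in>grid_box a b. avg (mesh_rect N c (succ c)) f)"
proof -
  define \<omega> where "\<omega> = ennreal ((1 / real N) ^ CARD('n))"
  have w: "\<omega> \<noteq> 0" "\<omega> \<noteq> top" using N by (simp_all add: \<omega>_def)
  have R: "mesh_rect N a b \<in> rectangles" by (rule mesh_rect_rectangle) (use N ab in auto)
  have em: "emeasure lebesgue (mesh_rect N a b) = ennreal (\<Prod>i\<in>UNIV. real (b i - a i)) * ennreal ((1 / real N) ^ CARD('n))"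
    by (rule emeasure_mesh_rect) (use N ab in auto)
  have "avg (mesh_rect N a b) f * ennreal (\<Prod>i\<in>UNIV. real (b i - a i)) * \<omega>
     = (\<integral>\<^sup>+x\<in>mesh_rect N a b. f x \<partial>lebesgue)"
    unfolding nn_integral_eq_avg[OF R, of f] em \<omega>_def by (rule mult.assoc)
  also have "\<dots> = (\<Sum>c\<in>grid_box a b. avg (mesh_rect N c (succ c)) f * \<omega>)"
    unfolding nn_integral_mesh[OF N f, of a b]
  proof (intro sum.cong refl)
    fix c :: "'n \<Rightarrow> nat"
    have Rc: "mesh_rect N c (succ c) \<in> rectangles" by (rule mesh_rect_rectangle) (use N in auto)
    have emc: "emeasure lebesgue (mesh_rect N c (succ c)) = ennreal (\<Prod>i\<in>UNIV. real (succ c i - c i)) * ennreal ((1 / real N) ^ CARD('n))"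
      by (rule emeasure_mesh_rect) (use N in auto)
    show "(\<integral>\<^sup>+x\<in>mesh_rect N c (succ c). f x \<partial>lebesgue) = avg (mesh_rect N c (succ c)) f * \<omega>"
      using emc unfolding nn_integral_eq_avg[OF Rc, of f] \<omega>_def
      by (simp del: emeasure_completion)
  qed
  finally have "\<omega> * (avg (mesh_rect N a b) f * ennreal (\<Prod>i\<in>UNIV. real (b i - a i)))
      = \<omega> * (\<Sum>c\<in>grid_box a b. avg (mesh_rect N c (succ c)) f)"
    by (simp only: sum_distrib_left mult.commute[of _ \<omega>])
  then show ?thesis using w by (simp only: ennreal_mult_cancel_left simp_thms)
qed

text \<open>\<open>h\<close> commutes with the outer supremum; at the inner infima monotonicity
  gives an inequality, in the direction that Fatou's lemma needs.\<close>

lemma liminf_compose_le: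
  fixes h :: "ennreal \<Rightarrow> ennreal" and u :: "nat \<Rightarrow> ennreal"
  assumes "mono h" "\<And>f :: nat \<Rightarrow> ennreal. h (SUP i. f i) = (SUP i. h (f i))"
  shows "h (liminf u) \<le> liminf (\<lambda>n. h (u n))"
  unfolding liminf_SUP_INF assms(2)
  by (intro SUP_mono' INF_greatest monoD[OF assms(1)] INF_lower) auto

text \<open>\<open>s\<close> plays the part of \<open>v powr (- 1 / (t - 1))\<close>. As a separate
  function it avoids negative powers of extended numbers; in the applications it is a product of
  powers of the other weights.\<close>

locale strong_Ap =
  fixes v s :: "real ^ 'n \<Rightarrow> ennreal" and t K :: real
  assumes t: "1 < t" and K: "0 \<le> K"
  and v_meas [measurable]: "v \<in> borel_measurable lebesgue"
  and s_meas [measurable]: "s \<in> borel_measurable lebesgue"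
  and v_avg: "\<And>R. R \<in> rectangles \<Longrightarrow> 0 < avg R v \<and> avg R v < top"
  and s_avg: "\<And>R. R \<in> rectangles \<Longrightarrow> 0 < avg R s \<and> avg R s < top"
  and vs: "AE x in lebesgue. 1 \<le> v x * enn_powr (s x) (t - 1)"
  and Ap: "\<And>R. R \<in> rectangles \<Longrightarrow> avg R v * enn_powr (avg R s) (t - 1) \<le> ennreal K"
begin

text \<open>Hoelder's inequality carries the pointwise lower bound over to averages. With
  \<open>Ap\<close>, cell averages of \<open>v\<close> and \<open>s\<close> therefore inherit all
  the hypotheses of the grid theorem.\<close>

lemma vs_avg:
  assumes R: "R \<in> rectangles"
  shows "1 \<le> avg R v * enn_powr (avg R s) (t - 1)"
proof -
  have "1 = avg R (\<lambda>x. 1)" using R by (simp add: avg_const)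
  also have "\<dots> \<le> avg R (\<lambda>x. enn_powr (v x) (1 / t) * enn_powr (s x) ((t - 1) / t))"
    using vs
  proof (intro avg_mono_AE, eventually_elim, intro impI)
    fix x assume "1 \<le> v x * enn_powr (s x) (t - 1)"
    then have "enn_powr 1 (1 / t) \<le> enn_powr (v x * enn_powr (s x) (t - 1)) (1 / t)"
      using t by (intro enn_powr_mono) auto
    then show "1 \<le> enn_powr (v x) (1 / t) * enn_powr (s x) ((t - 1) / t)"
      by (simp add: enn_powr_mult enn_powr_powr)
  qed
  also have "\<dots> \<le> enn_powr (avg R v) (1 / t) * enn_powr (avg R s) ((t - 1) / t)"
    using t by (intro avg_Holder2 R) (auto simp: add_divide_distrib[symmetric])
  finally have "enn_powr 1 t \<le> enn_powr (enn_powr (avg R v) (1 / t) * enn_powr (avg R s) ((t - 1) / t)) t"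
    using t by (intro enn_powr_mono) auto
  then show ?thesis using t by (simp add: enn_powr_mult enn_powr_powr)
qed

text \<open>Hoelder's inequality against \<open>s\<close>, after \<open>f\<close> is bounded by
  \<open>(f powr t * v) powr (1 / t)\<close> times \<open>s powr ((t - 1) / t)\<close>. It converts
  cell averages of \<open>f\<close> back to the norm of \<open>f\<close>, and shows that functions
  of finite norm have finite averages.\<close>

lemma avg_powr_le:
  assumes R: "R \<in> rectangles" and [measurable]: "f \<in> borel_measurable lebesgue"
  shows "enn_powr (avg R f) t * avg R v \<le> ennreal K * avg R (\<lambda>x. enn_powr (f x) t * v x)"
proof -
  have "avg R f \<le> avg R (\<lambda>x. enn_powr (enn_powr (f x) t * v x) (1 / t) * enn_powr (s x) ((t - 1) / t))"
    using vs
  proof (intro avg_mono_AE, eventually_elim, intro impI)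
    fix x assume "1 \<le> v x * enn_powr (s x) (t - 1)"
    then have "enn_powr 1 (1 / t) \<le> enn_powr (v x * enn_powr (s x) (t - 1)) (1 / t)"
      using t by (intro enn_powr_mono) auto
    then have "f x * 1 \<le> f x * (enn_powr (v x) (1 / t) * enn_powr (s x) ((t - 1) / t))"
      by (intro mult_left_mono) (auto simp: enn_powr_mult enn_powr_powr)
    then show "f x \<le> enn_powr (enn_powr (f x) t * v x) (1 / t) * enn_powr (s x) ((t - 1) / t)"
      using t by (simp add: enn_powr_mult enn_powr_powr mult.assoc)
  qed
  also have "\<dots> \<le> enn_powr (avg R (\<lambda>x. enn_powr (f x) t * v x)) (1 / t) * enn_powr (avg R s) ((t - 1) / t)"
    using t by (intro avg_Holder2 R) (auto simp: add_divide_distrib[symmetric])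
  finally have "enn_powr (avg R f) t \<le>
     enn_powr (enn_powr (avg R (\<lambda>x. enn_powr (f x) t * v x)) (1 / t) * enn_powr (avg R s) ((t - 1) / t)) t"
    using t by (intro enn_powr_mono) auto
  also have "\<dots> = avg R (\<lambda>x. enn_powr (f x) t * v x) * enn_powr (avg R s) (t - 1)"
    using t by (simp add: enn_powr_mult enn_powr_powr)
  finally have "enn_powr (avg R f) t * avg R v \<le>
      (avg R (\<lambda>x. enn_powr (f x) t * v x) * enn_powr (avg R s) (t - 1)) * avg R v"
    by (rule mult_right_mono) simp
  also have "\<dots> = (avg R v * enn_powr (avg R s) (t - 1)) * avg R (\<lambda>x. enn_powr (f x) t * v x)"
    by (simp add: mult_ac)
  also have "\<dots> \<le> ennreal K * avg R (\<lambda>x. enn_powr (f x) t * v x)"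
    by (intro mult_right_mono Ap R) auto
  finally show ?thesis .
qed

definition cell_avg :: "nat \<Rightarrow> (real ^ 'n \<Rightarrow> ennreal) \<Rightarrow> ('n \<Rightarrow> nat) \<Rightarrow> real" where
  "cell_avg N f c = enn2real (avg (mesh_rect N c (succ c)) f)"

text \<open>\<open>2 * N\<^sup>2\<close> cells of side \<open>1 / N\<close> cover the interval from
  \<open>- N\<close> to \<open>N\<close> in each direction; outside this cube the function is
  0.\<close>

definition mesh_max :: "nat \<Rightarrow> (real ^ 'n \<Rightarrow> ennreal) \<Rightarrow> real ^ 'n \<Rightarrow> ennreal" where
  "mesh_max N f x = (\<Sum>c\<in>grid (2 * N\<^sup>2). indicator (mesh_box N c (succ c)) x *
      ennreal (part_max UNIV (2 * N\<^sup>2) (cell_avg N f) c))"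

lemma mesh_max_eq:
  assumes "0 < N" "\<And>i. - real N \<le> x $ i" "mesh_index N x \<in> grid (2 * N\<^sup>2)"
  shows "mesh_max N f x = ennreal (part_max UNIV (2 * N\<^sup>2) (cell_avg N f) (mesh_index N x))"
proof -
  have "mesh_max N f x = (\<Sum>c\<in>grid (2 * N\<^sup>2). if c = mesh_index N x then
     ennreal (part_max UNIV (2 * N\<^sup>2) (cell_avg N f) c) else 0)"
    unfolding mesh_max_def using assms
    by (intro sum.cong refl) (auto simp: mem_mesh_box grid_box_succ indicator_def)
  then show ?thesis using assms by (simp add: finite_grid)
qed

lemma enn_powr_mesh_max:
  assumes N: "0 < N"
  shows "enn_powr (mesh_max N f x) t = (\<Sum>c\<in>grid (2 * N\<^sup>2). indicator (mesh_box N c (succ c)) x *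
      ennreal (part_max UNIV (2 * N\<^sup>2) (cell_avg N f) c powr t))"
proof (cases "(\<forall>i. - real N \<le> x $ i) \<and> mesh_index N x \<in> grid (2 * N\<^sup>2)")
  case True
  have "(\<Sum>c\<in>grid (2 * N\<^sup>2). indicator (mesh_box N c (succ c)) x *
      ennreal (part_max UNIV (2 * N\<^sup>2) (cell_avg N f) c powr t)) =
    (\<Sum>c\<in>grid (2 * N\<^sup>2). if c = mesh_index N x then
     ennreal (part_max UNIV (2 * N\<^sup>2) (cell_avg N f) c powr t) else 0)"
    using N True by (intro sum.cong refl) (auto simp: mem_mesh_box grid_box_succ indicator_def)
  moreover have "0 \<le> part_max UNIV (2 * N\<^sup>2) (cell_avg N f) (mesh_index N x)"
    using True by (intro part_max_nonneg) (auto simp: cell_avg_def)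
  ultimately show ?thesis using True N by (simp add: finite_grid mesh_max_eq enn_powr_ennreal)
next
  case False
  then have "indicator (mesh_box N c (succ c)) x = (0::ennreal)" if "c \<in> grid (2 * N\<^sup>2)" for c
    using N that by (auto simp: mem_mesh_box grid_box_succ indicator_def)
  then show ?thesis by (simp add: mesh_max_def)
qed

text \<open>The grid theorem for cell averages, whose common measure \<open>\<omega>\<close> factors
  out. The last factor \<open>K\<close> stems from \<open>avg_powr_le\<close>; no constant depends
  on \<open>N\<close>.\<close>

lemma mesh_max_bound:
  assumes N: "0 < N" and [measurable]: "f \<in> borel_measurable lebesgue"
  and fin: "\<And>R. R \<in> rectangles \<Longrightarrow> avg R f < top"
  shows "(\<integral>\<^sup>+x. enn_powr (mesh_max N f x) t * v x \<partial>lebesgue)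
     \<le> ennreal (line_const t K ^ CARD('n) * K) * (\<integral>\<^sup>+x. enn_powr (f x) t * v x \<partial>lebesgue)"
proof -
  define L where "L = 2 * N\<^sup>2"
  define V where "V = cell_avg N v"
  define S where "S = cell_avg N s"
  define F where "F = cell_avg N f"
  have cell: "mesh_rect N c (succ c) \<in> rectangles" for c :: "'n \<Rightarrow> nat"
    using N by (intro mesh_rect_rectangle) auto
  have Veq: "avg (mesh_rect N c (succ c)) v = ennreal (V c)" and V0: "0 < V c"
    and Seq: "avg (mesh_rect N c (succ c)) s = ennreal (S c)" and S0: "0 < S c"
    and Feq: "avg (mesh_rect N c (succ c)) f = ennreal (F c)" and F0: "0 \<le> F c" for c
    using v_avg[OF cell] s_avg[OF cell] fin[OF cell]
    by (auto simp: V_def S_def F_def cell_avg_def enn2real_positive_iff)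
  have disc: "(\<Sum>c\<in>grid L. part_max UNIV L F c powr t * V c)
       \<le> line_const t K ^ CARD('n) * (\<Sum>c\<in>grid L. F c powr t * V c)"
  proof (rule grid_strong_maximal_bound[OF t K, where s=S])
    fix c :: "'n \<Rightarrow> nat"
    show "1 \<le> V c * S c powr (t - 1)"
      using vs_avg[OF cell, of c] V0[of c] S0[of c]
      by (simp add: Veq Seq enn_powr_ennreal ennreal_mult[symmetric] ennreal_1[symmetric] del: ennreal_1)
  next
    fix a b :: "'n \<Rightarrow> nat" assume ab: "\<And>i. a i < b i"
    let ?R = "mesh_rect N a b"
    let ?P = "\<Prod>i\<in>UNIV. real (b i - a i)"
    have R: "?R \<in> rectangles" by (rule mesh_rect_rectangle) (use N ab in auto)
    have P: "0 < ?P" using ab by (intro prod_pos) auto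
    \<comment> \<open>Since all cells have the same measure, a sum of cell averages over a grid box
      is the average over the rectangle times the number of cells. This translates \<open>Ap\<close>
      into the grid condition.\<close>
    have *: "(\<Sum>c\<in>grid_box a b. enn2real (avg (mesh_rect N c (succ c)) g)) = enn2real (avg ?R g) * ?P"
      if g: "g \<in> borel_measurable lebesgue" "\<And>R. R \<in> rectangles \<Longrightarrow> avg R g < top" for g
    proof -
      have "ennreal (\<Sum>c\<in>grid_box a b. enn2real (avg (mesh_rect N c (succ c)) g))
        = (\<Sum>c\<in>grid_box a b. avg (mesh_rect N c (succ c)) g)"
        using g(2)[OF cell] by (subst sum_ennreal[symmetric]) auto
      also have "\<dots> = avg ?R g * ennreal ?P" by (rule avg_mesh[symmetric]) (use N ab g(1) in auto)
      also have "\<dots> = ennreal (enn2real (avg ?R g) * ?P)"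
        using g(2)[OF R] P by (simp add: ennreal_mult)
      finally show ?thesis using P by (subst (asm) ennreal_inj) (auto intro!: sum_nonneg)
    qed
    define V' where "V' = enn2real (avg ?R v)"
    define S' where "S' = enn2real (avg ?R s)"
    have "avg ?R v = ennreal V'" "avg ?R s = ennreal S'" "0 < V'" "0 < S'"
      using v_avg[OF R] s_avg[OF R] by (auto simp: V'_def S'_def enn2real_positive_iff)
    then have VS: "V' * S' powr (t - 1) \<le> K"
      using Ap[OF R] K by (simp add: enn_powr_ennreal ennreal_mult[symmetric])
    have "(\<Sum>c\<in>grid_box a b. V c) * (\<Sum>c\<in>grid_box a b. S c) powr (t - 1) = (V' * ?P) * (S' * ?P) powr (t - 1)"
      using *[of v] *[of s] v_avg s_avg by (simp add: V_def S_def cell_avg_def V'_def S'_def)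
    also have "\<dots> = (V' * S' powr (t - 1)) * (?P * ?P powr (t - 1))"
      using \<open>0 < S'\<close> P by (simp add: powr_mult mult_ac)
    also have "?P * ?P powr (t - 1) = ?P powr t" using P powr_add[of ?P 1 "t - 1"] by simp
    also have "(V' * S' powr (t - 1)) * ?P powr t \<le> K * ?P powr t"
      using VS by (intro mult_right_mono) auto
    finally show "(\<Sum>c\<in>grid_box a b. V c) * (\<Sum>c\<in>grid_box a b. S c) powr (t - 1) \<le> K * ?P powr t" .
  qed (use V0 S0 F0 in auto)
  define \<omega> where "\<omega> = (1 / real N) ^ CARD('n)"
  have w: "0 < \<omega>" using N by (simp add: \<omega>_def)
  have cell_int: "(\<integral>\<^sup>+x\<in>mesh_box N c (succ c). g x \<partial>lebesgue) = avg (mesh_rect N c (succ c)) g * ennreal \<omega>"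
    for c :: "'n \<Rightarrow> nat" and g
  proof -
    have "(\<integral>\<^sup>+x\<in>mesh_box N c (succ c). g x \<partial>lebesgue) = (\<integral>\<^sup>+x\<in>mesh_rect N c (succ c). g x \<partial>lebesgue)"
      using mesh_box_AE[of N c "succ c"] by (intro nn_integral_cong_AE) (auto elim!: eventually_mono simp: indicator_def)
    also have "\<dots> = avg (mesh_rect N c (succ c)) g * ennreal \<omega>"
      using emeasure_mesh_rect[OF N, of c "succ c"] unfolding nn_integral_eq_avg[OF cell]
      by (simp add: \<omega>_def del: emeasure_completion)
    finally show ?thesis .
  qed
  have pm0: "0 \<le> part_max UNIV L F c" if "c \<in> grid L" for c
    using that F0 by (intro part_max_nonneg) auto
  have "(\<integral>\<^sup>+x. enn_powr (mesh_max N f x) t * v x \<partial>lebesgue)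
     = (\<integral>\<^sup>+x. (\<Sum>c\<in>grid L. ennreal (part_max UNIV L F c powr t) * (v x * indicator (mesh_box N c (succ c)) x)) \<partial>lebesgue)"
    unfolding enn_powr_mesh_max[OF N] L_def[symmetric] F_def[symmetric] sum_distrib_right
    by (simp add: mult_ac)
  also have "\<dots> = (\<Sum>c\<in>grid L. ennreal (part_max UNIV L F c powr t) * (ennreal (V c) * ennreal \<omega>))"
    by (simp add: nn_integral_sum nn_integral_cmult cell_int Veq)
  also have "\<dots> = ennreal (\<Sum>c\<in>grid L. part_max UNIV L F c powr t * V c * \<omega>)"
    using V0 w by (subst sum_ennreal[symmetric]) (auto simp: ennreal_mult[symmetric] less_imp_le mult.assoc)
  also have "\<dots> \<le> ennreal (line_const t K ^ CARD('n) * (\<Sum>c\<in>grid L. F c powr t * V c * \<omega>))"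
    using disc w by (intro ennreal_leI) (simp add: sum_distrib_right[symmetric] mult.assoc[symmetric])
  also have "\<dots> = ennreal (line_const t K ^ CARD('n)) * ennreal (\<Sum>c\<in>grid L. F c powr t * V c * \<omega>)"
    using V0 w by (intro ennreal_mult sum_nonneg) (auto simp: line_const_nonneg less_imp_le)
  also have "ennreal (\<Sum>c\<in>grid L. F c powr t * V c * \<omega>)
      = (\<Sum>c\<in>grid L. ennreal (F c powr t) * ennreal (V c) * ennreal \<omega>)"
    using V0 w by (subst sum_ennreal[symmetric]) (auto simp: ennreal_mult less_imp_le)
  also have "(\<Sum>c\<in>grid L. ennreal (F c powr t) * ennreal (V c) * ennreal \<omega>)
     \<le> (\<Sum>c\<in>grid L. ennreal K * (avg (mesh_rect N c (succ c)) (\<lambda>x. enn_powr (f x) t * v x) * ennreal \<omega>))"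
  proof (intro sum_mono)
    fix c :: "'n \<Rightarrow> nat"
    have "ennreal (F c powr t) * ennreal (V c) = enn_powr (avg (mesh_rect N c (succ c)) f) t * avg (mesh_rect N c (succ c)) v"
      unfolding Feq Veq using F0 by (simp add: enn_powr_ennreal)
    also have "\<dots> \<le> ennreal K * avg (mesh_rect N c (succ c)) (\<lambda>x. enn_powr (f x) t * v x)"
      by (intro avg_powr_le cell) measurable
    finally show "ennreal (F c powr t) * ennreal (V c) * ennreal \<omega>
       \<le> ennreal K * (avg (mesh_rect N c (succ c)) (\<lambda>x. enn_powr (f x) t * v x) * ennreal \<omega>)"
      unfolding mult.assoc[symmetric] by (rule mult_right_mono) simp
  qed
  also have "\<dots> = ennreal K * (\<integral>\<^sup>+x. (\<Sum>c\<in>grid L. enn_powr (f x) t * v x * indicator (mesh_box N c (succ c)) x) \<partial>lebesgue)"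
    by (simp add: cell_int[symmetric] nn_integral_sum sum_distrib_left)
  also have "\<dots> \<le> ennreal K * (\<integral>\<^sup>+x. enn_powr (f x) t * v x \<partial>lebesgue)"
  proof (intro mult_left_mono nn_integral_mono)
    fix x :: "real ^ 'n"
    have "(\<Sum>c\<in>grid L. indicator (mesh_box N c (succ c)) x :: ennreal)
       \<le> (\<Sum>c\<in>grid L. if c = mesh_index N x then 1 else 0)"
      by (intro sum_mono) (auto simp: mem_mesh_box[OF N] grid_box_succ indicator_def)
    also have "\<dots> \<le> 1" by (simp add: finite_grid)
    finally have "enn_powr (f x) t * v x * (\<Sum>c\<in>grid L. indicator (mesh_box N c (succ c)) x) \<le> enn_powr (f x) t * v x * 1"
      by (rule mult_left_mono) simp
    then show "(\<Sum>c\<in>grid L. enn_powr (f x) t * v x * indicator (mesh_box N c (succ c)) x) \<le> enn_powr (f x) t * v x"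
      by (simp only: sum_distrib_left mult_1_right)
  qed auto
  finally have "(\<integral>\<^sup>+x. enn_powr (mesh_max N f x) t * v x \<partial>lebesgue)
     \<le> ennreal (line_const t K ^ CARD('n)) * (ennreal K * (\<integral>\<^sup>+x. enn_powr (f x) t * v x \<partial>lebesgue))"
    by (simp add: mult_left_mono)
  also have "\<dots> = ennreal (line_const t K ^ CARD('n) * K) * (\<integral>\<^sup>+x. enn_powr (f x) t * v x \<partial>lebesgue)"
    using K by (subst ennreal_mult) (auto simp: line_const_nonneg mult.assoc)
  finally show ?thesis .
qed

end

context strong_Ap
begin

lemma avg_le_mesh_max:
  assumes N: "0 < N" and [measurable]: "f \<in> borel_measurable lebesgue"
  and fin: "\<And>R. R \<in> rectangles \<Longrightarrow> avg R f < top"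
  and x: "x \<in> mesh_box N a b" and b: "\<And>i. b i \<le> 2 * N\<^sup>2"
  shows "avg (mesh_rect N a b) f \<le> mesh_max N f x"
proof -
  have x': "\<And>i. - real N \<le> x $ i" "mesh_index N x \<in> grid_box a b"
    using x by (auto simp: mem_mesh_box[OF N])
  then have ab: "a i \<le> mesh_index N x i" "mesh_index N x i < b i" for i by (auto simp: grid_box_def)
  then have lt: "a i < b i" for i by (rule le_less_trans)
  have R: "mesh_rect N a b \<in> rectangles" by (rule mesh_rect_rectangle) (use N lt in auto)
  have g: "mesh_index N x \<in> grid (2 * N\<^sup>2)" using x'(2) grid_box_subset[of b, OF b] by blast
  let ?P = "\<Prod>i\<in>UNIV. real (b i - a i)"
  have P: "0 < ?P" using lt by (intro prod_pos) auto
  have "avg (mesh_rect N a b) f * ennreal ?P = (\<Sum>c\<in>grid_box a b. avg (mesh_rect N c (succ c)) f)"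
    by (rule avg_mesh) (use N lt in auto)
  also have "\<dots> = (\<Sum>c\<in>grid_box a b. ennreal (cell_avg N f c))"
  proof (intro sum.cong refl)
    fix c :: "'n \<Rightarrow> nat"
    have "mesh_rect N c (succ c) \<in> rectangles" by (rule mesh_rect_rectangle) (use N in auto)
    then show "avg (mesh_rect N c (succ c)) f = ennreal (cell_avg N f c)"
      using fin by (simp add: cell_avg_def)
  qed
  also have "\<dots> = ennreal (\<Sum>c\<in>grid_box a b. cell_avg N f c)"
    by (rule sum_ennreal) (simp add: cell_avg_def)
  also have "(\<Sum>c\<in>grid_box a b. cell_avg N f c) = box_avg (cell_avg N f) (a, b) * ?P"
    unfolding box_avg_def prod.case using P by (metis less_irrefl nonzero_eq_divide_eq)
  also have "\<dots> = ennreal (box_avg (cell_avg N f) (a, b)) * ennreal ?P"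
    using P by (intro ennreal_mult) (auto simp: box_avg_def cell_avg_def intro!: divide_nonneg_pos sum_nonneg)
  finally have "avg (mesh_rect N a b) f = ennreal (box_avg (cell_avg N f) (a, b))"
    using P by (simp add: mult_right_ennreal_cancel)
  also have "\<dots> \<le> ennreal (part_max UNIV (2 * N\<^sup>2) (cell_avg N f) (mesh_index N x))"
    using ab b by (intro ennreal_leI part_max_ge) (auto simp: part_boxes_def)
  also have "\<dots> = mesh_max N f x" using mesh_max_eq[OF N x'(1) g] by simp
  finally show ?thesis .
qed

text \<open>Rounding the corners inwards gives mesh rectangles inside \<open>R\<close> that
  eventually contain any given point of \<open>R\<close>, so Fatou's lemma applies to their
  indicators. As they are no larger than \<open>R\<close>, replacing the measure of \<open>R\<close>
  by theirs only increases the quotient.\<close>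

lemma strong_max_le_liminf:
  assumes [measurable]: "f \<in> borel_measurable lebesgue"
  and fin: "\<And>R. R \<in> rectangles \<Longrightarrow> avg R f < top"
  shows "strong_max f x \<le> liminf (\<lambda>N. mesh_max N f x)"
  unfolding strong_max_def
proof (intro SUP_least)
  fix R assume "R \<in> {R \<in> rectangles. x \<in> R}"
  then have R: "R \<in> rectangles" and x: "x \<in> R" by auto
  from R obtain l u where lu: "R = box l u" "\<And>i. l $ i < u $ i" by (auto simp: rectangles_def)
  note RM = rectangles_measure[OF R]
  define a where "a N i = nat \<lceil>(l $ i + real N) * real N\<rceil>" for N i
  define b where "b N i = nat \<lfloor>(u $ i + real N) * real N\<rfloor>" for N i
  have ev: "\<forall>\<^sub>F N in sequentially. 0 < N \<and> (\<forall>i. - real N \<le> l $ i) \<and> (\<forall>i. u $ i \<le> real N)"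
  proof -
    have "\<forall>\<^sub>F N in sequentially. y \<le> real N" for y
      using filterlim_real_sequentially unfolding filterlim_at_top by auto
    from this[of "- l $ i" for i] this[of "u $ i" for i]
    have "\<forall>\<^sub>F N in sequentially. \<forall>i. - l $ i \<le> real N" "\<forall>\<^sub>F N in sequentially. \<forall>i. u $ i \<le> real N"
      by (auto intro!: eventually_all_finite)
    then show ?thesis using eventually_gt_at_top[of 0]
      by eventually_elim (auto simp: minus_le_iff)
  qed
  have coords: "l $ i \<le> mesh_point N (a N) $ i" "mesh_point N (a N) $ i < l $ i + 1 / real N"
      "mesh_point N (b N) $ i \<le> u $ i" "u $ i - 1 / real N < mesh_point N (b N) $ i" "b N i \<le> 2 * N\<^sup>2"
    if N: "0 < N" "\<And>i. - real N \<le> l $ i" "\<And>i. u $ i \<le> real N" for N i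
  proof -
    let ?L = "(l $ i + real N) * real N" and ?U = "(u $ i + real N) * real N"
    have L0: "0 \<le> ?L" using N(2)[of i] by simp
    have U0: "0 \<le> ?U" using N(2)[of i] lu(2)[of i] by simp
    have A: "?L \<le> real (a N i)" "real (a N i) < ?L + 1"
    proof -
      have "real (a N i) = of_int \<lceil>?L\<rceil>" using L0 by (simp add: a_def)
      then show "?L \<le> real (a N i)" "real (a N i) < ?L + 1" by linarith+
    qed
    have B: "real (b N i) \<le> ?U" "?U - 1 < real (b N i)"
    proof -
      have "real (b N i) = of_int \<lfloor>?U\<rfloor>" using U0 by (simp add: b_def)
      then show "real (b N i) \<le> ?U" "?U - 1 < real (b N i)" by linarith+
    qed
    show "l $ i \<le> mesh_point N (a N) $ i" "mesh_point N (a N) $ i < l $ i + 1 / real N"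
      using A divide_right_mono[OF A(1), of "real N"] divide_strict_right_mono[OF A(2), of "real N"] N(1)
      by (auto simp: mesh_point_def add_divide_distrib)
    show "mesh_point N (b N) $ i \<le> u $ i" "u $ i - 1 / real N < mesh_point N (b N) $ i"
      using B divide_right_mono[OF B(1), of "real N"] divide_strict_right_mono[OF B(2), of "real N"] N(1)
      by (auto simp: mesh_point_def diff_divide_distrib)
    have "?U \<le> (2 * real N) * real N" using N(3)[of i] by (intro mult_right_mono) auto
    then have "real (b N i) \<le> real (2 * N\<^sup>2)" using B by (simp add: power2_eq_square)
    then show "b N i \<le> 2 * N\<^sup>2" by (simp only: of_nat_le_iff)
  qed
  have mem: "\<forall>\<^sub>F N in sequentially. y \<in> mesh_box N (a N) (b N)" if y: "y \<in> R" for y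
  proof -
    have "\<forall>\<^sub>F N in sequentially. 1 / real N < e" if "0 < e" for e :: real
      using lim_1_over_n order_tendstoD(2)[OF lim_1_over_n that] by simp
    from this[of "y $ i - l $ i" for i] this[of "u $ i - y $ i" for i] y
    have "\<forall>\<^sub>F N in sequentially. \<forall>i. 1 / real N < y $ i - l $ i" "\<forall>\<^sub>F N in sequentially. \<forall>i. 1 / real N < u $ i - y $ i"
      by (auto intro!: eventually_all_finite simp: lu(1) mem_box_cart)
    with ev show ?thesis
    proof eventually_elim
      case (elim N)
      have "mesh_point N (a N) $ i \<le> y $ i \<and> y $ i < mesh_point N (b N) $ i" for i
        using coords(2,4)[of N i] elim by (smt (verit, best))
      then show ?case by (simp add: mesh_box_def)
    qed
  qed
  have int_f: "(\<integral>\<^sup>+y. f y * indicator R y / emeasure lebesgue R \<partial>lebesgue)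
     \<le> (\<integral>\<^sup>+y. liminf (\<lambda>N. f y * indicator (mesh_box N (a N) (b N)) y / emeasure lebesgue R) \<partial>lebesgue)"
  proof (intro nn_integral_mono)
    fix y
    show "f y * indicator R y / emeasure lebesgue R
       \<le> liminf (\<lambda>N. f y * indicator (mesh_box N (a N) (b N)) y / emeasure lebesgue R)"
    proof (cases "y \<in> R")
      case True
      show ?thesis
        by (intro Liminf_bounded eventually_mono[OF mem[OF True]]) (use True in simp)
    qed simp
  qed
  have "avg R f = (\<integral>\<^sup>+y. f y * indicator R y / emeasure lebesgue R \<partial>lebesgue)"
    unfolding avg_def using RM(1) by (subst nn_integral_divide) auto
  also note int_f
  also have "(\<integral>\<^sup>+y. liminf (\<lambda>N. f y * indicator (mesh_box N (a N) (b N)) y / emeasure lebesgue R) \<partial>lebesgue)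
     \<le> liminf (\<lambda>N. \<integral>\<^sup>+y. f y * indicator (mesh_box N (a N) (b N)) y / emeasure lebesgue R \<partial>lebesgue)"
    by (intro nn_integral_liminf) measurable
  also have "\<dots> \<le> liminf (\<lambda>N. mesh_max N f x)"
  proof (rule Liminf_mono)
    show "\<forall>\<^sub>F N in sequentially. (\<integral>\<^sup>+y. f y * indicator (mesh_box N (a N) (b N)) y / emeasure lebesgue R \<partial>lebesgue)
        \<le> mesh_max N f x"
      using ev mem[OF x]
    proof eventually_elim
      case (elim N)
      then have N: "0 < N" and co: "- real N \<le> l $ i" "u $ i \<le> real N" for i by auto
      let ?Q = "mesh_rect N (a N) (b N)"
      have ab: "a N i < b N i" for i
        using elim(2) unfolding mem_mesh_box[OF N] grid_box_def by (auto intro: le_less_trans)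
      have Q: "?Q \<in> rectangles" by (rule mesh_rect_rectangle) (use N ab in auto)
      have "?Q \<subseteq> R"
        unfolding mesh_rect_def lu(1)
      proof
        fix y assume "y \<in> box (mesh_point N (a N)) (mesh_point N (b N))"
        then have "l $ i < y $ i \<and> y $ i < u $ i" for i
          using coords(1,3)[OF N co, of i] unfolding mem_box_cart by (meson le_less_trans less_le_trans)
        then show "y \<in> box l u" by (simp add: mem_box_cart)
      qed
      then have le: "emeasure lebesgue ?Q \<le> emeasure lebesgue R" using RM(1) by (rule emeasure_mono)
      have "(\<integral>\<^sup>+y. f y * indicator (mesh_box N (a N) (b N)) y / emeasure lebesgue R \<partial>lebesgue)
         = (\<integral>\<^sup>+y\<in>mesh_box N (a N) (b N). f y \<partial>lebesgue) / emeasure lebesgue R"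
        by (intro nn_integral_divide) measurable
      also have "(\<integral>\<^sup>+y\<in>mesh_box N (a N) (b N). f y \<partial>lebesgue) = (\<integral>\<^sup>+y\<in>?Q. f y \<partial>lebesgue)"
        using mesh_box_AE[of N "a N" "b N"]
        by (intro nn_integral_cong_AE) (auto elim!: eventually_mono simp: indicator_def)
      also have "\<dots> / emeasure lebesgue R = avg ?Q f * (emeasure lebesgue ?Q / emeasure lebesgue R)"
        unfolding nn_integral_eq_avg[OF Q] by (simp only: ennreal_times_divide)
      also have "\<dots> \<le> avg ?Q f * 1"
        using le RM(4,5) by (intro mult_left_mono divide_le_posI_ennreal) (auto simp: zero_less_iff_neq_zero)
      also have "avg ?Q f \<le> mesh_max N f x"
        by (rule avg_le_mesh_max) (use N fin elim coords(5)[OF N co] in auto)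
      finally show ?case by simp
    qed
  qed
  finally show "avg R f \<le> liminf (\<lambda>N. mesh_max N f x)" .
qed

lemma mesh_max_measurable [measurable]: "mesh_max N f \<in> borel_measurable lebesgue"
  unfolding mesh_max_def by measurable

theorem strong_max_bound:
  assumes f [measurable]: "f \<in> borel_measurable lebesgue"
  shows "(\<integral>\<^sup>+x. enn_powr (strong_max f x) t * v x \<partial>lebesgue)
     \<le> ennreal (line_const t K ^ CARD('n) * K + 1) * (\<integral>\<^sup>+x. enn_powr (f x) t * v x \<partial>lebesgue)"
    (is "_ \<le> ennreal ?C * ?I")
proof (cases "?I = top")
  case True
  \<comment> \<open>The summand 1 in the constant makes the right-hand side infinite whenever the
    norm of \<open>f\<close> is.\<close>
  have "0 < ?C" using K by (intro add_nonneg_pos) (auto simp: line_const_nonneg)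
  then show ?thesis using True by (simp add: ennreal_mult_top)
next
  case False
  have fin: "avg R f < top" if R: "R \<in> rectangles" for R
  proof -
    have "enn_powr (avg R f) t * avg R v \<le> ennreal K * avg R (\<lambda>x. enn_powr (f x) t * v x)"
      by (intro avg_powr_le R f)
    also have "avg R (\<lambda>x. enn_powr (f x) t * v x) \<le> ?I / emeasure lebesgue R"
      unfolding avg_def by (intro divide_right_mono_ennreal nn_integral_mono) (auto simp: indicator_def)
    finally have "enn_powr (avg R f) t * avg R v \<le> ennreal K * (?I / emeasure lebesgue R)"
      by (simp add: mult_left_mono)
    also have "\<dots> < top"
    proof -
      have "?I / emeasure lebesgue R < top"
        unfolding less_top[symmetric] ennreal_divide_eq_top_iff
        using False rectangles_measure(4,5)[OF R] by blast
      then show ?thesis by (simp only: ennreal_mult_less_top ennreal_less_top simp_thms)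
    qed
    finally show ?thesis using v_avg[OF R] by (auto simp: ennreal_mult_less_top)
  qed
  have "(\<integral>\<^sup>+x. enn_powr (strong_max f x) t * v x \<partial>lebesgue)
     \<le> (\<integral>\<^sup>+x. liminf (\<lambda>N. enn_powr (mesh_max N f x) t * v x) \<partial>lebesgue)"
  proof (intro nn_integral_mono)
    fix x
    have "enn_powr (strong_max f x) t * v x \<le> enn_powr (liminf (\<lambda>N. mesh_max N f x)) t * v x"
      using t by (intro mult_right_mono enn_powr_mono strong_max_le_liminf f fin) auto
    also have "\<dots> \<le> liminf (\<lambda>N. enn_powr (mesh_max N f x) t * v x)"
      using t by (intro liminf_compose_le)
        (auto intro!: monoI mult_right_mono enn_powr_mono simp: enn_powr_SUP SUP_mult_right_ennreal)
    finally show "enn_powr (strong_max f x) t * v x \<le> liminf (\<lambda>N. enn_powr (mesh_max N f x) t * v x)" .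
  qed
  also have "\<dots> \<le> liminf (\<lambda>N. \<integral>\<^sup>+x. enn_powr (mesh_max N f x) t * v x \<partial>lebesgue)"
    by (intro nn_integral_liminf) measurable
  also have "\<dots> \<le> liminf (\<lambda>N::nat. ennreal ?C * ?I)"
  proof (rule Liminf_mono)
    show "\<forall>\<^sub>F N in sequentially. (\<integral>\<^sup>+x. enn_powr (mesh_max N f x) t * v x \<partial>lebesgue) \<le> ennreal ?C * ?I"
      using eventually_gt_at_top[of 0]
    proof eventually_elim
      case (elim N)
      have "(\<integral>\<^sup>+x. enn_powr (mesh_max N f x) t * v x \<partial>lebesgue) \<le> ennreal (line_const t K ^ CARD('n) * K) * ?I"
        by (intro mesh_max_bound elim f fin)
      also have "\<dots> \<le> ennreal ?C * ?I" by (intro mult_right_mono ennreal_leI) auto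
      finally show ?case .
    qed
  qed
  also have "\<dots> = ennreal ?C * ?I" by (simp add: Liminf_const)
  finally show ?thesis .
qed

end

section \<open>The reverse Hoelder inequality\<close>

text \<open>With \<open>a = t - 1\<close>, \<open>x\<close> and \<open>y\<close> are averages of the
  weight and of its dual, so that \<open>x * y powr a\<close> lies between 1 and \<open>K\<close>.
  There the subtracted term is comparable with \<open>x powr (1 + \<delta>)\<close>: it keeps the
  function between \<open>x powr (1 + \<delta>)\<close> and twice this power, and for small
  \<open>\<delta>\<close> its convexity outweighs that of the first term.\<close>

definition bellman :: "real \<Rightarrow> real \<Rightarrow> real \<Rightarrow> real \<Rightarrow> real" where
  "bellman a \<delta> x y = 2 * x powr (1 + \<delta>) - x powr (\<delta> - 1) * y powr (- 2 * a)"

text \<open>The expression is the second derivative of the negative of \<open>bellman\<close> in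
  direction \<open>(p, r)\<close>. In the relative velocities \<open>\<xi>\<close> and
  \<open>\<eta>\<close> its first three terms are \<open>M\<close> times a sum of squares containing
  \<open>(1 - \<delta>) * \<xi>\<^sup>2\<close>; the last term is at most \<open>M * \<xi>\<^sup>2 *
  (2 * \<delta> * (1 + \<delta>) * K\<^sup>2)\<close> in size, which this square absorbs.\<close>

lemma bellman_second_derivative_nonneg:
  fixes X Y p r a \<delta> K :: real
  assumes X: "0 < X" and Y: "0 < Y" and a: "0 < a" and d: "0 < \<delta>" "\<delta> < 1"
  and K: "0 < K" "X * Y powr a \<le> K" "2 * \<delta> * (1 + \<delta>) * K\<^sup>2 \<le> 1 - \<delta>"
  shows "0 \<le> (\<delta> - 1) * (\<delta> - 2) * p\<^sup>2 * X powr (\<delta> - 3) * Y powr (- 2 * a)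
      + 2 * (\<delta> - 1) * (- 2 * a) * p * r * X powr (\<delta> - 2) * Y powr (- 2 * a - 1)
      + (- 2 * a) * (- 2 * a - 1) * r\<^sup>2 * X powr (\<delta> - 1) * Y powr (- 2 * a - 2)
      - 2 * (1 + \<delta>) * \<delta> * p\<^sup>2 * X powr (\<delta> - 1)" (is "0 \<le> ?D")
proof -
  define M where "M = X powr (\<delta> - 1) * Y powr (- 2 * a)"
  define \<xi> where "\<xi> = p / X"
  define \<eta> where "\<eta> = r / Y"
  have p: "p = \<xi> * X" and r: "r = \<eta> * Y" using X Y by (auto simp: \<xi>_def \<eta>_def)
  have e: "X powr (\<delta> - 3) = X powr (\<delta> - 1) / X\<^sup>2" "X powr (\<delta> - 2) = X powr (\<delta> - 1) / X"
    "Y powr (- 2 * a - 1) = Y powr (- 2 * a) / Y" "Y powr (- 2 * a - 2) = Y powr (- 2 * a) / Y\<^sup>2"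
    "X powr (1 + \<delta>) = X powr (\<delta> - 1) * X\<^sup>2"
    using X Y powr_diff[of X "\<delta> - 1" 2] powr_diff[of X "\<delta> - 1" 1] powr_diff[of Y "- 2 * a" 1]
      powr_diff[of Y "- 2 * a" 2] powr_add[of X "\<delta> - 1" 2]
    by (simp_all add: algebra_simps)
  have eq: "?D = M * (((1 - \<delta>) * \<xi> + 2 * a * \<eta>)\<^sup>2 + (1 - \<delta>) * \<xi>\<^sup>2 + 2 * a * \<eta>\<^sup>2)
      - 2 * (1 + \<delta>) * \<delta> * \<xi>\<^sup>2 * X powr (1 + \<delta>)"
    unfolding e M_def p r using X Y by (simp add: field_simps power2_eq_square)
  have "X powr (1 + \<delta>) = M * (X * Y powr a)\<^sup>2"
  proof -
    have "(Y powr a)\<^sup>2 = Y powr (2 * a)" using Y by (simp add: powr_powr[symmetric] power2_eq_square powr_add[symmetric])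
    then show ?thesis unfolding e M_def using Y by (simp add: power_mult_distrib powr_minus field_simps)
  qed
  also have "\<dots> \<le> M * K\<^sup>2"
    using K X by (intro mult_left_mono power_mono) (auto simp: M_def)
  finally have "2 * (1 + \<delta>) * \<delta> * \<xi>\<^sup>2 * X powr (1 + \<delta>) \<le> 2 * (1 + \<delta>) * \<delta> * \<xi>\<^sup>2 * (M * K\<^sup>2)"
    using d by (intro mult_left_mono) auto
  also have "\<dots> = M * \<xi>\<^sup>2 * (2 * \<delta> * (1 + \<delta>) * K\<^sup>2)" by (simp add: mult_ac)
  also have "\<dots> \<le> M * \<xi>\<^sup>2 * (1 - \<delta>)"
    using K by (intro mult_left_mono) (auto simp: M_def)
  also have "\<dots> \<le> M * (((1 - \<delta>) * \<xi> + 2 * a * \<eta>)\<^sup>2 + (1 - \<delta>) * \<xi>\<^sup>2 + 2 * a * \<eta>\<^sup>2)"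
    using a d unfolding mult.assoc by (intro mult_left_mono) (auto simp: M_def mult_ac)
  finally show ?thesis unfolding eq by simp
qed

text \<open>
  The segment between two halves may leave the domain \<open>x * y powr a \<le> K\<close>, but only by the factor
  \<open>2 powr (1 + a)\<close>.
\<close>

lemma bellman_midpoint:
  fixes a \<delta> K :: real
  assumes pos: "0 < x1" "0 < x2" "0 < y1" "0 < y2" and a: "0 < a" and d: "0 < \<delta>" "\<delta> < 1"
  and K: "0 < K" "((x1 + x2) / 2) * ((y1 + y2) / 2) powr a \<le> K"
    "2 * \<delta> * (1 + \<delta>) * (2 powr (1 + a) * K)\<^sup>2 \<le> 1 - \<delta>"
  shows "(bellman a \<delta> x1 y1 + bellman a \<delta> x2 y2) / 2 \<le> bellman a \<delta> ((x1 + x2) / 2) ((y1 + y2) / 2)"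
proof -
  define x where "x = (x1 + x2) / 2"
  define y where "y = (y1 + y2) / 2"
  define p where "p = (x2 - x1) / 2"
  define r where "r = (y2 - y1) / 2"
  have xy: "x1 = x - p" "x2 = x + p" "y1 = y - r" "y2 = y + r"
    by (simp_all add: x_def y_def p_def r_def field_simps)
  \<comment> \<open>The negative of \<open>bellman\<close> along the segment, with the halves at the
    parameters -1 and 1 and the parent at 0.\<close>
  define g where "g t = (x + t * p) powr (\<delta> - 1) * (y + t * r) powr (- 2 * a) - 2 * (x + t * p) powr (1 + \<delta>)" for t
  define g' where "g' t = (\<delta> - 1) * p * ((x + t * p) powr (\<delta> - 2) * (y + t * r) powr (- 2 * a))
     + (- 2 * a) * r * ((x + t * p) powr (\<delta> - 1) * (y + t * r) powr (- 2 * a - 1))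
     - 2 * (1 + \<delta>) * p * (x + t * p) powr \<delta>" for t
  define g'' where "g'' t = (\<delta> - 1) * (\<delta> - 2) * p\<^sup>2 * (x + t * p) powr (\<delta> - 3) * (y + t * r) powr (- 2 * a)
      + 2 * (\<delta> - 1) * (- 2 * a) * p * r * (x + t * p) powr (\<delta> - 2) * (y + t * r) powr (- 2 * a - 1)
      + (- 2 * a) * (- 2 * a - 1) * r\<^sup>2 * (x + t * p) powr (\<delta> - 1) * (y + t * r) powr (- 2 * a - 2)
      - 2 * (1 + \<delta>) * \<delta> * p\<^sup>2 * (x + t * p) powr (\<delta> - 1)" for t
  have segment: "0 < x + t * p" "0 < y + t * r" "x + t * p \<le> 2 * x" "y + t * r \<le> 2 * y"
    if t: "t \<in> {-1..1}" for t
  proof -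
    have *: "\<bar>t * p\<bar> \<le> \<bar>p\<bar>" "\<bar>t * r\<bar> \<le> \<bar>r\<bar>"
      using t by (auto simp: abs_mult abs_le_iff intro!: mult_left_le_one_le)
    have "\<bar>p\<bar> < x" "\<bar>r\<bar> < y" using pos xy by (auto simp: abs_if)
    with * show "0 < x + t * p" "0 < y + t * r" "x + t * p \<le> 2 * x" "y + t * r \<le> 2 * y"
      by linarith+
  qed
  have "convex_on {-1..1} g"
  proof (rule f''_ge0_imp_convex)
    fix t :: real assume t: "t \<in> {-1..1}"
    note s = segment[OF t]
    show "DERIV g t :> g' t"
      unfolding g_def g'_def using s
      by (auto intro!: derivative_eq_intros simp: algebra_simps)
    show "DERIV g' t :> g'' t"
      unfolding g''_def g'_def using s
      by (auto intro!: derivative_eq_intros simp: algebra_simps power2_eq_square)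
    have "(x + t * p) * (y + t * r) powr a \<le> (2 * x) * (2 * y) powr a"
      using s a by (intro mult_mono powr_mono2) auto
    also have "\<dots> = 2 powr (1 + a) * (x * y powr a)"
    proof -
      have "0 < y" using pos by (simp add: y_def)
      then show ?thesis by (simp add: powr_mult powr_add)
    qed
    also have "\<dots> \<le> 2 powr (1 + a) * K"
      using K(2) by (intro mult_left_mono) (auto simp: x_def y_def)
    finally show "0 \<le> g'' t"
      unfolding g''_def using s a d K by (intro bellman_second_derivative_nonneg[where K="2 powr (1 + a) * K"]) auto
  qed (rule convex_real_interval)
  from convex_onD[OF this, of "1/2" "-1" 1] have "g 0 \<le> (g (-1) + g 1) / 2" by simp
  then show ?thesis
    unfolding x_def[symmetric] y_def[symmetric]
    unfolding xy by (simp add: g_def bellman_def)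
qed

text \<open>The lower constraint makes the subtracted term at most half of the leading one.\<close>

lemma bellman_ge:
  assumes "0 < x" "0 < y" "1 \<le> x * y powr a"
  shows "x powr (1 + \<delta>) \<le> bellman a \<delta> x y"
proof -
  have "x powr (\<delta> - 1) * y powr (- 2 * a) * 1 \<le> x powr (\<delta> - 1) * y powr (- 2 * a) * (x * y powr a)\<^sup>2"
    using assms by (intro mult_left_mono) (auto simp: one_le_power)
  also have "\<dots> = (x powr (\<delta> - 1) * x powr 2) * (y powr (- 2 * a) * (y powr a) powr 2)"
    using assms by (simp add: power_mult_distrib mult_ac)
  also have "\<dots> = x powr (1 + \<delta>)"
    using assms by (simp only: powr_powr powr_add[symmetric]) (simp add: algebra_simps)
  finally show ?thesis by (simp add: bellman_def)
qed

section \<open>Successive halvings of a rectangle\<close>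

definition set_coord :: "real ^ 'n \<Rightarrow> 'n \<Rightarrow> real \<Rightarrow> real ^ 'n" where
  "set_coord u j m = (\<chi> i. if i = j then m else u $ i)"

lemma set_coord_nth [simp]: "set_coord u j m $ i = (if i = j then m else u $ i)"
  by (simp add: set_coord_def)

text \<open>Dyadic descent as a function of the point: the list prescribes the directions of the
  cuts, so inductions run over lists instead of families of subrectangles. Points on a cutting plane
  go to the upper half, which affects a null set only.\<close>

fun leaf :: "'n list \<Rightarrow> (real ^ 'n) \<times> (real ^ 'n) \<Rightarrow> real ^ 'n \<Rightarrow> (real ^ 'n) \<times> (real ^ 'n)" where
  "leaf [] (l, u) x = (l, u)"
| "leaf (j # js) (l, u) x = (let m = (l $ j + u $ j) / 2 in
     if x $ j < m then leaf js (l, set_coord u j m) x else leaf js (set_coord l j m, u) x)"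

definition leaf_box :: "'n list \<Rightarrow> real ^ 'n \<Rightarrow> real ^ 'n \<Rightarrow> real ^ 'n \<Rightarrow> (real ^ 'n) set" where
  "leaf_box js l u x = (case leaf js (l, u) x of (l', u') \<Rightarrow> box l' u')"

lemma leaf_box_Nil: "leaf_box [] l u x = box l u"
  by (simp add: leaf_box_def)

lemma leaf_box_Cons:
  "leaf_box (j # js) l u x = (let m = (l $ j + u $ j) / 2 in
     if x $ j < m then leaf_box js l (set_coord u j m) x else leaf_box js (set_coord l j m) u x)"
  by (simp add: leaf_box_def Let_def)

lemma half_lt:
  assumes "\<And>i. l $ i < u $ i"
  shows "l $ i < set_coord u j ((l $ j + u $ j) / 2) $ i" "set_coord l j ((l $ j + u $ j) / 2) $ i < u $ i"
  using assms[of i] by auto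

lemma rectangles_box: "(\<And>i. l $ i < u $ i) \<Longrightarrow> box l u \<in> rectangles"
  by (auto simp: rectangles_def)

lemma leaf_box_rectangle: "(\<And>i. l $ i < u $ i) \<Longrightarrow> leaf_box js l u x \<in> rectangles"
proof (induction js arbitrary: l u)
  case (Cons j js)
  show ?case
    unfolding leaf_box_Cons Let_def by (auto simp del: set_coord_nth intro!: Cons.IH half_lt Cons.prems)
qed (simp add: leaf_box_Nil rectangles_box)

text \<open>For a fixed list only finitely many leaves occur, each on a set cut out by half-spaces;
  hence \<open>G\<close> may be an arbitrary function of sets.\<close>

lemma leaf_box_measurable [measurable]:
  fixes G :: "(real ^ 'n) set \<Rightarrow> ennreal"
  shows "(\<lambda>x. G (leaf_box js l u x)) \<in> borel_measurable lebesgue"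
proof (induction js arbitrary: l u)
  case (Cons j js)
  have [measurable]: "{x :: real ^ 'n. x $ j < m} \<in> sets lebesgue" for m
    using open_halfspace_component_lt_cart[of j m] by simp
  have "(\<lambda>x. G (leaf_box (j # js) l u x)) = (\<lambda>x. if x \<in> {x. x $ j < (l $ j + u $ j) / 2}
     then G (leaf_box js l (set_coord u j ((l $ j + u $ j) / 2)) x)
     else G (leaf_box js (set_coord l j ((l $ j + u $ j) / 2)) u x))"
    by (auto simp: leaf_box_Cons Let_def)
  also have "\<dots> \<in> borel_measurable lebesgue"
    using Cons.IH by measurable
  finally show ?case .
qed (simp add: leaf_box_Nil)

lemma box_set_coord:
  fixes l u :: "real ^ 'n" and j :: 'n
  assumes "\<And>i. l $ i < u $ i"
  shows "x \<in> box l (set_coord u j ((l $ j + u $ j) / 2)) \<longleftrightarrow> x \<in> box l u \<and> x $ j < (l $ j + u $ j) / 2"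
    "x \<in> box (set_coord l j ((l $ j + u $ j) / 2)) u \<longleftrightarrow> x \<in> box l u \<and> (l $ j + u $ j) / 2 < x $ j"
proof -
  have *: "(l $ i < x $ i \<and> x $ i < set_coord u j ((l $ j + u $ j) / 2) $ i) \<longleftrightarrow>
      (l $ i < x $ i \<and> x $ i < u $ i) \<and> (i = j \<longrightarrow> x $ j < (l $ j + u $ j) / 2)"
    "(set_coord l j ((l $ j + u $ j) / 2) $ i < x $ i \<and> x $ i < u $ i) \<longleftrightarrow>
      (l $ i < x $ i \<and> x $ i < u $ i) \<and> (i = j \<longrightarrow> (l $ j + u $ j) / 2 < x $ j)" for i
    using assms[of i] by (cases "i = j"; auto)+
  show "x \<in> box l (set_coord u j ((l $ j + u $ j) / 2)) \<longleftrightarrow> x \<in> box l u \<and> x $ j < (l $ j + u $ j) / 2"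
    "x \<in> box (set_coord l j ((l $ j + u $ j) / 2)) u \<longleftrightarrow> x \<in> box l u \<and> (l $ j + u $ j) / 2 < x $ j"
    unfolding mem_box_cart * by blast+
qed

lemma nn_integral_halves:
  fixes l u :: "real ^ 'n" and j :: 'n
  assumes lu: "\<And>i. l $ i < u $ i" and [measurable]: "f \<in> borel_measurable lebesgue"
  defines "m \<equiv> (l $ j + u $ j) / 2"
  shows "(\<integral>\<^sup>+x\<in>box l u. f x \<partial>lebesgue)
    = (\<integral>\<^sup>+x\<in>box l (set_coord u j m). f x \<partial>lebesgue) + (\<integral>\<^sup>+x\<in>box (set_coord l j m) u. f x \<partial>lebesgue)"
proof -
  have "(\<integral>\<^sup>+x\<in>box l u. f x \<partial>lebesgue)
    = (\<integral>\<^sup>+x. f x * indicator (box l (set_coord u j m)) x + f x * indicator (box (set_coord l j m) u) x \<partial>lebesgue)"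
    using AE_coordinates_neq[of "\<lambda>_. m"]
  proof (intro nn_integral_cong_AE, eventually_elim)
    fix x :: "real ^ 'n" assume x: "\<forall>i. x $ i \<noteq> m"
    have "x \<in> box l (set_coord u j m) \<longleftrightarrow> x \<in> box l u \<and> x $ j < m"
      using box_set_coord[OF lu] unfolding m_def by blast
    moreover have "x \<in> box (set_coord l j m) u \<longleftrightarrow> x \<in> box l u \<and> m < x $ j"
      using box_set_coord[OF lu] unfolding m_def by blast
    ultimately show "f x * indicator (box l u) x
      = f x * indicator (box l (set_coord u j m)) x + f x * indicator (box (set_coord l j m) u) x"
      using x[rule_format, of j] by (cases "x $ j < m") (auto simp: indicator_def)
  qed
  also have "\<dots> = (\<integral>\<^sup>+x\<in>box l (set_coord u j m). f x \<partial>lebesgue) + (\<integral>\<^sup>+x\<in>box (set_coord l j m) u. f x \<partial>lebesgue)"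
    by (intro nn_integral_add borel_measurable_times_ennreal borel_measurable_indicator) auto
  finally show ?thesis .
qed

lemma measure_halves:
  fixes l u :: "real ^ 'n" and j :: 'n
  assumes lu: "\<And>i. l $ i < u $ i"
  defines "m \<equiv> (l $ j + u $ j) / 2"
  shows "emeasure lebesgue (box l (set_coord u j m)) = emeasure lebesgue (box l u) / 2"
    "emeasure lebesgue (box (set_coord l j m) u) = emeasure lebesgue (box l u) / 2"
proof -
  have P: "(\<Prod>i\<in>UNIV. v $ i - w $ i) = (v $ j - w $ j) * (\<Prod>i\<in>UNIV - {j}. v $ i - w $ i)" for v w :: "real ^ 'n"
    by (subst prod.remove[of _ j]) auto
  have P1: "(\<Prod>i\<in>UNIV. set_coord u j m $ i - l $ i) = (m - l $ j) * (\<Prod>i\<in>UNIV - {j}. u $ i - l $ i)"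
    and P2: "(\<Prod>i\<in>UNIV. u $ i - set_coord l j m $ i) = (u $ j - m) * (\<Prod>i\<in>UNIV - {j}. u $ i - l $ i)"
    unfolding P by (auto intro!: prod.cong)
  have nn: "0 \<le> (u $ j - l $ j) * (\<Prod>i\<in>UNIV - {j}. u $ i - l $ i)"
    using lu by (intro mult_nonneg_nonneg prod_nonneg) (auto simp: less_imp_le)
  have 1: "emeasure lebesgue (box l u) = ennreal ((u $ j - l $ j) * (\<Prod>i\<in>UNIV - {j}. u $ i - l $ i))"
    unfolding P[symmetric] by (intro emeasure_box_cart) (use lu in \<open>auto simp: less_imp_le\<close>)
  have "emeasure lebesgue (box l (set_coord u j m)) = ennreal ((m - l $ j) * (\<Prod>i\<in>UNIV - {j}. u $ i - l $ i))"
    using half_lt[OF lu, where j=j] unfolding m_def[symmetric] P1[symmetric]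
    by (intro emeasure_box_cart less_imp_le)
  also have "m - l $ j = (u $ j - l $ j) / 2" by (simp add: m_def field_simps)
  also have "ennreal ((u $ j - l $ j) / 2 * (\<Prod>i\<in>UNIV - {j}. u $ i - l $ i)) = emeasure lebesgue (box l u) / 2"
    unfolding 1 using nn ennreal_divide_numeral[OF nn, of "num.Bit0 num.One"] by simp
  finally show "emeasure lebesgue (box l (set_coord u j m)) = emeasure lebesgue (box l u) / 2" .
  have "emeasure lebesgue (box (set_coord l j m) u) = ennreal ((u $ j - m) * (\<Prod>i\<in>UNIV - {j}. u $ i - l $ i))"
    using half_lt[OF lu, where j=j] unfolding m_def[symmetric] P2[symmetric]
    by (intro emeasure_box_cart less_imp_le)
  also have "u $ j - m = (u $ j - l $ j) / 2" by (simp add: m_def field_simps)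
  also have "ennreal ((u $ j - l $ j) / 2 * (\<Prod>i\<in>UNIV - {j}. u $ i - l $ i)) = emeasure lebesgue (box l u) / 2"
    unfolding 1 using nn ennreal_divide_numeral[OF nn, of "num.Bit0 num.One"] by simp
  finally show "emeasure lebesgue (box (set_coord l j m) u) = emeasure lebesgue (box l u) / 2" .
qed

lemma avg_halves:
  fixes l u :: "real ^ 'n" and j :: 'n
  assumes lu: "\<And>i. l $ i < u $ i" and f: "f \<in> borel_measurable lebesgue"
  defines "m \<equiv> (l $ j + u $ j) / 2"
  shows "avg (box l u) f = (avg (box l (set_coord u j m)) f + avg (box (set_coord l j m) u) f) / 2"
proof -
  define \<mu> where "\<mu> = emeasure lebesgue (box l u)"
  have "\<mu> \<noteq> 0" "\<mu> < top" unfolding \<mu>_def using rectangles_measure(4,5)[OF rectangles_box[OF lu]] by auto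
  then obtain r where r: "\<mu> = ennreal r" "0 < r" by (cases \<mu>) auto
  have *: "x / (\<mu> / 2) / 2 = x / \<mu>" for x
  proof (cases x)
    case (real y)
    then show ?thesis using r ennreal_divide_numeral[of r "num.Bit0 num.One"] ennreal_divide_numeral[of "y / (r / 2)" "num.Bit0 num.One"]
      by (simp add: divide_ennreal)
  next
    case top
    then show ?thesis using r ennreal_divide_numeral[of r "num.Bit0 num.One"] by (simp add: ennreal_top_divide)
  qed
  show ?thesis
    unfolding avg_def m_def measure_halves[OF lu] nn_integral_halves[OF lu f, where j=j] \<mu>_def[symmetric]
    by (simp add: add_divide_distrib_ennreal *)
qed

lemma nn_integral_leaf_Cons:
  fixes l u :: "real ^ 'n" and j :: 'n and G :: "(real ^ 'n) set \<Rightarrow> ennreal"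
  assumes lu: "\<And>i. l $ i < u $ i"
  defines "m \<equiv> (l $ j + u $ j) / 2"
  shows "(\<integral>\<^sup>+x\<in>box l u. G (leaf_box (j # js) l u x) \<partial>lebesgue)
    = (\<integral>\<^sup>+x\<in>box l (set_coord u j m). G (leaf_box js l (set_coord u j m) x) \<partial>lebesgue)
    + (\<integral>\<^sup>+x\<in>box (set_coord l j m) u. G (leaf_box js (set_coord l j m) u x) \<partial>lebesgue)"
proof -
  have 1: "G (leaf_box (j # js) l u x) * indicator (box l (set_coord u j m)) x
    = G (leaf_box js l (set_coord u j m) x) * indicator (box l (set_coord u j m)) x" for x
  proof (cases "x \<in> box l (set_coord u j m)")
    case True
    then have "x $ j < m" by (auto simp: mem_box_cart dest: spec[of _ j])
    then show ?thesis by (simp add: leaf_box_Cons m_def Let_def)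
  qed simp
  have 2: "G (leaf_box (j # js) l u x) * indicator (box (set_coord l j m) u) x
    = G (leaf_box js (set_coord l j m) u x) * indicator (box (set_coord l j m) u) x" for x
  proof (cases "x \<in> box (set_coord l j m) u")
    case True
    then have "m < x $ j" by (auto simp: mem_box_cart dest: spec[of _ j])
    then show ?thesis by (simp add: leaf_box_Cons m_def Let_def)
  qed simp
  have "(\<integral>\<^sup>+x\<in>box l u. G (leaf_box (j # js) l u x) \<partial>lebesgue)
    = (\<integral>\<^sup>+x\<in>box l (set_coord u j m). G (leaf_box (j # js) l u x) \<partial>lebesgue)
    + (\<integral>\<^sup>+x\<in>box (set_coord l j m) u. G (leaf_box (j # js) l u x) \<partial>lebesgue)"
    unfolding m_def by (intro nn_integral_halves lu) measurable
  then show ?thesis unfolding 1 2 .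
qed

text \<open>Leaf averages are conditional expectations; they preserve the integral because each cut
  does.\<close>

lemma nn_integral_leaf_avg:
  fixes l u :: "real ^ 'n"
  assumes "\<And>i. l $ i < u $ i" and f: "f \<in> borel_measurable lebesgue"
  shows "(\<integral>\<^sup>+x\<in>box l u. avg (leaf_box js l u x) f \<partial>lebesgue) = (\<integral>\<^sup>+x\<in>box l u. f x \<partial>lebesgue)"
  using assms(1)
proof (induction js arbitrary: l u)
  case Nil
  note R = rectangles_box[OF Nil]
  have "(\<integral>\<^sup>+x\<in>box l u. avg (box l u) f \<partial>lebesgue) = avg (box l u) f * emeasure lebesgue (box l u)"
    using rectangles_measure(1)[OF R] by (rule nn_integral_cmult_indicator)
  then show ?case unfolding leaf_box_Nil nn_integral_eq_avg[OF R] .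
next
  case (Cons j js)
  show ?case
    unfolding nn_integral_leaf_Cons[where G="\<lambda>R. avg R f", OF Cons.prems] nn_integral_halves[OF Cons.prems f, where j=j]
    by (intro arg_cong2[where f="(+)"] Cons.IH half_lt Cons.prems)
qed

text \<open>The point is followed in closed boxes, because on a cutting plane it lies only on the
  boundary of its leaf.\<close>

lemma leaf_side:
  assumes "\<And>i. l $ i < u $ i" "x \<in> cbox l u" "leaf js (l, u) x = (l', u')"
  shows "x \<in> cbox l' u' \<and> box l' u' \<subseteq> box l u \<and> (\<forall>i. (u' $ i - l' $ i) * 2 ^ count_list js i = u $ i - l $ i)"
  using assms
proof (induction js arbitrary: l u)
  case (Cons j js)
  define m where "m = (l $ j + u $ j) / 2"
  note h = half_lt[OF Cons.prems(1), where j=j, folded m_def]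
  have lm: "l $ j < m" "m < u $ j" using Cons.prems(1)[of j] by (auto simp: m_def)
  show ?case
  proof (cases "x $ j < m")
    case True
    then have "leaf js (l, set_coord u j m) x = (l', u')"
      using Cons.prems(3) by (simp add: m_def Let_def)
    moreover have "x \<in> cbox l (set_coord u j m)" using Cons.prems(2) True by (auto simp: mem_box_cart)
    ultimately have IH: "x \<in> cbox l' u'" "box l' u' \<subseteq> box l (set_coord u j m)"
      "\<And>i. (u' $ i - l' $ i) * 2 ^ count_list js i = set_coord u j m $ i - l $ i"
      using Cons.IH[OF h(1)] by auto
    have "box l (set_coord u j m) \<subseteq> box l u"
      using box_set_coord[OF Cons.prems(1)] unfolding m_def by blast
    moreover have "(u' $ i - l' $ i) * 2 ^ count_list (j # js) i = u $ i - l $ i" for i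
      using IH(3)[of i] by (auto simp: m_def field_simps)
    ultimately show ?thesis using IH by blast
  next
    case False
    then have "leaf js (set_coord l j m, u) x = (l', u')"
      using Cons.prems(3) by (simp add: m_def Let_def)
    moreover have "x \<in> cbox (set_coord l j m) u" using Cons.prems(2) False by (auto simp: mem_box_cart)
    ultimately have IH: "x \<in> cbox l' u'" "box l' u' \<subseteq> box (set_coord l j m) u"
      "\<And>i. (u' $ i - l' $ i) * 2 ^ count_list js i = u $ i - set_coord l j m $ i"
      using Cons.IH[OF h(2)] by auto
    have "box (set_coord l j m) u \<subseteq> box l u"
      using box_set_coord[OF Cons.prems(1)] unfolding m_def by blast
    moreover have "(u' $ i - l' $ i) * 2 ^ count_list (j # js) i = u $ i - l $ i" for i
      using IH(3)[of i] by (auto simp: m_def field_simps)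
    ultimately show ?thesis using IH by blast
  qed
qed auto

text \<open>Two dominated convergences: \<open>V\<close> is truncated at a height \<open>M\<close>,
  and the truncation is approximated by continuous functions that converge to \<open>V\<close>
  almost everywhere and are clipped to values between 0 and \<open>M\<close>.\<close>

lemma continuous_L1_approx:
  fixes V :: "real ^ 'n \<Rightarrow> real"
  assumes V [measurable]: "V \<in> borel_measurable lebesgue" and V0: "\<And>x. 0 \<le> V x"
  and R [measurable]: "R \<in> sets lebesgue" and Rfin: "emeasure lebesgue R < top"
  and Vint: "(\<integral>\<^sup>+x\<in>R. ennreal (V x) \<partial>lebesgue) < top" and e: "0 < e"
  obtains g where "continuous_on UNIV g" "\<And>x. 0 \<le> g x" "(\<integral>\<^sup>+x\<in>R. ennreal \<bar>V x - g x\<bar> \<partial>lebesgue) < e"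
proof -
  define e2 where "e2 = min (e / 2) 1"
  have e2: "0 < e2" "e2 + e2 \<le> e" "e2 < top"
  proof -
    show "0 < e2" using e by (simp add: e2_def ennreal_zero_less_divide)
    show "e2 < top" by (simp add: e2_def min_less_iff_disj)
    have "e2 + e2 \<le> e / 2 + e / 2" unfolding e2_def by (intro add_mono) auto
    also have "\<dots> = e" by (cases e) (auto simp: ennreal_divide_numeral ennreal_plus[symmetric] ennreal_top_divide simp del: ennreal_plus)
    finally show "e2 + e2 \<le> e" .
  qed
  have "(\<lambda>n. \<integral>\<^sup>+x. ennreal \<bar>V x - min (V x) (real n)\<bar> * indicator R x \<partial>lebesgue) \<longlonglongrightarrow> (\<integral>\<^sup>+x. 0 \<partial>(lebesgue :: (real ^ 'n) measure))"
  proof (rule nn_integral_dominated_convergence[where w="\<lambda>x. ennreal (V x) * indicator R x"])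
    show "AE x in lebesgue. ennreal \<bar>V x - min (V x) (real n)\<bar> * indicator R x \<le> ennreal (V x) * indicator R x" for n
      using V0 by (intro AE_I2 mult_right_mono ennreal_leI) (auto simp: min_def abs_if not_le intro: order_trans[OF of_nat_0_le_iff])
    show "AE x in lebesgue. (\<lambda>n. ennreal \<bar>V x - min (V x) (real n)\<bar> * indicator R x) \<longlonglongrightarrow> 0"
    proof (intro AE_I2)
      fix x
      have "\<forall>\<^sub>F n in sequentially. V x \<le> real n"
        using filterlim_real_sequentially unfolding filterlim_at_top by auto
      then have "\<forall>\<^sub>F n in sequentially. ennreal \<bar>V x - min (V x) (real n)\<bar> * indicator R x = 0"
        by eventually_elim simp
      then show "(\<lambda>n. ennreal \<bar>V x - min (V x) (real n)\<bar> * indicator R x) \<longlonglongrightarrow> 0"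
        by (rule tendsto_eventually)
    qed
  qed (use Vint in auto)
  then have "\<forall>\<^sub>F n in sequentially. (\<integral>\<^sup>+x\<in>R. ennreal \<bar>V x - min (V x) (real n)\<bar> \<partial>lebesgue) < e2"
    using e2(1) by (intro order_tendstoD(2)) auto
  then obtain M :: nat where M: "(\<integral>\<^sup>+x\<in>R. ennreal \<bar>V x - min (V x) (real M)\<bar> \<partial>lebesgue) < e2"
    by (auto simp: eventually_sequentially)
  from lebesgue_measurable_imp_measurable_on[OF V, of UNIV] obtain N G where
    N: "negligible N" and G: "\<And>n. continuous_on UNIV (G n)" and lim: "\<And>x. x \<notin> N \<Longrightarrow> (\<lambda>n. G n x) \<longlonglongrightarrow> V x"
    by (auto simp: measurable_on_def)
  define H where "H n x = max 0 (min (G n x) (real M))" for n x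
  have H: "continuous_on UNIV (H n)" for n
    unfolding H_def by (intro continuous_intros G)
  have [measurable]: "H n \<in> borel_measurable lebesgue" for n
    using borel_measurable_continuous_onI[OF H] by (simp add: measurable_completion)
  have "(\<lambda>n. \<integral>\<^sup>+x. ennreal \<bar>min (V x) (real M) - H n x\<bar> * indicator R x \<partial>lebesgue) \<longlonglongrightarrow> (\<integral>\<^sup>+x. 0 \<partial>(lebesgue :: (real ^ 'n) measure))"
  proof (rule nn_integral_dominated_convergence[where w="\<lambda>x. ennreal (real M) * indicator R x"])
    have "\<bar>min (V x) (real M) - H n x\<bar> \<le> real M" for n x
      using V0[of x] by (auto simp: H_def min_def max_def abs_le_iff)
    then show "AE x in lebesgue. ennreal \<bar>min (V x) (real M) - H n x\<bar> * indicator R x \<le> ennreal (real M) * indicator R x" for n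
      by (intro AE_I2 mult_right_mono ennreal_leI) auto
    show "AE x in lebesgue. (\<lambda>n. ennreal \<bar>min (V x) (real M) - H n x\<bar> * indicator R x) \<longlonglongrightarrow> 0"
      using AE_not_in[OF N[unfolded negligible_iff_null_sets]]
    proof eventually_elim
      fix x assume "x \<notin> N"
      then have "(\<lambda>n. \<bar>min (V x) (real M) - H n x\<bar>) \<longlonglongrightarrow> \<bar>min (V x) (real M) - max 0 (min (V x) (real M))\<bar>"
        unfolding H_def by (intro tendsto_intros lim)
      then have "(\<lambda>n. ennreal \<bar>min (V x) (real M) - H n x\<bar>) \<longlonglongrightarrow> ennreal 0"
        using V0[of x] by (intro tendsto_ennrealI) (simp add: max_def)
      then have "(\<lambda>n. ennreal \<bar>min (V x) (real M) - H n x\<bar> * indicator R x) \<longlonglongrightarrow> ennreal 0 * indicator R x"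
        by (intro tendsto_mult_ennreal tendsto_const) (auto simp: indicator_def)
      then show "(\<lambda>n. ennreal \<bar>min (V x) (real M) - H n x\<bar> * indicator R x) \<longlonglongrightarrow> 0" by simp
    qed
    have "(\<integral>\<^sup>+x\<in>R. ennreal (real M) \<partial>lebesgue) = ennreal (real M) * emeasure lebesgue R"
      using R by (rule nn_integral_cmult_indicator)
    then show "(\<integral>\<^sup>+x\<in>R. ennreal (real M) \<partial>lebesgue) < \<infinity>"
      using Rfin by (simp add: ennreal_mult_less_top del: emeasure_completion)
  qed measurable
  then have "\<forall>\<^sub>F n in sequentially. (\<integral>\<^sup>+x\<in>R. ennreal \<bar>min (V x) (real M) - H n x\<bar> \<partial>lebesgue) < e2"
    using e2(1) by (intro order_tendstoD(2)) auto
  then obtain n where n: "(\<integral>\<^sup>+x\<in>R. ennreal \<bar>min (V x) (real M) - H n x\<bar> \<partial>lebesgue) < e2"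
    by (auto simp: eventually_sequentially)
  have "(\<integral>\<^sup>+x\<in>R. ennreal \<bar>V x - H n x\<bar> \<partial>lebesgue)
     \<le> (\<integral>\<^sup>+x. ennreal \<bar>V x - min (V x) (real M)\<bar> * indicator R x + ennreal \<bar>min (V x) (real M) - H n x\<bar> * indicator R x \<partial>lebesgue)"
    unfolding distrib_right[symmetric]
    by (intro nn_integral_mono mult_right_mono) (auto simp: ennreal_plus[symmetric] simp del: ennreal_plus intro!: ennreal_leI)
  also have "\<dots> = (\<integral>\<^sup>+x\<in>R. ennreal \<bar>V x - min (V x) (real M)\<bar> \<partial>lebesgue) + (\<integral>\<^sup>+x\<in>R. ennreal \<bar>min (V x) (real M) - H n x\<bar> \<partial>lebesgue)"
    by (intro nn_integral_add) measurable
  also have "\<dots> < e2 + e2" by (intro add_strict_mono M n)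
  also have "\<dots> \<le> e" by (rule e2)
  finally show ?thesis using that[of "H n"] H by (auto simp: H_def)
qed

text \<open>\<open>N\<close> rounds through all the coordinates, so that leaves shrink in every
  direction by the same factor.\<close>

definition dyadic_list :: "nat \<Rightarrow> 'n::finite list" where
  "dyadic_list N = concat (replicate N (SOME xs. set xs = UNIV \<and> distinct xs))"

lemma count_dyadic_list: "count_list (dyadic_list N) (i :: 'n::finite) = N"
proof -
  define xs where "xs = (SOME xs :: 'n list. set xs = UNIV \<and> distinct xs)"
  obtain ys :: "'n list" where "set ys = UNIV \<and> distinct ys"
    using finite_distinct_list[of "UNIV :: 'n set"] by auto
  then have xs: "set xs = UNIV \<and> distinct xs"
    unfolding xs_def by (rule someI)
  have "distinct ys \<Longrightarrow> count_list ys i = (if i \<in> set ys then 1 else 0)" for ys by (induction ys) auto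
  with xs have 1: "count_list xs i = 1" by simp
  have "count_list (concat (replicate N xs)) i = N"
    by (induction N) (simp_all add: 1)
  then show ?thesis unfolding dyadic_list_def xs_def .
qed

lemma leaf_box_oscillation:
  fixes g :: "real ^ 'n \<Rightarrow> real"
  assumes lu: "\<And>i. l $ i < u $ i" and g: "continuous_on UNIV g" and e: "0 < e"
  shows "\<forall>\<^sub>F N in sequentially. \<forall>x\<in>box l u. \<forall>y\<in>leaf_box (dyadic_list N) l u x. \<bar>g y - g x\<bar> \<le> e"
proof -
  have "uniformly_continuous_on (cbox l u) g"
    using g by (intro compact_uniformly_continuous continuous_on_subset[OF g]) auto
  then obtain d where d: "0 < d" "\<And>x y. x \<in> cbox l u \<Longrightarrow> y \<in> cbox l u \<Longrightarrow> dist y x < d \<Longrightarrow> dist (g y) (g x) < e"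
    using e unfolding uniformly_continuous_on_def by metis
  have "(\<lambda>N. (\<Sum>i\<in>UNIV. (u $ i - l $ i)) * (1 / 2) ^ N) \<longlonglongrightarrow> (\<Sum>i\<in>UNIV. (u $ i - l $ i)) * 0"
    by (intro tendsto_intros LIMSEQ_realpow_zero) auto
  then have "\<forall>\<^sub>F N in sequentially. (\<Sum>i\<in>UNIV. (u $ i - l $ i)) * (1 / 2) ^ N < d"
    using d(1) by (intro order_tendstoD(2)) auto
  then show ?thesis
  proof eventually_elim
    case (elim N)
    show ?case
    proof (intro ballI)
      fix x y assume x: "x \<in> box l u" and y: "y \<in> leaf_box (dyadic_list N) l u x"
      obtain l' u' where l': "leaf (dyadic_list N) (l, u) x = (l', u')" by fastforce
      have xc: "x \<in> cbox l u" using x box_subset_cbox by blast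
      note s = leaf_side[OF lu xc l']
      have y': "y \<in> box l' u'" using y by (simp add: leaf_box_def l')
      have "\<bar>(y - x) $ i\<bar> \<le> (u $ i - l $ i) * (1 / 2) ^ N" for i
      proof -
        have "l' $ i \<le> x $ i" "x $ i \<le> u' $ i" "l' $ i < y $ i" "y $ i < u' $ i"
          using s y' by (auto simp: mem_box_cart)
        then have "\<bar>(y - x) $ i\<bar> \<le> u' $ i - l' $ i" by auto
        also have "\<dots> = (u $ i - l $ i) * (1 / 2) ^ N"
          using s by (auto simp: count_dyadic_list field_simps)
        finally show ?thesis .
      qed
      then have "(\<Sum>i\<in>UNIV. \<bar>(y - x) $ i\<bar>) \<le> (\<Sum>i\<in>UNIV. (u $ i - l $ i)) * (1 / 2) ^ N"
        unfolding sum_distrib_right by (intro sum_mono)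
      then have "dist y x < d"
        using norm_le_l1_cart[of "y - x"] elim by (simp add: dist_norm)
      then have "dist (g y) (g x) < e"
        using d(2)[OF xc, of y] y' s box_subset_cbox by blast
      then show "\<bar>g y - g x\<bar> \<le> e" by (simp add: dist_real_def)
    qed
  qed
qed

section \<open>Bellman induction and passage to the limit\<close>

context strong_Ap
begin

lemma K_ge_1: "1 \<le> K"
proof -
  have "1 \<le> avg (box 0 1) v * enn_powr (avg (box 0 1) s) (t - 1)"
    by (intro vs_avg rectangles_box) simp
  also have "\<dots> \<le> ennreal K" by (intro Ap rectangles_box) simp
  finally show ?thesis unfolding ennreal_1[symmetric] ennreal_le_iff2 by auto
qed

lemma real_averages:
  assumes R: "R \<in> rectangles"
  defines "X \<equiv> enn2real (avg R v)" and "Y \<equiv> enn2real (avg R s)"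
  shows "avg R v = ennreal X" "avg R s = ennreal Y" "0 < X" "0 < Y"
    "1 \<le> X * Y powr (t - 1)" "X * Y powr (t - 1) \<le> K"
proof -
  show XY: "avg R v = ennreal X" "avg R s = ennreal Y" "0 < X" "0 < Y"
    using v_avg[OF R] s_avg[OF R] by (auto simp: X_def Y_def enn2real_positive_iff)
  show "1 \<le> X * Y powr (t - 1)"
    using vs_avg[OF R] XY by (simp add: enn_powr_ennreal ennreal_mult[symmetric] ennreal_1[symmetric] del: ennreal_1)
  show "X * Y powr (t - 1) \<le> K"
    using Ap[OF R] K XY by (simp add: enn_powr_ennreal ennreal_mult[symmetric])
qed

lemma nn_integral_v_finite:
  assumes R: "R \<in> rectangles"
  shows "(\<integral>\<^sup>+x\<in>R. v x \<partial>lebesgue) < top"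
  unfolding nn_integral_eq_avg[OF R] using v_avg[OF R] rectangles_measure(5)[OF R]
  by (simp only: ennreal_mult_less_top simp_thms)

lemma v_finite_AE:
  assumes R: "R \<in> rectangles"
  shows "AE x in lebesgue. x \<in> R \<longrightarrow> v x = ennreal (enn2real (v x))"
proof -
  have "AE x in lebesgue. v x * indicator R x \<noteq> \<infinity>"
    by (intro nn_integral_PInf_AE borel_measurable_times_ennreal borel_measurable_indicator v_meas
        rectangles_measure(1)[OF R]) (use nn_integral_v_finite[OF R] in auto)
  then show ?thesis by eventually_elim (auto simp: less_top[symmetric])
qed

text \<open>Induction along the cuts. At a leaf, \<open>bellman_ge\<close> dominates the power; at a
  cut, the averages of the parent are the midpoints of those of its halves, so
  \<open>bellman_midpoint\<close> applies with \<open>a = t - 1\<close>. Its factor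
  \<open>2 powr (1 + a)\<close> is the \<open>2 powr t\<close> of the smallness condition.\<close>

lemma leaf_reverse_Holder:
  fixes l u :: "real ^ 'n"
  assumes d: "0 < \<delta>" "\<delta> < 1" "2 * \<delta> * (1 + \<delta>) * (2 powr t * K)\<^sup>2 \<le> 1 - \<delta>"
  and lu: "\<And>i. l $ i < u $ i"
  shows "(\<integral>\<^sup>+x\<in>box l u. enn_powr (avg (leaf_box js l u x) v) (1 + \<delta>) \<partial>lebesgue)
    \<le> ennreal (bellman (t - 1) \<delta> (enn2real (avg (box l u) v)) (enn2real (avg (box l u) s))) * emeasure lebesgue (box l u)"
  using lu
proof (induction js arbitrary: l u)
  case Nil
  note R = rectangles_box[OF Nil]
  define X where "X = enn2real (avg (box l u) v)"
  define Y where "Y = enn2real (avg (box l u) s)"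
  note XY = real_averages[OF R, folded X_def Y_def]
  have "X powr (1 + \<delta>) \<le> bellman (t - 1) \<delta> X Y" using XY by (intro bellman_ge)
  then have "enn_powr (avg (box l u) v) (1 + \<delta>) \<le> ennreal (bellman (t - 1) \<delta> X Y)"
    using XY by (simp add: enn_powr_ennreal ennreal_leI)
  moreover have "(\<integral>\<^sup>+x\<in>box l u. enn_powr (avg (box l u) v) (1 + \<delta>) \<partial>lebesgue)
      = enn_powr (avg (box l u) v) (1 + \<delta>) * emeasure lebesgue (box l u)"
    using rectangles_measure(1)[OF R] by (rule nn_integral_cmult_indicator)
  ultimately show ?case
    unfolding leaf_box_Nil X_def[symmetric] Y_def[symmetric] by (simp only: mult_right_mono zero_le)
next
  case (Cons j js)
  define m where "m = (l $ j + u $ j) / 2"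
  define V where "V R = enn2real (avg R v)" for R
  define S where "S R = enn2real (avg R s)" for R
  let ?R = "box l u" and ?R1 = "box l (set_coord u j m)" and ?R2 = "box (set_coord l j m) u"
  note h = half_lt[OF Cons.prems, where j=j, folded m_def]
  note R = rectangles_box[OF Cons.prems] rectangles_box[OF h(1)] rectangles_box[OF h(2)]
  note VS = real_averages[folded V_def S_def]
  have half: "ennreal x = (ennreal y + ennreal z) / 2 \<Longrightarrow> 0 < x \<Longrightarrow> 0 < y \<Longrightarrow> 0 < z \<Longrightarrow> x = (y + z) / 2" for x y z
    using ennreal_divide_numeral[of "y + z" "num.Bit0 num.One"] by (simp add: ennreal_plus[symmetric] del: ennreal_plus)
  have Vh: "V ?R = (V ?R1 + V ?R2) / 2"
    using avg_halves[OF Cons.prems v_meas, where j=j, folded m_def] R by (intro half) (auto simp: VS)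
  have Sh: "S ?R = (S ?R1 + S ?R2) / 2"
    using avg_halves[OF Cons.prems s_meas, where j=j, folded m_def] R by (intro half) (auto simp: VS)
  have B: "(bellman (t - 1) \<delta> (V ?R1) (S ?R1) + bellman (t - 1) \<delta> (V ?R2) (S ?R2)) / 2 \<le> bellman (t - 1) \<delta> (V ?R) (S ?R)"
    using VS(6)[OF R(1)] unfolding Vh Sh
    using d t K_ge_1 VS R by (intro bellman_midpoint[where K=K]) auto
  let ?\<mu> = "emeasure lebesgue ?R"
  have half_sum: "ennreal x * (\<mu> / 2) + ennreal y * (\<mu> / 2) \<le> ennreal z * \<mu>" if asm: "(x + y) / 2 \<le> z" "0 \<le> x" "0 \<le> y" "\<mu> \<noteq> top" for x y z \<mu>
  proof -
    obtain r where r: "\<mu> = ennreal r" "0 \<le> r" using asm(4) by (cases \<mu>) auto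
    have "(x + y) / 2 * r \<le> z * r" using asm r by (intro mult_right_mono)
    then have "x * (r / 2) + y * (r / 2) \<le> z * r" by (simp add: field_simps)
    then show ?thesis
      using r asm ennreal_divide_numeral[of r "num.Bit0 num.One"]
      by (simp add: ennreal_mult[symmetric] ennreal_plus[symmetric] del: ennreal_plus)
  qed
  have B0: "0 \<le> bellman (t - 1) \<delta> (V Q) (S Q)" if Q: "Q \<in> rectangles" for Q
    using bellman_ge[of "V Q" "S Q" "t - 1" \<delta>] VS[OF Q] powr_ge_zero order_trans by blast
  have "(\<integral>\<^sup>+x\<in>?R. enn_powr (avg (leaf_box (j # js) l u x) v) (1 + \<delta>) \<partial>lebesgue)
    = (\<integral>\<^sup>+x\<in>?R1. enn_powr (avg (leaf_box js l (set_coord u j m) x) v) (1 + \<delta>) \<partial>lebesgue)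
    + (\<integral>\<^sup>+x\<in>?R2. enn_powr (avg (leaf_box js (set_coord l j m) u x) v) (1 + \<delta>) \<partial>lebesgue)"
    unfolding m_def by (rule nn_integral_leaf_Cons[where G="\<lambda>R. enn_powr (avg R v) (1 + \<delta>)", OF Cons.prems])
  also have "\<dots> \<le> ennreal (bellman (t - 1) \<delta> (V ?R1) (S ?R1)) * emeasure lebesgue ?R1
     + ennreal (bellman (t - 1) \<delta> (V ?R2) (S ?R2)) * emeasure lebesgue ?R2"
    unfolding V_def S_def by (intro add_mono Cons.IH h)
  also have "\<dots> = ennreal (bellman (t - 1) \<delta> (V ?R1) (S ?R1)) * (?\<mu> / 2) + ennreal (bellman (t - 1) \<delta> (V ?R2) (S ?R2)) * (?\<mu> / 2)"
    unfolding m_def measure_halves[OF Cons.prems] ..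
  also have "\<dots> \<le> ennreal (bellman (t - 1) \<delta> (V ?R) (S ?R)) * ?\<mu>"
    using rectangles_measure(5)[OF R(1)] by (intro half_sum B B0 R) auto
  finally show ?case unfolding V_def S_def .
qed

text \<open>Approximation in place of a differentiation theorem: leaf averages of a continuous
  function converge uniformly, and by \<open>nn_integral_leaf_avg\<close> averaging does not
  increase the distance in L1 to the approximant.\<close>

lemma leaf_avg_tendsto_L1:
  fixes l u :: "real ^ 'n"
  assumes lu: "\<And>i. l $ i < u $ i"
  shows "(\<lambda>N. \<integral>\<^sup>+x\<in>box l u. ennreal \<bar>enn2real (avg (leaf_box (dyadic_list N) l u x) v) - enn2real (v x)\<bar> \<partial>lebesgue) \<longlonglongrightarrow> 0"
proof (rule order_tendstoI)
  fix e :: ennreal assume e: "0 < e"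
  note R = rectangles_box[OF lu]
  note RM = rectangles_measure[OF R]
  note [measurable] = RM(1)
  define V where "V x = enn2real (v x)" for x
  have [measurable]: "V \<in> borel_measurable lebesgue" unfolding V_def by measurable
  note vfin = v_finite_AE[OF R, folded V_def]
  have Vint: "(\<integral>\<^sup>+x\<in>box l u. ennreal (V x) \<partial>lebesgue) < top"
  proof -
    have "(\<integral>\<^sup>+x\<in>box l u. ennreal (V x) \<partial>lebesgue) = (\<integral>\<^sup>+x\<in>box l u. v x \<partial>lebesgue)"
      using vfin by (intro nn_integral_cong_AE) (auto elim!: eventually_mono simp: indicator_def)
    then show ?thesis using nn_integral_v_finite[OF R] by simp
  qed
  define e3 where "e3 = min (e / 3) 1"
  have e3: "0 < e3" "e3 + e3 + e3 \<le> e" "e3 < top"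
  proof -
    show "0 < e3" using e by (simp add: e3_def ennreal_zero_less_divide)
    show "e3 < top" by (simp add: e3_def min_less_iff_disj)
    have "e3 + e3 + e3 \<le> e / 3 + e / 3 + e / 3" unfolding e3_def by (intro add_mono) auto
    also have "\<dots> = e" by (cases e) (auto simp: ennreal_divide_numeral ennreal_plus[symmetric] ennreal_top_divide simp del: ennreal_plus)
    finally show "e3 + e3 + e3 \<le> e" .
  qed
  obtain g where g: "continuous_on UNIV g" "\<And>x. 0 \<le> g x" "(\<integral>\<^sup>+x\<in>box l u. ennreal \<bar>V x - g x\<bar> \<partial>lebesgue) < e3"
    using continuous_L1_approx[of V "box l u" e3] RM Vint e3 by (auto simp: V_def)
  have [measurable]: "g \<in> borel_measurable lebesgue"
    using borel_measurable_continuous_onI[OF g(1)] by (simp add: measurable_completion)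
  define \<epsilon> where "\<epsilon> = enn2real e3 / (2 * measure lebesgue (box l u))"
  have eps: "0 < \<epsilon>" "ennreal \<epsilon> * emeasure lebesgue (box l u) < e3"
  proof -
    obtain r where r: "e3 = ennreal r" "0 < r" using e3 by (cases e3) auto
    show "0 < \<epsilon>" using r RM(3) by (simp add: \<epsilon>_def)
    have "\<epsilon> * measure lebesgue (box l u) = r / 2" using r RM(3) by (simp add: \<epsilon>_def)
    then have "ennreal \<epsilon> * emeasure lebesgue (box l u) = ennreal (r / 2)"
      unfolding RM(2) using \<open>0 < \<epsilon>\<close> by (subst ennreal_mult[symmetric]) auto
    then show "ennreal \<epsilon> * emeasure lebesgue (box l u) < e3" unfolding r(1) using r(2) by (simp add: ennreal_less_iff)
  qed
  show "\<forall>\<^sub>F N in sequentially. (\<integral>\<^sup>+x\<in>box l u. ennreal \<bar>enn2real (avg (leaf_box (dyadic_list N) l u x) v) - enn2real (v x)\<bar> \<partial>lebesgue) < e"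
    using leaf_box_oscillation[OF lu g(1) eps(1)]
  proof eventually_elim
    case (elim N)
    let ?L = "\<lambda>x. leaf_box (dyadic_list N) l u x"
    let ?D = "\<lambda>y. ennreal \<bar>V y - g y\<bar>"
    \<comment> \<open>Three errors: the average of the approximation error over the leaf, the
      oscillation of \<open>g\<close> there, and the approximation error at \<open>x\<close>. Both
      one-sided bounds are proved for extended numbers, where nothing is subtracted, and combined
      once they are known to be finite.\<close>
    have pt: "ennreal \<bar>enn2real (avg (?L x) v) - V x\<bar> \<le> avg (?L x) ?D + ennreal \<epsilon> + ?D x" if x: "x \<in> box l u" for x
    proof (cases "avg (?L x) ?D = top")
      case False
      have Q: "?L x \<in> rectangles" by (rule leaf_box_rectangle[OF lu])
      have sub: "?L x \<subseteq> box l u"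
      proof -
        obtain l' u' where l': "leaf (dyadic_list N) (l, u) x = (l', u')" by fastforce
        have "x \<in> cbox l u" using x box_subset_cbox by blast
        from leaf_side[OF lu this l'] show ?thesis by (simp add: leaf_box_def l')
      qed
      have 1: "avg (?L x) v \<le> ennreal (g x + \<epsilon>) + avg (?L x) ?D"
      proof -
        have "avg (?L x) v \<le> avg (?L x) (\<lambda>y. ennreal (g x + \<epsilon>) + ?D y)"
          using vfin
        proof (intro avg_mono_AE, eventually_elim, intro impI)
          fix y assume "y \<in> box l u \<longrightarrow> v y = ennreal (V y)" and y: "y \<in> ?L x"
          then have "v y = ennreal (V y)" using sub by auto
          also have "V y \<le> (g x + \<epsilon>) + \<bar>V y - g y\<bar>" using elim x y by fastforce
          also have "ennreal \<dots> = ennreal (g x + \<epsilon>) + ?D y"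
            using g(2)[of x] eps(1) by (intro ennreal_plus) auto
          finally show "v y \<le> ennreal (g x + \<epsilon>) + ?D y" by (simp add: ennreal_leI)
        qed
        also have "\<dots> = ennreal (g x + \<epsilon>) + avg (?L x) ?D"
          using Q by (subst avg_add) (auto simp: avg_const)
        finally show ?thesis .
      qed
      have 2: "ennreal (g x) \<le> avg (?L x) v + avg (?L x) ?D + ennreal \<epsilon>"
      proof -
        have "ennreal (g x) = avg (?L x) (\<lambda>y. ennreal (g x))" using Q by (simp add: avg_const)
        also have "\<dots> \<le> avg (?L x) (\<lambda>y. v y + ?D y + ennreal \<epsilon>)"
          using vfin
        proof (intro avg_mono_AE, eventually_elim, intro impI)
          fix y assume "y \<in> box l u \<longrightarrow> v y = ennreal (V y)" and y: "y \<in> ?L x"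
          then have v: "v y = ennreal (V y)" using sub by auto
          have "0 \<le> V y" by (simp add: V_def)
          moreover have "g x \<le> V y + \<bar>V y - g y\<bar> + \<epsilon>" using elim x y by fastforce
          ultimately show "ennreal (g x) \<le> v y + ?D y + ennreal \<epsilon>"
            unfolding v using eps(1) by (simp add: ennreal_plus[symmetric] ennreal_leI del: ennreal_plus)
        qed
        also have "\<dots> = avg (?L x) v + avg (?L x) ?D + ennreal \<epsilon>"
          using Q by (subst avg_add; (simp add: avg_const)?; subst avg_add; simp)
        finally show ?thesis .
      qed
      obtain D where D: "avg (?L x) ?D = ennreal D" "0 \<le> D" using False by (cases "avg (?L x) ?D") auto
      obtain A where A: "avg (?L x) v = ennreal A" "0 \<le> A" using v_avg[OF Q] by (cases "avg (?L x) v") auto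
      have "A \<le> g x + \<epsilon> + D" "g x \<le> A + D + \<epsilon>"
        using 1 2 D A g(2)[of x] eps(1) by (simp_all add: ennreal_plus[symmetric] del: ennreal_plus)
      then have "\<bar>A - V x\<bar> \<le> D + \<epsilon> + \<bar>V x - g x\<bar>" by linarith
      then show ?thesis
        using D A eps(1) by (simp add: ennreal_plus[symmetric] ennreal_leI del: ennreal_plus)
    qed simp
    have "(\<integral>\<^sup>+x\<in>box l u. ennreal \<bar>enn2real (avg (?L x) v) - V x\<bar> \<partial>lebesgue)
      \<le> (\<integral>\<^sup>+x. avg (?L x) ?D * indicator (box l u) x + ennreal \<epsilon> * indicator (box l u) x + ?D x * indicator (box l u) x \<partial>lebesgue)"
      using pt by (intro nn_integral_mono) (simp add: indicator_def)
    also have "\<dots> = (\<integral>\<^sup>+x\<in>box l u. avg (?L x) ?D \<partial>lebesgue) + (\<integral>\<^sup>+x\<in>box l u. ennreal \<epsilon> \<partial>lebesgue) + (\<integral>\<^sup>+x\<in>box l u. ?D x \<partial>lebesgue)"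
      using RM(1) leaf_box_measurable[of "\<lambda>Q. avg Q ?D"] by (subst nn_integral_add; (simp; fail)?; subst nn_integral_add; simp)
    also have "(\<integral>\<^sup>+x\<in>box l u. avg (?L x) ?D \<partial>lebesgue) = (\<integral>\<^sup>+x\<in>box l u. ?D x \<partial>lebesgue)"
      by (rule nn_integral_leaf_avg[OF lu]) measurable
    also have "(\<integral>\<^sup>+x\<in>box l u. ennreal \<epsilon> \<partial>lebesgue) = ennreal \<epsilon> * emeasure lebesgue (box l u)"
      using RM(1) by (rule nn_integral_cmult_indicator)
    also have "(\<integral>\<^sup>+x\<in>box l u. ?D x \<partial>lebesgue) + ennreal \<epsilon> * emeasure lebesgue (box l u) + (\<integral>\<^sup>+x\<in>box l u. ?D x \<partial>lebesgue) < e3 + e3 + e3"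
      by (intro add_strict_mono g(3) eps(2))
    also have "\<dots> \<le> e" by (rule e3)
    finally show ?case unfolding V_def .
  qed
qed simp

text \<open>
  Stein's and Gehring's self-improvement, with the stopping-time argument replaced by a Bellman
  function, which is a supersolution along the successive halvings of a rectangle.
\<close>

theorem reverse_Holder:
  obtains \<delta> where "0 < \<delta>" "\<And>R. R \<in> rectangles \<Longrightarrow> avg R (\<lambda>x. enn_powr (v x) (1 + \<delta>)) \<le> 2 * enn_powr (avg R v) (1 + \<delta>)"
proof -
  define K' where "K' = 2 powr t * K"
  have "1 \<le> 2 powr t" using t by (simp add: ge_one_powr_ge_zero)
  then have K': "1 \<le> K'" unfolding K'_def using mult_mono[of 1 "2 powr t" 1 K] K_ge_1 by simp
  \<comment> \<open>With \<open>\<delta> * K'\<^sup>2 = 1 / 8\<close> the left-hand side of the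
    smallness condition becomes \<open>(1 + \<delta>) / 4\<close>.\<close>
  define \<delta> where "\<delta> = 1 / (8 * K'\<^sup>2)"
  have K2: "1 \<le> K'\<^sup>2" using K' by (simp add: one_le_power)
  have d: "0 < \<delta>" "\<delta> \<le> 1 / 8" "\<delta> * K'\<^sup>2 = 1 / 8" using K2 by (auto simp: \<delta>_def divide_simps)
  have d3: "2 * \<delta> * (1 + \<delta>) * (2 powr t * K)\<^sup>2 \<le> 1 - \<delta>"
  proof -
    have "2 * \<delta> * (1 + \<delta>) * K'\<^sup>2 = 2 * (1 + \<delta>) * (\<delta> * K'\<^sup>2)" by (simp add: mult_ac)
    also have "\<dots> = (1 + \<delta>) / 4" unfolding d(3) by simp
    also have "\<dots> \<le> 1 - \<delta>" using d(2) by simp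
    finally show ?thesis by (simp add: K'_def)
  qed
  show ?thesis
  proof (rule that[OF d(1)])
    fix R :: "(real ^ 'n) set" assume R: "R \<in> rectangles"
    then obtain l u where Req: "R = box l u" and lu: "\<And>i. l $ i < u $ i" by (auto simp: rectangles_def)
    note RM = rectangles_measure[OF R]
    define V where "V x = enn2real (v x)" for x
    define T where "T N x = enn2real (avg (leaf_box (dyadic_list N) l u x) v)" for N x
    have [measurable]: "V \<in> borel_measurable lebesgue" unfolding V_def by measurable
    have [measurable]: "T N \<in> borel_measurable lebesgue" for N
      unfolding T_def using leaf_box_measurable[of "\<lambda>Q. avg Q v"] by measurable
    note [measurable] = RM(1)
    have Teq: "avg (leaf_box (dyadic_list N) l u x) v = ennreal (T N x)" for N x
      unfolding T_def using v_avg[OF leaf_box_rectangle[OF lu]] by simp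
    have L1: "(\<lambda>N. \<integral>\<^sup>+x. ennreal (norm (indicator R x * (T N x - V x))) \<partial>lebesgue) \<longlonglongrightarrow> 0"
    proof -
      have "ennreal (norm (indicator R x * (T N x - V x))) = ennreal \<bar>T N x - V x\<bar> * indicator R x" for N x
        by (simp add: indicator_def)
      then show ?thesis
        using leaf_avg_tendsto_L1[OF lu] unfolding T_def[symmetric] V_def[symmetric] Req[symmetric] by simp
    qed
    have "\<forall>\<^sub>F N in sequentially. (\<integral>\<^sup>+x. ennreal (norm (indicator R x * (T N x - V x))) \<partial>lebesgue) < top"
      using L1 by (intro order_tendstoD(2)) auto
    then obtain N0 where N0: "\<And>N. N0 \<le> N \<Longrightarrow> (\<integral>\<^sup>+x. ennreal (norm (indicator R x * (T N x - V x))) \<partial>lebesgue) < top"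
      by (auto simp: eventually_sequentially)
    \<comment> \<open>Finite distance in L1 is known from \<open>N0\<close> on only; the shift makes
      every \<open>w N\<close> integrable.\<close>
    define w where "w N x = indicator R x * (T (N + N0) x - V x)" for N x
    have wint: "integrable lebesgue (w N)" for N
      unfolding w_def using N0[of "N + N0"] by (intro integrableI_bounded) auto
    have "(\<lambda>N. \<integral>\<^sup>+x. ennreal (norm (w N x)) \<partial>lebesgue) \<longlonglongrightarrow> ennreal 0"
      unfolding w_def using LIMSEQ_ignore_initial_segment[OF L1, of N0] by simp
    then have "(\<lambda>N. ennreal (\<integral>x. norm (w N x) \<partial>lebesgue)) \<longlonglongrightarrow> ennreal 0"
      using nn_integral_eq_integral[OF integrable_norm[OF wint]] by simp
    then have "(\<lambda>N. \<integral>x. norm (w N x) \<partial>lebesgue) \<longlonglongrightarrow> 0"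
      by (subst (asm) tendsto_ennreal_iff) auto
    from tendsto_L1_AE_subseq[OF wint this] obtain r where r: "strict_mono r"
      "AE x in lebesgue. (\<lambda>n. w (r n) x) \<longlonglongrightarrow> 0" by auto
    \<comment> \<open>Convergence in L1 yields convergence almost everywhere along a subsequence,
      which is enough for Fatou's lemma.\<close>
    define k where "k n = r n + N0" for n
    note vfin = v_finite_AE[OF R, folded V_def]
    have "(\<integral>\<^sup>+x\<in>R. enn_powr (v x) (1 + \<delta>) \<partial>lebesgue)
      \<le> (\<integral>\<^sup>+x. liminf (\<lambda>n. enn_powr (avg (leaf_box (dyadic_list (k n)) l u x) v) (1 + \<delta>) * indicator R x) \<partial>lebesgue)"
      using vfin r(2)
    proof (intro nn_integral_mono_AE, eventually_elim)
      fix x assume vx: "x \<in> R \<longrightarrow> v x = ennreal (V x)" and lim: "(\<lambda>n. w (r n) x) \<longlonglongrightarrow> 0"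
      show "enn_powr (v x) (1 + \<delta>) * indicator R x
        \<le> liminf (\<lambda>n. enn_powr (avg (leaf_box (dyadic_list (k n)) l u x) v) (1 + \<delta>) * indicator R x)"
      proof (cases "x \<in> R")
        case True
        then have "(\<lambda>n. (T (k n) x - V x) + V x) \<longlonglongrightarrow> 0 + V x"
          using lim by (intro tendsto_add tendsto_const) (simp add: w_def k_def)
        then have "(\<lambda>n. T (k n) x powr (1 + \<delta>)) \<longlonglongrightarrow> V x powr (1 + \<delta>)"
          using d(1) by (intro tendsto_powr' tendsto_const) (auto simp: T_def)
        then have "(\<lambda>n. ennreal (T (k n) x powr (1 + \<delta>))) \<longlonglongrightarrow> ennreal (V x powr (1 + \<delta>))"
          by (rule tendsto_ennrealI)
        then have "liminf (\<lambda>n. ennreal (T (k n) x powr (1 + \<delta>))) = ennreal (V x powr (1 + \<delta>))"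
          by (intro lim_imp_Liminf) auto
        moreover have "0 \<le> T N x" "0 \<le> V x" for N by (simp_all add: T_def V_def)
        ultimately show ?thesis using True vx by (simp add: Teq enn_powr_ennreal)
      qed simp
    qed
    also have "\<dots> \<le> liminf (\<lambda>n. \<integral>\<^sup>+x\<in>R. enn_powr (avg (leaf_box (dyadic_list (k n)) l u x) v) (1 + \<delta>) \<partial>lebesgue)"
      using leaf_box_measurable[of "\<lambda>Q. enn_powr (avg Q v) (1 + \<delta>)"] by (intro nn_integral_liminf) measurable
    also have "\<dots> \<le> liminf (\<lambda>n::nat. ennreal (bellman (t - 1) \<delta> (enn2real (avg R v)) (enn2real (avg R s))) * emeasure lebesgue R)"
      unfolding Req by (intro Liminf_mono always_eventually allI leaf_reverse_Holder d3 lu) (use d in auto)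
    also have "\<dots> = ennreal (bellman (t - 1) \<delta> (enn2real (avg R v)) (enn2real (avg R s))) * emeasure lebesgue R"
      by (rule Liminf_const) simp
    also have "\<dots> \<le> (2 * enn_powr (avg R v) (1 + \<delta>)) * emeasure lebesgue R"
    proof (intro mult_right_mono)
      obtain X where X: "avg R v = ennreal X" "0 < X" using v_avg[OF R] by (cases "avg R v") auto
      have "ennreal (bellman (t - 1) \<delta> X Y) \<le> ennreal (2 * X powr (1 + \<delta>))" for Y
        by (intro ennreal_leI) (simp add: bellman_def)
      then show "ennreal (bellman (t - 1) \<delta> (enn2real (avg R v)) (enn2real (avg R s))) \<le> 2 * enn_powr (avg R v) (1 + \<delta>)"
        using X by (simp add: enn_powr_ennreal numeral_mult_ennreal)
    qed simp
    finally show "avg R (\<lambda>x. enn_powr (v x) (1 + \<delta>)) \<le> 2 * enn_powr (avg R v) (1 + \<delta>)"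
      unfolding nn_integral_eq_avg[OF R] using RM(4,5)
      by (simp del: emeasure_completion add: mult.commute[of _ "emeasure lebesgue R"] ennreal_mult_le_mult_iff)
  qed
qed

end

section \<open>Multilinear weights\<close>

lemma ennreal_inverse_antimono: "x \<le> y \<Longrightarrow> inverse y \<le> inverse (x :: ennreal)"
proof (cases x; cases y)
  fix r r' assume "x \<le> y" "x = ennreal r" "y = ennreal r'" "0 \<le> r" "0 \<le> r'"
  then show "inverse y \<le> inverse x"
    by (cases "r = 0") (auto simp: inverse_ennreal intro!: ennreal_leI le_imp_inverse_le)
qed (auto simp: top_unique)

lemma ennreal_inverse_inverse: "inverse (inverse x) = (x :: ennreal)"
proof (cases x)
  case (real r)
  then show ?thesis by (cases "r = 0") (auto simp: inverse_ennreal)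
qed auto

lemma avg_pos:
  assumes R: "R \<in> rectangles" and [measurable]: "f \<in> borel_measurable lebesgue"
  and pos: "AE x in lebesgue. 0 < f x"
  shows "0 < avg R f"
proof (rule ccontr)
  note RM = rectangles_measure[OF R]
  note [measurable] = RM(1)
  assume "\<not> 0 < avg R f"
  then have "(\<integral>\<^sup>+x\<in>R. f x \<partial>lebesgue) = 0" by (simp add: nn_integral_eq_avg[OF R])
  then have "AE x in lebesgue. f x * indicator R x = 0"
    by (subst (asm) nn_integral_0_iff_AE) auto
  with pos have "AE x in lebesgue. x \<notin> R"
    by eventually_elim (auto simp: indicator_def)
  then have "R \<in> null_sets lebesgue" using AE_iff_null_sets[OF RM(1)] by simp
  then show False using RM(4) by (simp add: null_sets_def)
qed

lemma nn_integral_avg_mono: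
  assumes R: "R \<in> rectangles" "R' \<in> rectangles" "R \<subseteq> R'"
  shows "avg R' f < top \<Longrightarrow> avg R f < top"
proof -
  assume "avg R' f < top"
  then have "(\<integral>\<^sup>+x\<in>R'. f x \<partial>lebesgue) < top"
    unfolding nn_integral_eq_avg[OF R(2)] using rectangles_measure(5)[OF R(2)]
    by (simp only: ennreal_mult_less_top simp_thms)
  moreover have "(\<integral>\<^sup>+x\<in>R. f x \<partial>lebesgue) \<le> (\<integral>\<^sup>+x\<in>R'. f x \<partial>lebesgue)"
    using R(3) by (intro nn_integral_mono) (auto simp: indicator_def)
  ultimately have fin: "(\<integral>\<^sup>+x\<in>R. f x \<partial>lebesgue) < top" by (rule le_less_trans[rotated])
  show "avg R f < top"
    unfolding avg_def less_top[symmetric] ennreal_divide_eq_top_iff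
    using fin rectangles_measure(4)[OF R(1)] by (auto simp del: emeasure_completion)
qed

lemma ennreal_prod_less_top:
  fixes f :: "'i \<Rightarrow> ennreal"
  assumes "finite I" "(\<Prod>i\<in>I. f i) < top" "\<And>i. i \<in> I \<Longrightarrow> 0 < f i" "i \<in> I"
  shows "f i < top"
  using assms by (subst (asm) less_top[symmetric]) (auto simp: ennreal_prod_eq_top less_top zero_less_iff_neq_zero)

text \<open>Since \<open>u\<close> is real-valued, this is strictly positive everywhere; it is
  infinite exactly at the zeros of \<open>u\<close>. Positivity is what later excludes products of
  the form \<open>0 * \<infinity>\<close>.\<close>

definition dual_weight :: "real \<Rightarrow> (real ^ 'n \<Rightarrow> real) \<Rightarrow> real ^ 'n \<Rightarrow> ennreal" where
  "dual_weight p u x = inverse (ennreal (u x powr conj_exp p))"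

lemma dual_weight_pos: "0 < dual_weight p u x"
  by (simp add: dual_weight_def ennreal_inverse_positive)

lemma dual_weight_eq: "0 < u x \<Longrightarrow> dual_weight p u x = ennreal (u x powr - conj_exp p)"
  by (simp add: dual_weight_def inverse_ennreal powr_minus)

lemma dual_weight_measurable [measurable]:
  "u \<in> borel_measurable lebesgue \<Longrightarrow> dual_weight p u \<in> borel_measurable lebesgue"
  unfolding dual_weight_def[abs_def] by measurable

lemma dual_factor_eq: "p \<noteq> 1 \<Longrightarrow> dual_factor p R u = enn_powr (avg R (dual_weight p u)) (1 / conj_exp p)"
  unfolding dual_factor_def dual_weight_def[abs_def] by simp

lemma locally_integrable_measurable:
  fixes g :: "real ^ 'n \<Rightarrow> real"
  assumes "locally_integrable g"
  shows "g \<in> borel_measurable lebesgue"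
proof (rule borel_measurable_LIMSEQ_real)
  fix x
  show "(\<lambda>n. indicator (cball 0 (real n)) x *\<^sub>R g x) \<longlonglongrightarrow> g x"
  proof (rule tendsto_eventually)
    have "\<forall>\<^sub>F n in sequentially. norm x \<le> real n"
      using filterlim_real_sequentially unfolding filterlim_at_top by auto
    then show "\<forall>\<^sub>F n in sequentially. indicator (cball 0 (real n)) x *\<^sub>R g x = g x"
      by eventually_elim simp
  qed
next
  fix n
  have "g absolutely_integrable_on cball 0 (real n)"
    using assms by (auto simp: locally_integrable_def)
  then show "(\<lambda>x. indicator (cball 0 (real n)) x *\<^sub>R g x) \<in> borel_measurable lebesgue"
    by (auto simp: set_integrable_def)
qed

section \<open>The multilinear condition, and its consequence (2) back to (1)\<close>

locale weights =
  fixes \<alpha> p q :: real and P :: "'m::finite \<Rightarrow> real" and w :: "'m \<Rightarrow> real ^ 'n \<Rightarrow> real"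
  assumes \<alpha>: "0 \<le> \<alpha>" and P: "\<And>i. 1 < P i" and p_eq: "1 / p = (\<Sum>i\<in>UNIV. 1 / P i)"
  and p: "0 < p" and pq: "p \<le> q" and q_eq: "1 / q = 1 / p - \<alpha> / real CARD('n)"
  and w0: "\<And>i x. 0 \<le> w i x" and w_loc: "\<And>i. locally_integrable (w i)"
begin

definition "P' i = conj_exp (P i)"
definition "\<sigma> i = dual_weight (P i) (w i)"
definition "v x = ennreal (nu w x powr q)"

lemma q: "0 < q" using p pq by simp

lemma P': "1 < P' i" "1 / P i + 1 / P' i = 1" "0 < P' i"
  using P[of i] by (auto simp: P'_def conj_exp_def field_simps)

lemma w_meas [measurable]: "w i \<in> borel_measurable lebesgue"
  by (rule locally_integrable_measurable[OF w_loc])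

lemma nu_meas [measurable]: "nu w \<in> borel_measurable lebesgue"
  unfolding nu_def[abs_def] by measurable

lemma v_meas [measurable]: "v \<in> borel_measurable lebesgue"
  unfolding v_def[abs_def] by measurable

lemma \<sigma>_meas [measurable]: "\<sigma> i \<in> borel_measurable lebesgue"
  unfolding \<sigma>_def by measurable

lemma nu_nonneg: "0 \<le> nu w x"
  unfolding nu_def by (intro prod_nonneg) (auto simp: w0)

lemma v_eq_0_iff: "v x = 0 \<longleftrightarrow> nu w x = 0"
  using powr_ge_zero[of "nu w x" q] by (simp add: v_def ennreal_eq_0_iff order_antisym_conv)

lemma \<sigma>_pos: "0 < \<sigma> i x" by (simp add: \<sigma>_def dual_weight_pos)

definition "A = A_const P q w"

lemma stmt1_iff: "w \<in> A_class P q \<longleftrightarrow> A < top"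
  by (auto simp: A_class_def A_def w0)

definition "A_term R = enn_powr (avg R v) (1 / q) * (\<Prod>i\<in>UNIV. enn_powr (avg R (\<sigma> i)) (1 / P' i))"

lemma A_eq: "A = (SUP R\<in>rectangles. A_term R)"
proof -
  have "P i \<noteq> 1" for i using P[of i] by simp
  then show ?thesis
    unfolding A_def A_const_def A_term_def v_def[abs_def] by (simp add: dual_factor_eq \<sigma>_def P'_def)
qed

lemma A_term_le: "R \<in> rectangles \<Longrightarrow> A_term R \<le> A"
  unfolding A_eq by (rule SUP_upper)

text \<open>Cubes exhaust the space, so every rectangle lies in one on which \<open>v\<close> has
  positive average. There all factors of \<open>A_term\<close> are positive, so finiteness of the
  product forces finiteness of each factor, and integrals over subrectangles inherit it.
  Integrability of \<open>\<sigma> i\<close> in turn excludes zeros of \<open>w i\<close> on sets of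
  positive measure.\<close>

lemma dichotomy:
  assumes A: "A < top" and nz: "\<not> (AE x in lebesgue. nu w x = 0)"
  shows "R \<in> rectangles \<Longrightarrow> avg R v < top" "R \<in> rectangles \<Longrightarrow> avg R (\<sigma> i) < top"
    "AE x in lebesgue. 0 < w i x"
proof -
  define Q :: "nat \<Rightarrow> (real ^ 'n) set" where "Q k = box (\<chi> i. - real (Suc k)) (\<chi> i. real (Suc k))" for k
  have Q: "Q k \<in> rectangles" for k unfolding Q_def by (rule rectangles_box) simp
  have Qmono: "Q k \<subseteq> Q l" if "k \<le> l" for k l
  proof
    fix x assume "x \<in> Q k"
    then have "- real (Suc k) < x $ i \<and> x $ i < real (Suc k)" for i
      unfolding Q_def mem_box_cart by simp
    moreover have "real (Suc k) \<le> real (Suc l)" using that by simp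
    ultimately have "- real (Suc l) < x $ i \<and> x $ i < real (Suc l)" for i
      by (smt (verit, best))
    then show "x \<in> Q l" unfolding Q_def mem_box_cart by simp
  qed
  have Qcov: "\<exists>k. x \<in> Q k" for x
  proof -
    obtain k where "norm x < real k" using reals_Archimedean2 by blast
    then have bd: "\<bar>x $ i\<bar> < real (Suc k)" for i using component_le_norm_cart[of x i] by simp
    have "- real (Suc k) < x $ i \<and> x $ i < real (Suc k)" for i using bd[of i] by arith
    then have "x \<in> Q k" unfolding Q_def mem_box_cart by simp
    then show ?thesis ..
  qed
  have "\<exists>k. 0 < avg (Q k) v"
  proof (rule ccontr)
    assume no: "\<nexists>k. 0 < avg (Q k) v"
    have "AE x in lebesgue. x \<in> Q k \<longrightarrow> nu w x = 0" for k
    proof -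
      note [measurable] = rectangles_measure(1)[OF Q[of k]]
      have "(\<integral>\<^sup>+x\<in>Q k. v x \<partial>lebesgue) = 0" using no by (simp add: nn_integral_eq_avg[OF Q])
      then have "AE x in lebesgue. v x * indicator (Q k) x = 0" by (subst (asm) nn_integral_0_iff_AE) auto
      then show ?thesis by eventually_elim (auto simp: v_eq_0_iff indicator_def)
    qed
    then have "AE x in lebesgue. \<forall>k. x \<in> Q k \<longrightarrow> nu w x = 0" unfolding AE_all_countable by blast
    then have "AE x in lebesgue. nu w x = 0" by eventually_elim (use Qcov in blast)
    then show False using nz by simp
  qed
  then obtain k0 where k0: "0 < avg (Q k0) v" by auto
  have big: "\<exists>R'\<in>rectangles. R \<subseteq> R' \<and> 0 < avg R' v" if R: "R \<in> rectangles" for R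
  proof -
    obtain l u where lu: "R = box l u" using R by (auto simp: rectangles_def)
    obtain k1 where k1: "norm l + norm u < real k1" using reals_Archimedean2 by blast
    have b: "- real (Suc k1) \<le> l $ i" "u $ i \<le> real (Suc k1)" for i
    proof -
      have "\<bar>l $ i\<bar> \<le> norm l" "\<bar>u $ i\<bar> \<le> norm u" "0 \<le> norm l" "0 \<le> norm u"
        by (simp_all add: component_le_norm_cart)
      then show "- real (Suc k1) \<le> l $ i" "u $ i \<le> real (Suc k1)" using k1 by simp_all
    qed
    have "R \<subseteq> Q k1"
    proof
      fix x assume "x \<in> R"
      then have "- real (Suc k1) < x $ i \<and> x $ i < real (Suc k1)" for i
        using b[of i] unfolding lu mem_box_cart by (meson le_less_trans less_le_trans)
      then show "x \<in> Q k1" unfolding Q_def mem_box_cart by simp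
    qed
    then have "R \<subseteq> Q (max k0 k1)" using Qmono[of k1 "max k0 k1"] by auto
    moreover have "0 < avg (Q (max k0 k1)) v"
    proof -
      have "(\<integral>\<^sup>+x\<in>Q k0. v x \<partial>lebesgue) \<le> (\<integral>\<^sup>+x\<in>Q (max k0 k1). v x \<partial>lebesgue)"
        using Qmono[of k0 "max k0 k1"] by (intro nn_integral_mono) (auto simp: indicator_def)
      moreover have "0 < (\<integral>\<^sup>+x\<in>Q k0. v x \<partial>lebesgue)"
        unfolding nn_integral_eq_avg[OF Q] using k0 rectangles_measure(4)[OF Q]
        by (simp only: ennreal_zero_less_mult_iff zero_less_iff_neq_zero simp_thms) simp
      ultimately have "0 < (\<integral>\<^sup>+x\<in>Q (max k0 k1). v x \<partial>lebesgue)" by (rule less_le_trans[rotated])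
      then show ?thesis unfolding nn_integral_eq_avg[OF Q] by (simp only: ennreal_zero_less_mult_iff)
    qed
    ultimately show ?thesis using Q by blast
  qed
  have fin: "avg R v < top \<and> (\<forall>i. avg R (\<sigma> i) < top)" if R: "R \<in> rectangles" for R
  proof -
    obtain R' where R': "R' \<in> rectangles" "R \<subseteq> R'" "0 < avg R' v" using big[OF R] by blast
    have pos: "0 < enn_powr (avg R' (\<sigma> i)) (1 / P' i)" for i
      using \<sigma>_pos by (auto intro!: avg_pos R')
    have lt: "A_term R' < top" using A_term_le[OF R'(1)] A by (rule le_less_trans)
    have "(\<Prod>i\<in>UNIV. enn_powr (avg R' (\<sigma> i)) (1 / P' i)) \<noteq> 0"
      using pos by (simp add: zero_less_iff_neq_zero)
    then have "enn_powr (avg R' v) (1 / q) < top" "(\<Prod>i\<in>UNIV. enn_powr (avg R' (\<sigma> i)) (1 / P' i)) < top"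
      using lt R'(3) unfolding A_term_def by (auto simp: ennreal_mult_less_top)
    moreover from this(2) have "enn_powr (avg R' (\<sigma> i)) (1 / P' i) < top" for i
      using pos by (intro ennreal_prod_less_top[of UNIV "\<lambda>i. enn_powr (avg R' (\<sigma> i)) (1 / P' i)" i]) auto
    ultimately show ?thesis using nn_integral_avg_mono[OF R R'(1,2)] by simp
  qed
  then show "R \<in> rectangles \<Longrightarrow> avg R v < top" "R \<in> rectangles \<Longrightarrow> avg R (\<sigma> i) < top" by auto
  have "AE x in lebesgue. x \<in> Q k \<longrightarrow> 0 < w i x" for k
  proof -
    have "(\<integral>\<^sup>+x\<in>Q k. \<sigma> i x \<partial>lebesgue) < top"
      unfolding nn_integral_eq_avg[OF Q] using fin[OF Q[of k]] rectangles_measure(5)[OF Q]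
      by (simp only: ennreal_mult_less_top simp_thms)
    then have "AE x in lebesgue. \<sigma> i x * indicator (Q k) x \<noteq> \<infinity>"
      using rectangles_measure(1)[OF Q[of k]]
      by (intro nn_integral_PInf_AE borel_measurable_times_ennreal borel_measurable_indicator \<sigma>_meas) auto
    then show ?thesis
    proof eventually_elim
      case (elim x)
      then show ?case using w0[of i x] P'(3)[of i]
        by (cases "w i x = 0") (auto simp: \<sigma>_def dual_weight_def indicator_def P'_def)
    qed
  qed
  then have "AE x in lebesgue. \<forall>k. x \<in> Q k \<longrightarrow> 0 < w i x" unfolding AE_all_countable by blast
  then show "AE x in lebesgue. 0 < w i x" by eventually_elim (use Qcov in blast)
qed

text \<open>The first factor vanishes on every rectangle and \<open>0 * \<infinity> = 0\<close>, so
  every admissible \<open>r\<close> will do; the smallest exponent is the largest admissible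
  choice.\<close>

lemma stmt1_imp_stmt2_degenerate:
  assumes "AE x in lebesgue. nu w x = 0"
  shows "\<exists>r>1. (\<forall>i. 1 \<le> P i / r) \<and> (\<lambda>i x. w i x powr r) \<in> A_class (\<lambda>i. P i / r) (q / r)"
proof -
  define r where "r = Min (range P)"
  have r: "1 < r" "\<And>i. r \<le> P i" using P unfolding r_def by auto
  have "avg R (\<lambda>x. ennreal (nu (\<lambda>i x. w i x powr r) x powr (q / r))) = 0" if "R \<in> rectangles" for R
  proof -
    have "avg R (\<lambda>x. ennreal (nu (\<lambda>i x. w i x powr r) x powr (q / r))) = avg R (\<lambda>_. 0)"
      using assms by (intro avg_cong_AE, eventually_elim) (auto simp: nu_def)
    then show ?thesis using that by (simp add: avg_const)
  qed
  then have "A_const (\<lambda>i. P i / r) (q / r) (\<lambda>i x. w i x powr r) = 0"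
    unfolding A_const_def by (intro antisym SUP_least) auto
  then show ?thesis using r
    by (intro exI[of _ r]) (auto simp: A_class_def)
qed

lemma nu_powr: "nu (\<lambda>i x. w i x powr r) x = nu w x powr r"
  unfolding nu_def by (simp add: prod_powr_distrib w0)

lemma \<sigma>_powr: "0 < c \<Longrightarrow> inverse (ennreal ((w i x powr r) powr c)) = enn_powr (\<sigma> i x) (r * c / P' i)" if "0 < r"
  using P'(3)[of i] that
  by (simp add: \<sigma>_def dual_weight_def enn_powr_inverse enn_powr_ennreal powr_powr P'_def[symmetric])

text \<open>The dual weights of the powers \<open>w i powr r\<close> are powers
  \<open>\<sigma> i\<close> to the exponent \<open>r * c / P' i\<close>, which is at least 1;
  Jensen's inequality in each factor gives \<open>A \<le> enn_powr A2 (1 / r)\<close>. The average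
  of \<open>v\<close> is the same on both sides.\<close>

lemma stmt2_imp_stmt1:
  assumes r: "1 < r" "\<And>i. 1 \<le> P i / r"
  and A2: "(\<lambda>i x. w i x powr r) \<in> A_class (\<lambda>i. P i / r) (q / r)"
  shows "A < top"
proof -
  let ?w = "\<lambda>i x. w i x powr r"
  define A2 where "A2 = A_const (\<lambda>i. P i / r) (q / r) ?w"
  have A2_fin: "A2 < top" using A2 by (simp add: A2_def A_class_def)
  have "A \<le> enn_powr A2 (1 / r)"
    unfolding A_eq
  proof (rule SUP_least)
    fix R :: "(real ^ 'n) set" assume R: "R \<in> rectangles"
    have v_eq: "(\<lambda>x. ennreal (nu ?w x powr (q / r))) = v"
      using r by (auto simp: nu_powr powr_powr v_def)
    have dual: "enn_powr (enn_powr (avg R (\<sigma> i)) (1 / P' i)) r \<le> dual_factor (P i / r) R (?w i)" for i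
    proof (cases "P i / r = 1")
      \<comment> \<open>The endpoint \<open>P i = r\<close>: every essential lower bound of
        \<open>w i powr r\<close> bounds \<open>\<sigma> i\<close>, and hence its average, from
        above.\<close>
      case True
      have "ess_inf R (\<lambda>x. ennreal (?w i x)) \<le> inverse (enn_powr (avg R (\<sigma> i)) (r / P' i))"
        unfolding ess_inf_def
      proof (rule Sup_least, clarify)
        fix c assume c: "AE x in lebesgue. x \<in> R \<longrightarrow> c \<le> ennreal (?w i x)"
        have "avg R (\<sigma> i) \<le> avg R (\<lambda>x. inverse (enn_powr c (P' i / r)))"
          using c
        proof (intro avg_mono_AE, eventually_elim, intro impI)
          fix x assume "x \<in> R \<longrightarrow> c \<le> ennreal (?w i x)" "x \<in> R"
          then have "enn_powr c (P' i / r) \<le> enn_powr (ennreal (?w i x)) (P' i / r)"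
            using r P'(3)[of i] by (intro enn_powr_mono) auto
          also have "\<dots> = ennreal (w i x powr P' i)" using r by (simp add: enn_powr_ennreal powr_powr)
          finally show "\<sigma> i x \<le> inverse (enn_powr c (P' i / r))"
            unfolding \<sigma>_def dual_weight_def P'_def[symmetric] by (rule ennreal_inverse_antimono)
        qed
        also have "\<dots> = inverse (enn_powr c (P' i / r))" by (rule avg_const[OF R])
        finally have "enn_powr (avg R (\<sigma> i)) (r / P' i) \<le> enn_powr (inverse (enn_powr c (P' i / r))) (r / P' i)"
          using r P'(3)[of i] by (intro enn_powr_mono) auto
        also have "\<dots> = inverse c" using r P'(3)[of i] by (simp add: enn_powr_inverse enn_powr_powr)
        finally have "inverse (inverse c) \<le> inverse (enn_powr (avg R (\<sigma> i)) (r / P' i))"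
          by (rule ennreal_inverse_antimono)
        then show "c \<le> inverse (enn_powr (avg R (\<sigma> i)) (r / P' i))"
          by (simp only: ennreal_inverse_inverse)
      qed
      then have "inverse (inverse (enn_powr (avg R (\<sigma> i)) (r / P' i))) \<le> dual_factor (P i / r) R (?w i)"
        unfolding dual_factor_def using True by (simp only: ennreal_inverse_antimono if_True refl)
      then show ?thesis by (simp add: enn_powr_powr ennreal_inverse_inverse)
    next
      case False
      define c where "c = conj_exp (P i / r)"
      have Pr: "r < P i" using r(2)[of i] False r(1) by (cases "P i = r") (auto simp: field_simps)
      have c: "0 < c" "1 \<le> r * c / P' i"
        using Pr r(1) P[of i] by (auto simp: c_def conj_exp_def P'_def field_simps)
      have d: "dual_weight (P i / r) (?w i) = (\<lambda>x. enn_powr (\<sigma> i x) (r * c / P' i))"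
        using \<sigma>_powr[of r c i] r c by (auto simp: dual_weight_def c_def)
      have "avg R (\<sigma> i) \<le> enn_powr (avg R (\<lambda>x. enn_powr (\<sigma> i x) (r * c / P' i))) (1 / (r * c / P' i))"
        by (intro avg_Jensen R c) measurable
      then have "enn_powr (avg R (\<sigma> i)) (r / P' i)
         \<le> enn_powr (enn_powr (avg R (\<lambda>x. enn_powr (\<sigma> i x) (r * c / P' i))) (1 / (r * c / P' i))) (r / P' i)"
        using r P'(3)[of i] by (intro enn_powr_mono) auto
      also have "\<dots> = enn_powr (avg R (\<lambda>x. enn_powr (\<sigma> i x) (r * c / P' i))) (1 / c)"
        using r c P'(3)[of i] by (simp add: enn_powr_powr)
      finally show ?thesis using False by (simp add: enn_powr_powr dual_factor_eq d c_def)
    qed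
    have "enn_powr (A_term R) r = enn_powr (avg R v) (r / q) * (\<Prod>i\<in>UNIV. enn_powr (enn_powr (avg R (\<sigma> i)) (1 / P' i)) r)"
      unfolding A_term_def by (simp add: enn_powr_mult enn_powr_prod enn_powr_powr)
    also have "\<dots> \<le> enn_powr (avg R v) (r / q) * (\<Prod>i\<in>UNIV. dual_factor (P i / r) R (?w i))"
      by (intro mult_left_mono prod_mono_ennreal dual) auto
    also have "\<dots> \<le> A2"
      unfolding A2_def A_const_def using R by (intro SUP_upper2[OF R]) (simp add: v_eq)
    finally show "A_term R \<le> enn_powr A2 (1 / r)"
      using r by (subst enn_powr_le_iff[symmetric]) auto
  qed
  also have "\<dots> < top" using A2_fin by simp
  finally show ?thesis .
qed

end

section \<open>Linear Muckenhoupt conditions for the individual weights, and the step from (1) to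
  (2)\<close>

locale nondegenerate_weights = weights \<alpha> p q P w
  for \<alpha> p q :: real and P :: "'m::finite \<Rightarrow> real" and w :: "'m \<Rightarrow> real ^ 'n \<Rightarrow> real" +
  assumes A_fin: "A < top" and nz: "\<not> (AE x in lebesgue. nu w x = 0)"
begin

lemmas v_fin = dichotomy(1)[OF A_fin nz]
lemmas \<sigma>_fin = dichotomy(2)[OF A_fin nz]

lemma w_pos: "AE x in lebesgue. \<forall>i. 0 < w i x"
  using dichotomy(3)[OF A_fin nz] by (simp add: AE_all_countable)

lemma v_pos: "AE x in lebesgue. 0 < v x"
  using w_pos
proof eventually_elim
  case (elim x)
  then have "0 < nu w x" unfolding nu_def by (intro prod_pos) auto
  then show ?case by (simp add: zero_less_iff_neq_zero v_eq_0_iff)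
qed

text \<open>Where all \<open>w j\<close> are positive, \<open>\<sigma> j\<close> to the power
  \<open>1 / P' j\<close> is the reciprocal of \<open>w j\<close>. This is \<open>A_term\<close>
  with averages replaced by values, and supplies the pointwise hypothesis of
  \<open>strong_Ap\<close>.\<close>

lemma pointwise_product: "AE x in lebesgue. enn_powr (v x) (1 / q) * (\<Prod>j\<in>UNIV. enn_powr (\<sigma> j x) (1 / P' j)) = 1"
  using w_pos
proof eventually_elim
  case (elim x)
  have "enn_powr (\<sigma> j x) (1 / P' j) = ennreal (inverse (w j x))" for j
  proof -
    have "(w j x powr - P' j) powr (1 / P' j) = inverse (w j x)"
      unfolding powr_powr using elim P'(3)[of j] by (simp add: powr_minus less_imp_le)
    then show ?thesis using elim by (simp add: \<sigma>_def dual_weight_eq P'_def[symmetric] enn_powr_ennreal)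
  qed
  moreover have "enn_powr (v x) (1 / q) = ennreal (nu w x)"
    using q nu_nonneg[of x] by (simp add: v_def enn_powr_ennreal powr_powr)
  moreover have "ennreal (nu w x) * (\<Prod>j\<in>UNIV. ennreal (inverse (w j x))) = ennreal (\<Prod>j\<in>UNIV. w j x * inverse (w j x))"
    using elim nu_nonneg[of x]
    by (subst prod_ennreal) (auto simp: less_imp_le nu_def prod.distrib ennreal_mult prod_nonneg)
  moreover have "(\<Prod>j\<in>UNIV. w j x * inverse (w j x)) = 1"
    using elim by (intro prod.neutral) (simp add: less_imp_neq[symmetric])
  ultimately show ?case by simp
qed

lemma avg_v_pos: "R \<in> rectangles \<Longrightarrow> 0 < avg R v"
  using v_pos by (intro avg_pos) auto

lemma avg_\<sigma>_pos: "R \<in> rectangles \<Longrightarrow> 0 < avg R (\<sigma> i)"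
  using \<sigma>_pos by (intro avg_pos) auto

text \<open>The partner of \<open>\<sigma> i\<close> is a geometric mean of \<open>v\<close> and the
  other dual weights, with exponents proportional to \<open>1 / q\<close> and
  \<open>1 / P' j\<close>. Hoelder's inequality bounds its average by the product of averages, and
  the condition becomes \<open>A_term\<close> to the power \<open>P' i\<close>.\<close>

lemma \<sigma>_strong_Ap: "\<exists>s t K. strong_Ap (\<sigma> i) s t K"
proof -
  \<comment> \<open>Normalises the exponents \<open>\<theta>\<close> to sum 1; then
    \<open>(t - 1) * \<theta> j\<close> is \<open>P' i\<close> times \<open>1 / q\<close> or
    \<open>1 / P' j\<close>.\<close>
  define si where "si = 1 / (1 / q + (\<Sum>j\<in>UNIV - {i}. 1 / P' j))"
  define \<theta> where "\<theta> j = si * (if j = i then 1 / q else 1 / P' j)" for j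
  define g where "g j = (if j = i then v else \<sigma> j)" for j
  define s where "s x = (\<Prod>j\<in>UNIV. enn_powr (g j x) (\<theta> j))" for x
  define t where "t = 1 + P' i / si"
  have den: "0 < 1 / q + (\<Sum>j\<in>UNIV - {i}. 1 / P' j)"
    using q P'(3) by (intro add_pos_nonneg sum_nonneg) (auto simp: less_imp_le)
  then have si: "0 < si" by (simp add: si_def)
  have th: "0 < \<theta> j" for j using si q P'(3) by (simp add: \<theta>_def)
  have th1: "(\<Sum>j\<in>UNIV. \<theta> j) = 1"
  proof -
    have "(\<Sum>j\<in>UNIV. \<theta> j) = si * (1 / q + (\<Sum>j\<in>UNIV - {i}. 1 / P' j))"
      unfolding \<theta>_def sum_distrib_left[symmetric] by (subst sum.remove[of _ i]) auto
    then show ?thesis using den by (simp add: si_def)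
  qed
  \<comment> \<open>One identity for two uses: on values, where \<open>pointwise_product\<close>
    makes the right-hand side 1, and on averages, where it is a power of
    \<open>A_term\<close>.\<close>
  have alg: "S i * enn_powr (\<Prod>j\<in>UNIV. enn_powr (if j = i then V else S j) (\<theta> j)) (t - 1)
     = enn_powr (enn_powr V (1 / q) * (\<Prod>j\<in>UNIV. enn_powr (S j) (1 / P' j))) (P' i)" for S :: "'m \<Rightarrow> ennreal" and V
  proof -
    have "enn_powr (\<Prod>j\<in>UNIV. enn_powr (if j = i then V else S j) (\<theta> j)) (t - 1)
      = enn_powr V (P' i / q) * (\<Prod>j\<in>UNIV - {i}. enn_powr (S j) (P' i / P' j))"
      unfolding enn_powr_prod using si
      by (subst prod.remove[of _ i]) (auto simp: enn_powr_powr \<theta>_def t_def mult.commute intro!: arg_cong2[where f="(*)"] prod.cong)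
    moreover have "enn_powr (enn_powr V (1 / q) * (\<Prod>j\<in>UNIV. enn_powr (S j) (1 / P' j))) (P' i)
      = enn_powr V (P' i / q) * (S i * (\<Prod>j\<in>UNIV - {i}. enn_powr (S j) (P' i / P' j)))"
      unfolding enn_powr_mult enn_powr_prod using P'(3)[of i]
      by (subst prod.remove[of _ i]) (auto simp: enn_powr_powr)
    ultimately show ?thesis by (simp add: mult_ac)
  qed
  have g_meas [measurable]: "g j \<in> borel_measurable lebesgue" for j by (simp add: g_def)
  have s_meas: "s \<in> borel_measurable lebesgue" unfolding s_def[abs_def] by measurable
  have s_pos: "AE x in lebesgue. 0 < s x"
    using v_pos by eventually_elim (auto simp: s_def g_def zero_less_iff_neq_zero \<sigma>_pos[THEN less_imp_neq, symmetric])
  have s_avg: "avg R s \<le> (\<Prod>j\<in>UNIV. enn_powr (if j = i then avg R v else avg R (\<sigma> j)) (\<theta> j))" if R: "R \<in> rectangles" for R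
  proof -
    have "avg R s \<le> (\<Prod>j\<in>UNIV. enn_powr (avg R (g j)) (\<theta> j))"
      unfolding s_def[abs_def] by (intro avg_Holder R th th1 g_meas) auto
    also have "(\<lambda>j. avg R (g j)) = (\<lambda>j. if j = i then avg R v else avg R (\<sigma> j))"
      by (auto simp: g_def)
    finally show ?thesis by (simp add: fun_eq_iff)
  qed
  have t1: "1 < t" using si P'(3)[of i] by (simp add: t_def)
  have "strong_Ap (\<sigma> i) s t (enn2real (enn_powr A (P' i)))"
  proof
    show "1 < t" by (rule t1)
    show "AE x in lebesgue. 1 \<le> \<sigma> i x * enn_powr (s x) (t - 1)"
      using pointwise_product
    proof eventually_elim
      case (elim x)
      have "s x = (\<Prod>j\<in>UNIV. enn_powr (if j = i then v x else \<sigma> j x) (\<theta> j))"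
        unfolding s_def g_def by (intro prod.cong) auto
      then show ?case using alg[of "\<lambda>j. \<sigma> j x" "v x"] elim by simp
    qed
    fix R :: "(real ^ 'n) set" assume R: "R \<in> rectangles"
    show "0 < avg R (\<sigma> i) \<and> avg R (\<sigma> i) < top" using avg_\<sigma>_pos \<sigma>_fin R by auto
    have "(\<Prod>j\<in>UNIV. enn_powr (if j = i then avg R v else avg R (\<sigma> j)) (\<theta> j)) < top"
      using v_fin[OF R] \<sigma>_fin[OF R] unfolding less_top[symmetric] by (subst ennreal_prod_eq_top) auto
    then show "0 < avg R s \<and> avg R s < top"
      using s_avg[OF R] avg_pos[OF R s_meas s_pos] by (auto intro: le_less_trans)
    have "avg R (\<sigma> i) * enn_powr (avg R s) (t - 1)
        \<le> avg R (\<sigma> i) * enn_powr (\<Prod>j\<in>UNIV. enn_powr (if j = i then avg R v else avg R (\<sigma> j)) (\<theta> j)) (t - 1)"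
      using s_avg[OF R] t1 by (intro mult_left_mono enn_powr_mono) auto
    also have "\<dots> = enn_powr (A_term R) (P' i)" unfolding A_term_def by (rule alg)
    also have "\<dots> \<le> enn_powr A (P' i)" using A_term_le[OF R] P'(3)[of i] by (intro enn_powr_mono) auto
    also have "\<dots> = ennreal (enn2real (enn_powr A (P' i)))" using A_fin by simp
    finally show "avg R (\<sigma> i) * enn_powr (avg R s) (t - 1) \<le> ennreal (enn2real (enn_powr A (P' i)))" .
  qed (auto simp: s_meas)
  then show ?thesis by blast
qed

text \<open>Equals m - 1 / p, where m is the number of weights.\<close>

definition "\<kappa> = (\<Sum>j\<in>UNIV. 1 / P' j)"

lemma \<kappa>: "0 < \<kappa>"
  unfolding \<kappa>_def using P'(3) by (intro sum_pos) auto

text \<open>The same construction with \<open>v\<close> singled out: the exponents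
  \<open>1 / (P' j * \<kappa>)\<close> sum to 1, so \<open>t - 1 = q * \<kappa>\<close> turns the
  condition into \<open>A_term\<close> to the power \<open>q\<close>.\<close>

lemma v_strong_Ap:
  "strong_Ap v (\<lambda>x. \<Prod>j\<in>UNIV. enn_powr (\<sigma> j x) (1 / (P' j * \<kappa>))) (1 + q * \<kappa>) (enn2real (enn_powr A q))"
proof -
  define s where "s x = (\<Prod>j\<in>UNIV. enn_powr (\<sigma> j x) (1 / (P' j * \<kappa>)))" for x
  have alg: "V * enn_powr (\<Prod>j\<in>UNIV. enn_powr (S j) (1 / (P' j * \<kappa>))) (q * \<kappa>)
     = enn_powr (enn_powr V (1 / q) * (\<Prod>j\<in>UNIV. enn_powr (S j) (1 / P' j))) q" for S :: "'m \<Rightarrow> ennreal" and V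
    unfolding enn_powr_mult enn_powr_prod using \<kappa> q by (simp add: enn_powr_powr)
  have s_meas: "s \<in> borel_measurable lebesgue" unfolding s_def[abs_def] by measurable
  have s_pos: "AE x in lebesgue. 0 < s x"
    by (simp add: s_def zero_less_iff_neq_zero \<sigma>_pos[THEN less_imp_neq, symmetric])
  have s_avg: "avg R s \<le> (\<Prod>j\<in>UNIV. enn_powr (avg R (\<sigma> j)) (1 / (P' j * \<kappa>)))" if R: "R \<in> rectangles" for R
    unfolding s_def[abs_def]
  proof (intro avg_Holder R)
    have "(\<Sum>j\<in>UNIV. 1 / (P' j * \<kappa>)) = (\<Sum>j\<in>UNIV. 1 / P' j) / \<kappa>"
      by (simp add: sum_divide_distrib)
    then show "(\<Sum>j\<in>UNIV. 1 / (P' j * \<kappa>)) = 1" using \<kappa> unfolding \<kappa>_def[symmetric] by simp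
  qed (use \<kappa> P'(3) in auto)
  have "strong_Ap v s (1 + q * \<kappa>) (enn2real (enn_powr A q))"
  proof
    show "1 < 1 + q * \<kappa>" using q \<kappa> by simp
    show "AE x in lebesgue. 1 \<le> v x * enn_powr (s x) (1 + q * \<kappa> - 1)"
      using pointwise_product by eventually_elim (use alg in \<open>simp add: s_def\<close>)
    fix R :: "(real ^ 'n) set" assume R: "R \<in> rectangles"
    show "0 < avg R v \<and> avg R v < top" using avg_v_pos v_fin R by auto
    have "(\<Prod>j\<in>UNIV. enn_powr (avg R (\<sigma> j)) (1 / (P' j * \<kappa>))) < top"
      using \<sigma>_fin[OF R] unfolding less_top[symmetric] by (subst ennreal_prod_eq_top) auto
    then show "0 < avg R s \<and> avg R s < top"
      using s_avg[OF R] avg_pos[OF R s_meas s_pos] by (auto intro: le_less_trans)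
    have "avg R v * enn_powr (avg R s) (q * \<kappa>)
        \<le> avg R v * enn_powr (\<Prod>j\<in>UNIV. enn_powr (avg R (\<sigma> j)) (1 / (P' j * \<kappa>))) (q * \<kappa>)"
      using s_avg[OF R] q \<kappa> by (intro mult_left_mono enn_powr_mono) auto
    also have "\<dots> = enn_powr (A_term R) q" unfolding A_term_def by (rule alg)
    also have "\<dots> \<le> enn_powr A q" using A_term_le[OF R] q by (intro enn_powr_mono) auto
    also have "\<dots> = ennreal (enn2real (enn_powr A q))" using A_fin by simp
    finally show "avg R v * enn_powr (avg R s) (1 + q * \<kappa> - 1) \<le> ennreal (enn2real (enn_powr A q))" by simp
  qed (auto simp: s_meas)
  then show ?thesis by (simp add: s_def[abs_def])
qed

lemma \<sigma>_reverse_Holder: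
  "\<exists>\<delta>. \<forall>i. 0 < \<delta> i \<and> (\<forall>R\<in>rectangles.
     enn_powr (avg R (\<lambda>x. enn_powr (\<sigma> i x) (1 + \<delta> i))) (1 / (1 + \<delta> i)) \<le> 2 * avg R (\<sigma> i))"
proof (intro choice allI)
  fix i
  obtain s t K where "strong_Ap (\<sigma> i) s t K" using \<sigma>_strong_Ap by blast
  then interpret S: strong_Ap "\<sigma> i" s t K .
  obtain \<delta> where d: "0 < \<delta>" and rh: "\<And>R. R \<in> rectangles \<Longrightarrow>
      avg R (\<lambda>x. enn_powr (\<sigma> i x) (1 + \<delta>)) \<le> 2 * enn_powr (avg R (\<sigma> i)) (1 + \<delta>)"
    using S.reverse_Holder by blast
  have "enn_powr (avg R (\<lambda>x. enn_powr (\<sigma> i x) (1 + \<delta>))) (1 / (1 + \<delta>)) \<le> 2 * avg R (\<sigma> i)"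
    if R: "R \<in> rectangles" for R
  proof -
    have "enn_powr (avg R (\<lambda>x. enn_powr (\<sigma> i x) (1 + \<delta>))) (1 / (1 + \<delta>))
      \<le> enn_powr (2 * enn_powr (avg R (\<sigma> i)) (1 + \<delta>)) (1 / (1 + \<delta>))"
      using rh[OF R] d by (intro enn_powr_mono) auto
    also have "\<dots> = enn_powr 2 (1 / (1 + \<delta>)) * avg R (\<sigma> i)"
      using d by (simp add: enn_powr_mult enn_powr_powr)
    also have "enn_powr 2 (1 / (1 + \<delta>)) \<le> 2"
      using d by (intro enn_powr_le_self) auto
    finally show ?thesis by (simp add: mult_right_mono)
  qed
  then show "\<exists>\<delta>. 0 < \<delta> \<and> (\<forall>R\<in>rectangles.
     enn_powr (avg R (\<lambda>x. enn_powr (\<sigma> i x) (1 + \<delta>))) (1 / (1 + \<delta>)) \<le> 2 * avg R (\<sigma> i))"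
    using d by blast
qed

text \<open>The dual weight of \<open>w i powr r\<close> is the power
  \<open>y = r * c / P' i\<close> of \<open>\<sigma> i\<close>, and \<open>y\<close> tends to 1 as
  \<open>r\<close> decreases to 1. Once \<open>y \<le> 1 + \<delta> i\<close> for all of the
  finitely many \<open>i\<close>, the reverse Hoelder inequality controls the dual factors; the
  average of \<open>v\<close> does not change.\<close>

lemma stmt1_imp_stmt2:
  "\<exists>r>1. (\<forall>i. 1 \<le> P i / r) \<and> (\<lambda>i x. w i x powr r) \<in> A_class (\<lambda>i. P i / r) (q / r)"
proof -
  obtain \<delta> where d: "\<And>i. 0 < \<delta> i" and rh: "\<And>i R. R \<in> rectangles \<Longrightarrow>
     enn_powr (avg R (\<lambda>x. enn_powr (\<sigma> i x) (1 + \<delta> i))) (1 / (1 + \<delta> i)) \<le> 2 * avg R (\<sigma> i)"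
    using \<sigma>_reverse_Holder by blast
  \<comment> \<open>\<open>r * P i / (P i - r)\<close> is \<open>r\<close> times the conjugate
    exponent of \<open>P i / r\<close>; its limit at 1 is \<open>P' i\<close>.\<close>
  have "\<forall>\<^sub>F r in at_right 1. r < P i \<and> r * P i / (P i - r) < P' i * (1 + \<delta> i)" for i
  proof -
    have "((\<lambda>r. r * P i / (P i - r)) \<longlongrightarrow> 1 * P i / (P i - 1)) (at_right 1)"
      using P[of i] by (intro tendsto_intros) auto
    moreover have "1 * P i / (P i - 1) < P' i * (1 + \<delta> i)"
    proof -
      have "P' i * 1 < P' i * (1 + \<delta> i)"
        using d[of i] P'(3)[of i] by (intro mult_strict_left_mono) auto
      then show ?thesis by (simp add: P'_def conj_exp_def)
    qed
    ultimately have "\<forall>\<^sub>F r in at_right 1. r * P i / (P i - r) < P' i * (1 + \<delta> i)"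
      by (rule order_tendstoD(2))
    moreover have "\<forall>\<^sub>F r in at_right 1. r < P i"
      using P[of i] by (intro order_tendstoD(2)[OF tendsto_ident_at]) auto
    ultimately show ?thesis by eventually_elim auto
  qed
  then have "\<forall>\<^sub>F r in at_right 1. \<forall>i. r < P i \<and> r * P i / (P i - r) < P' i * (1 + \<delta> i)"
    by (rule eventually_all_finite)
  then have "\<forall>\<^sub>F r in at_right 1. 1 < r \<and> (\<forall>i. r < P i \<and> r * P i / (P i - r) < P' i * (1 + \<delta> i))"
    by (rule eventually_conj[OF eventually_at_right_less])
  then obtain r where r: "1 < r" "\<And>i. r < P i" "\<And>i. r * P i / (P i - r) < P' i * (1 + \<delta> i)"
    by (blast dest: eventually_happens'[OF trivial_limit_at_right_real])
  let ?w = "\<lambda>i x. w i x powr r"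
  have Pr: "1 < P i / r" for i using r(1) r(2)[of i] by simp
  have dual: "dual_factor (P i / r) R (?w i) \<le> enn_powr 2 (r / P' i) * enn_powr (enn_powr (avg R (\<sigma> i)) (1 / P' i)) r"
    if R: "R \<in> rectangles" for i R
  proof -
    define c where "c = conj_exp (P i / r)"
    have rc: "r * c = r * P i / (P i - r)" using r(1) r(2)[of i] by (simp add: c_def conj_exp_def field_simps)
    have c: "0 < c" unfolding c_def conj_exp_def by (rule divide_pos_pos) (use Pr[of i] in linarith)+
    define y where "y = r * c / P' i"
    have y: "0 < y" "y \<le> 1 + \<delta> i"
      using c r(1) r(3)[of i] P'(3)[of i] by (auto simp: y_def rc[symmetric] field_simps)
    have dw: "dual_weight (P i / r) (?w i) = (\<lambda>x. enn_powr (\<sigma> i x) y)"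
      using \<sigma>_powr[of r c i] r(1) c by (auto simp: dual_weight_def c_def y_def)
    have "enn_powr (avg R (\<lambda>x. enn_powr (\<sigma> i x) y)) (1 / y) \<le> enn_powr (avg R (\<lambda>x. enn_powr (\<sigma> i x) (1 + \<delta> i))) (1 / (1 + \<delta> i))"
      using y by (intro avg_power_mean R) auto
    also have "\<dots> \<le> 2 * avg R (\<sigma> i)" by (rule rh[OF R])
    finally have "enn_powr (enn_powr (avg R (\<lambda>x. enn_powr (\<sigma> i x) y)) (1 / y)) (r / P' i) \<le> enn_powr (2 * avg R (\<sigma> i)) (r / P' i)"
      using r(1) P'(3)[of i] by (intro enn_powr_mono) auto
    moreover have "enn_powr (enn_powr (avg R (\<lambda>x. enn_powr (\<sigma> i x) y)) (1 / y)) (r / P' i)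
        = enn_powr (avg R (\<lambda>x. enn_powr (\<sigma> i x) y)) (1 / c)"
      using r(1) c P'(3)[of i] by (simp add: enn_powr_powr y_def)
    moreover have "dual_factor (P i / r) R (?w i) = enn_powr (avg R (\<lambda>x. enn_powr (\<sigma> i x) y)) (1 / c)"
    proof -
      have "P i / r \<noteq> 1" using Pr[of i] by linarith
      then show ?thesis unfolding dw[symmetric] c_def by (rule dual_factor_eq)
    qed
    ultimately show ?thesis by (simp add: enn_powr_mult enn_powr_powr)
  qed
  define C where "C = (\<Prod>i\<in>UNIV. enn_powr 2 (r / P' i))"
  have C: "C < top" unfolding C_def less_top[symmetric] by (subst ennreal_prod_eq_top) auto
  have "A_const (\<lambda>i. P i / r) (q / r) ?w \<le> C * enn_powr A r"
    unfolding A_const_def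
  proof (rule SUP_least)
    fix R :: "(real ^ 'n) set" assume R: "R \<in> rectangles"
    have v_eq: "(\<lambda>x. ennreal (nu ?w x powr (q / r))) = v"
      using r by (auto simp: nu_powr powr_powr v_def)
    have "enn_powr (avg R v) (1 / (q / r)) * (\<Prod>i\<in>UNIV. dual_factor (P i / r) R (?w i))
      \<le> enn_powr (avg R v) (1 / (q / r)) * (\<Prod>i\<in>UNIV. enn_powr 2 (r / P' i) * enn_powr (enn_powr (avg R (\<sigma> i)) (1 / P' i)) r)"
      by (intro mult_left_mono prod_mono_ennreal dual R) auto
    also have "\<dots> = C * enn_powr (A_term R) r"
      by (simp add: C_def A_term_def prod.distrib enn_powr_mult enn_powr_prod enn_powr_powr mult_ac)
    also have "\<dots> \<le> C * enn_powr A r"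
      using r(1) by (intro mult_left_mono enn_powr_mono A_term_le R) auto
    finally show "enn_powr (avg R (\<lambda>x. ennreal (nu ?w x powr (q / r)))) (1 / (q / r)) * (\<Prod>i\<in>UNIV. dual_factor (P i / r) R (?w i)) \<le> C * enn_powr A r"
      unfolding v_eq .
  qed
  also have "\<dots> < top" using C A_fin by (simp add: ennreal_mult_less_top)
  finally have "?w \<in> A_class (\<lambda>i. P i / r) (q / r)" by (simp add: A_class_def)
  then show ?thesis using r(1) Pr by (intro exI[of _ r]) (auto simp: less_imp_le)
qed

end

section \<open>The steps from (4) to (3) and from (3) to (1)\<close>

lemma log_young_measurable [measurable]:
  assumes [measurable]: "f \<in> borel_measurable M"
  shows "(\<lambda>x. log_young k (f x)) \<in> borel_measurable M"
  unfolding log_young_def by measurable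

text \<open>\<open>log_young k\<close> dominates the identity, so every value admissible in the
  infimum bounds the average.\<close>

lemma avg_abs_le_luxemburg:
  assumes R: "R \<in> rectangles" and [measurable]: "f \<in> borel_measurable lebesgue"
  shows "avg R (\<lambda>x. ennreal \<bar>f x\<bar>) \<le> luxemburg (log_young k) R f"
  unfolding luxemburg_def
proof (rule Inf_greatest, clarify)
  fix t :: real assume t: "0 < t" "avg R (\<lambda>x. ennreal (log_young k (\<bar>f x\<bar> / t))) \<le> 1"
  have "avg R (\<lambda>x. ennreal \<bar>f x\<bar>) \<le> avg R (\<lambda>x. ennreal t * ennreal (log_young k (\<bar>f x\<bar> / t)))"
  proof (rule avg_mono)
    fix x
    have "\<bar>f x\<bar> / t * 1 \<le> \<bar>f x\<bar> / t * (1 + max (ln (\<bar>f x\<bar> / t)) 0 ^ k)"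
      using t(1) by (intro mult_left_mono) auto
    then have "\<bar>f x\<bar> \<le> t * log_young k (\<bar>f x\<bar> / t)"
      using t(1) by (simp add: log_young_def field_simps)
    then show "ennreal \<bar>f x\<bar> \<le> ennreal t * ennreal (log_young k (\<bar>f x\<bar> / t))"
      using t(1) by (simp add: ennreal_mult'[symmetric] ennreal_leI)
  qed
  also have "\<dots> = ennreal t * avg R (\<lambda>x. ennreal (log_young k (\<bar>f x\<bar> / t)))"
    by (intro avg_cmult R) measurable
  also have "\<dots> \<le> ennreal t * 1" using t(2) by (rule mult_left_mono) simp
  finally show "avg R (\<lambda>x. ennreal \<bar>f x\<bar>) \<le> ennreal t" by simp
qed

context weights
begin

text \<open>Normalising each integral by the measure of \<open>R\<close> releases a power
  \<open>\<alpha> / (m * n)\<close> of this measure; the \<open>m\<close> factors together give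
  \<open>\<alpha> / n\<close>, as in \<open>max_op_young\<close>.\<close>

lemma max_op_eq:
  "max_op \<alpha> f x = (SUP R\<in>{R \<in> rectangles. x \<in> R}.
     ennreal (measure lebesgue R powr (\<alpha> / real CARD('n))) * (\<Prod>i\<in>UNIV. avg R (\<lambda>y. ennreal \<bar>f i y\<bar>)))"
  for f :: "'m \<Rightarrow> real ^ 'n \<Rightarrow> real"
  unfolding max_op_def
proof (intro SUP_cong refl)
  fix R :: "(real ^ 'n) set" assume "R \<in> {R \<in> rectangles. x \<in> R}"
  then have R: "R \<in> rectangles" by simp
  note RM = rectangles_measure[OF R]
  let ?\<mu> = "measure lebesgue R" and ?\<beta> = "\<alpha> / (real CARD('m) * real CARD('n))"
  have "(\<integral>\<^sup>+y\<in>R. ennreal \<bar>f i y\<bar> \<partial>lebesgue) / ennreal (?\<mu> powr (1 - ?\<beta>))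
    = ennreal (?\<mu> powr ?\<beta>) * avg R (\<lambda>y. ennreal \<bar>f i y\<bar>)" for i
  proof -
    have "ennreal ?\<mu> / ennreal (?\<mu> powr (1 - ?\<beta>)) = ennreal (?\<mu> powr ?\<beta>)"
      using RM(3) powr_diff[of ?\<mu> 1 "1 - ?\<beta>"] by (subst divide_ennreal) auto
    then show ?thesis
      unfolding nn_integral_eq_avg[OF R] RM(2) ennreal_times_divide[symmetric] by (simp only: mult.commute)
  qed
  moreover have "(\<Prod>i\<in>(UNIV :: 'm set). ennreal (?\<mu> powr ?\<beta>)) = ennreal (?\<mu> powr (\<alpha> / real CARD('n)))"
    using RM(3) by (simp add: ennreal_power powr_realpow[symmetric] powr_powr)
  ultimately show "(\<Prod>i\<in>UNIV. (\<integral>\<^sup>+y\<in>R. ennreal \<bar>f i y\<bar> \<partial>lebesgue) / ennreal (?\<mu> powr (1 - ?\<beta>)))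
    = ennreal (?\<mu> powr (\<alpha> / real CARD('n))) * (\<Prod>i\<in>UNIV. avg R (\<lambda>y. ennreal \<bar>f i y\<bar>))"
    by (simp only: prod.distrib)
qed

abbreviation "in_Lp f \<equiv> (\<forall>i. f i \<in> weighted_Lp (P i) (\<lambda>x. w i x powr P i))"

lemma max_op_le_max_op_young:
  assumes "in_Lp f"
  shows "max_op \<alpha> f x \<le> max_op_young \<alpha> (log_young k) f x"
  unfolding max_op_eq max_op_young_def using assms
  by (intro SUP_mono' mult_left_mono prod_mono_ennreal avg_abs_le_luxemburg SUP_subset_mono)
    (auto simp: weighted_Lp_def)

lemma wnorm_mono:
  "0 < a \<Longrightarrow> (\<And>x. f x \<le> g x) \<Longrightarrow> wnorm a u f \<le> wnorm a u g"
  unfolding wnorm_def by (intro enn_powr_mono nn_integral_mono mult_right_mono) auto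

lemma stmt4_imp_stmt3:
  assumes "multi_bounded (max_op_young \<alpha> (log_young k)) P (\<lambda>i x. w i x powr P i) q (\<lambda>x. nu w x powr q)"
  shows "multi_bounded (max_op \<alpha>) P (\<lambda>i x. w i x powr P i) q (\<lambda>x. nu w x powr q)"
proof -
  have le: "wnorm q (\<lambda>x. nu w x powr q) (max_op \<alpha> f) \<le> wnorm q (\<lambda>x. nu w x powr q) (max_op_young \<alpha> (log_young k) f)"
    if "in_Lp f" for f
    by (intro wnorm_mono q max_op_le_max_op_young that)
  show ?thesis
    using assms unfolding multi_bounded_def by (blast intro: order_trans[OF le])
qed

text \<open>
  The extremal functions of the weighted averages are the dual weights; truncation keeps them in
  \<open>L\<^sup>p\<close>, since their integrability is not known in advance.
\<close>

definition truncated_dual :: "nat \<Rightarrow> (real ^ 'n) set \<Rightarrow> 'm \<Rightarrow> real ^ 'n \<Rightarrow> real" where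
  "truncated_dual N R i x = indicator R x * enn2real (min (\<sigma> i x) (of_nat (Suc N)))"

lemma truncated_dual_eq: "ennreal \<bar>truncated_dual N R i x\<bar> = min (\<sigma> i x) (of_nat (Suc N)) * indicator R x"
proof -
  have "min (\<sigma> i x) (of_nat (Suc N)) < top" by (auto simp: min_less_iff_disj of_nat_less_top)
  then show ?thesis by (auto simp: truncated_dual_def indicator_def abs_mult)
qed

lemma truncated_dual_measurable:
  assumes [measurable]: "R \<in> sets lebesgue"
  shows "truncated_dual N R i \<in> borel_measurable lebesgue"
  unfolding truncated_dual_def[abs_def] by measurable

text \<open>\<open>P' i * (P i - 1) = P i\<close>, so \<open>\<sigma> i powr (P i - 1)\<close>
  cancels \<open>w i powr P i\<close>, leaving one factor of the truncation. At zeros of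
  \<open>w i\<close> the left-hand side vanishes because the truncation is finite.\<close>

lemma truncated_dual_norm:
  assumes R: "R \<in> sets lebesgue"
  shows "wnorm (P i) (\<lambda>x. w i x powr P i) (\<lambda>x. ennreal \<bar>truncated_dual N R i x\<bar>)
    \<le> enn_powr (\<integral>\<^sup>+x\<in>R. min (\<sigma> i x) (of_nat (Suc N)) \<partial>lebesgue) (1 / P i)"
  unfolding wnorm_def
proof (intro enn_powr_mono nn_integral_mono)
  fix x
  show "enn_powr (ennreal \<bar>truncated_dual N R i x\<bar>) (P i) * ennreal (w i x powr P i) \<le> min (\<sigma> i x) (of_nat (Suc N)) * indicator R x"
  proof (cases "w i x = 0 \<or> x \<notin> R")
    case False
    then have x: "0 < w i x" "x \<in> R" using w0[of i x] by auto
    define m where "m = min (\<sigma> i x) (of_nat (Suc N))"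
    have "enn_powr m (P i) * ennreal (w i x powr P i) = m * (enn_powr m (P i - 1) * ennreal (w i x powr P i))"
      using P[of i] enn_powr_add[of 1 "P i - 1" m] by (simp add: mult.assoc)
    also have "\<dots> \<le> m * (enn_powr (\<sigma> i x) (P i - 1) * ennreal (w i x powr P i))"
      using P[of i] by (intro mult_left_mono mult_right_mono enn_powr_mono) (auto simp: m_def)
    also have "enn_powr (\<sigma> i x) (P i - 1) * ennreal (w i x powr P i) = 1"
    proof -
      have "(w i x powr - P' i) powr (P i - 1) = w i x powr - P i"
        unfolding powr_powr using P[of i] by (simp add: P'_def conj_exp_def)
      then have "(w i x powr - P' i) powr (P i - 1) * w i x powr P i = 1"
        using x by (simp add: powr_minus)
      then show ?thesis using x
        by (simp add: \<sigma>_def dual_weight_eq P'_def[symmetric] enn_powr_ennreal ennreal_mult[symmetric])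
    qed
    finally show ?thesis using x unfolding truncated_dual_eq m_def by simp
  qed (auto simp: truncated_dual_eq)
qed (use P[of i] in auto)

text \<open>On \<open>R\<close> the maximal function of the truncated dual weights is at least the
  constant \<open>B\<close>. The powers of the measure of \<open>R\<close> match by
  \<open>\<alpha> / n + 1 / q = 1 / p\<close>, those of the averages by
  \<open>1 / P i + 1 / P' i = 1\<close>; truncation makes the common factor \<open>Q\<close> finite,
  so it cancels.\<close>

lemma stmt3_imp_term_bound:
  assumes C: "\<And>f. in_Lp f \<Longrightarrow>
     wnorm q (\<lambda>x. nu w x powr q) (max_op \<alpha> f)
       \<le> C * (\<Prod>i\<in>UNIV. wnorm (P i) (\<lambda>x. w i x powr P i) (\<lambda>x. ennreal \<bar>f i x\<bar>))"
  and R: "R \<in> rectangles"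
  shows "enn_powr (avg R v) (1 / q) * (\<Prod>i\<in>UNIV. enn_powr (avg R (\<lambda>x. min (\<sigma> i x) (of_nat (Suc N)))) (1 / P' i)) \<le> C"
proof -
  note RM = rectangles_measure[OF R]
  define \<mu> where "\<mu> = measure lebesgue R"
  have \<mu>: "0 < \<mu>" "emeasure lebesgue R = ennreal \<mu>" using RM by (auto simp: \<mu>_def)
  define I where "I i = avg R (\<lambda>x. min (\<sigma> i x) (of_nat (Suc N)))" for i
  have I_int: "(\<integral>\<^sup>+x\<in>R. min (\<sigma> i x) (of_nat (Suc N)) \<partial>lebesgue) = I i * ennreal \<mu>" for i
    unfolding I_def nn_integral_eq_avg[OF R] \<mu>(2) ..
  have I_pos: "0 < I i" for i
    unfolding I_def using \<sigma>_pos by (intro avg_pos R) (auto simp: zero_less_iff_neq_zero min_def)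
  have I_top: "I i < top" for i
  proof -
    have "I i \<le> avg R (\<lambda>_. of_nat (Suc N))" unfolding I_def by (intro avg_mono) auto
    also have "\<dots> = of_nat (Suc N)" by (rule avg_const[OF R])
    finally show ?thesis using of_nat_less_top le_less_trans by blast
  qed
  have norm: "wnorm (P i) (\<lambda>x. w i x powr P i) (\<lambda>x. ennreal \<bar>truncated_dual N R i x\<bar>) \<le> enn_powr (I i * ennreal \<mu>) (1 / P i)" for i
    using truncated_dual_norm[OF RM(1), of i N] unfolding I_int .
  have inLp: "in_Lp (truncated_dual N R)"
  proof
    fix i
    have "enn_powr (I i * ennreal \<mu>) (1 / P i) < top" using I_top[of i] by (simp add: ennreal_mult_less_top)
    with norm[of i] show "truncated_dual N R i \<in> weighted_Lp (P i) (\<lambda>x. w i x powr P i)"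
      using truncated_dual_measurable[OF RM(1), of N i] by (auto simp: weighted_Lp_def intro: le_less_trans)
  qed
  define B where "B = ennreal (\<mu> powr (\<alpha> / real CARD('n))) * (\<Prod>i\<in>UNIV. I i)"
  have lower: "B \<le> max_op \<alpha> (truncated_dual N R) x" if "x \<in> R" for x
  proof -
    have "avg R (\<lambda>y. ennreal \<bar>truncated_dual N R i y\<bar>) = I i" for i
      unfolding I_def by (intro avg_cong_AE AE_I2) (simp add: truncated_dual_eq)
    then have "B = ennreal (measure lebesgue R powr (\<alpha> / real CARD('n))) * (\<Prod>i\<in>UNIV. avg R (\<lambda>y. ennreal \<bar>truncated_dual N R i y\<bar>))"
      by (simp add: B_def \<mu>_def)
    then show ?thesis unfolding max_op_eq using R that by (auto intro: SUP_upper)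
  qed
  have "B * enn_powr (avg R v * ennreal \<mu>) (1 / q) = enn_powr (\<integral>\<^sup>+x. enn_powr B q * (v x * indicator R x) \<partial>lebesgue) (1 / q)"
    using q RM(1) by (simp add: nn_integral_cmult nn_integral_eq_avg[OF R] \<mu>(2) enn_powr_mult enn_powr_powr del: emeasure_completion)
  also have "\<dots> \<le> wnorm q (\<lambda>x. nu w x powr q) (max_op \<alpha> (truncated_dual N R))"
    unfolding wnorm_def
    using lower q by (intro enn_powr_mono nn_integral_mono) (auto simp: v_def[symmetric] indicator_def intro!: mult_right_mono enn_powr_mono)
  also have "\<dots> \<le> C * (\<Prod>i\<in>UNIV. wnorm (P i) (\<lambda>x. w i x powr P i) (\<lambda>x. ennreal \<bar>truncated_dual N R i x\<bar>))"
    by (rule C[OF inLp])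
  also have "\<dots> \<le> C * (\<Prod>i\<in>UNIV. enn_powr (I i * ennreal \<mu>) (1 / P i))"
    by (intro mult_left_mono prod_mono_ennreal norm) auto
  finally have main: "B * enn_powr (avg R v * ennreal \<mu>) (1 / q) \<le> C * (\<Prod>i\<in>UNIV. enn_powr (I i * ennreal \<mu>) (1 / P i))" .
  define Q where "Q = (\<Prod>i\<in>UNIV. enn_powr (I i) (1 / P i)) * ennreal (\<mu> powr (1 / p))"
  have right: "(\<Prod>i\<in>UNIV. enn_powr (I i * ennreal \<mu>) (1 / P i)) = Q"
  proof -
    have "(\<Prod>i\<in>UNIV. enn_powr (ennreal \<mu>) (1 / P i)) = ennreal (\<mu> powr (1 / p))"
      using \<mu>(1) by (simp add: enn_powr_ennreal prod_ennreal p_eq powr_sum)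
    then show ?thesis by (simp add: enn_powr_mult prod.distrib Q_def)
  qed
  have left: "B * enn_powr (avg R v * ennreal \<mu>) (1 / q) = (enn_powr (avg R v) (1 / q) * (\<Prod>i\<in>UNIV. enn_powr (I i) (1 / P' i))) * Q"
  proof -
    have "I i = enn_powr (I i) (1 / P' i) * enn_powr (I i) (1 / P i)" for i
      using enn_powr_add[of "1 / P' i" "1 / P i" "I i"] P'[of i] P[of i] by (simp add: add.commute)
    then have "(\<Prod>i\<in>UNIV. I i) = (\<Prod>i\<in>UNIV. enn_powr (I i) (1 / P' i)) * (\<Prod>i\<in>UNIV. enn_powr (I i) (1 / P i))"
      unfolding prod.distrib[symmetric] by (intro prod.cong refl)
    moreover have "ennreal (\<mu> powr (\<alpha> / real CARD('n))) * enn_powr (ennreal \<mu>) (1 / q) = ennreal (\<mu> powr (1 / p))"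
    proof -
      have "\<alpha> / real CARD('n) + 1 / q = 1 / p" using q_eq by simp
      then show ?thesis using \<mu>(1) by (simp add: enn_powr_ennreal ennreal_mult[symmetric] powr_add[symmetric])
    qed
    moreover have "B * enn_powr (avg R v * ennreal \<mu>) (1 / q)
      = (ennreal (\<mu> powr (\<alpha> / real CARD('n))) * enn_powr (ennreal \<mu>) (1 / q)) * (enn_powr (avg R v) (1 / q) * (\<Prod>i\<in>UNIV. I i))"
      by (simp only: B_def enn_powr_mult mult_ac)
    ultimately show ?thesis by (simp only: Q_def mult_ac)
  qed
  have Q: "Q \<noteq> 0" "Q \<noteq> top"
  proof -
    show "Q \<noteq> 0" using \<mu>(1) I_pos by (simp add: Q_def zero_less_iff_neq_zero)
    have "(\<Prod>i\<in>UNIV. enn_powr (I i) (1 / P i)) \<noteq> top"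
      using I_top by (subst ennreal_prod_eq_top) (auto simp: less_top)
    then show "Q \<noteq> top" by (simp add: Q_def ennreal_mult_eq_top_iff)
  qed
  have "Q * (enn_powr (avg R v) (1 / q) * (\<Prod>i\<in>UNIV. enn_powr (I i) (1 / P' i))) \<le> Q * C"
    using main unfolding right left by (simp only: mult.commute)
  then show ?thesis unfolding ennreal_mult_le_mult_iff[OF Q] I_def .
qed

lemma avg_truncation_tendsto:
  assumes R: "R \<in> rectangles"
  shows "(\<lambda>N. avg R (\<lambda>x. min (\<sigma> i x) (of_nat (Suc N)))) \<longlonglongrightarrow> avg R (\<sigma> i)"
proof -
  note RM = rectangles_measure[OF R]
  have inc: "incseq (\<lambda>N x. min (\<sigma> i x) (of_nat (Suc N)) * indicator R x)"
    by (intro incseq_SucI le_funI mult_right_mono min.mono) auto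
  have sup: "(SUP N. min (\<sigma> i x) (of_nat (Suc N)) * indicator R x) = \<sigma> i x * indicator R x" for x
  proof -
    have "(SUP N. min (\<sigma> i x) (of_nat (Suc N))) = \<sigma> i x"
    proof (rule antisym[OF SUP_least])
      have "(SUP N. of_nat (Suc N) :: ennreal) = top"
      proof -
        have "(SUP N. of_nat N :: ennreal) \<le> (SUP N. of_nat (Suc N))"
          by (intro SUP_mono') simp
        then show ?thesis by (simp only: ennreal_SUP_of_nat_eq_top top_unique)
      qed
      then show "\<sigma> i x \<le> (SUP N. min (\<sigma> i x) (of_nat (Suc N)))"
        by (metis inf_SUP inf_min inf_top_right order_refl)
    qed simp
    then show ?thesis by (simp only: SUP_mult_right_ennreal[symmetric])
  qed
  have "(SUP N. \<integral>\<^sup>+x\<in>R. min (\<sigma> i x) (of_nat (Suc N)) \<partial>lebesgue) = (\<integral>\<^sup>+x\<in>R. \<sigma> i x \<partial>lebesgue)"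
    unfolding sup[symmetric]
    by (rule nn_integral_monotone_convergence_SUP[symmetric, OF inc]) (use RM(1) in measurable)
  then have "(SUP N. avg R (\<lambda>x. min (\<sigma> i x) (of_nat (Suc N)))) = avg R (\<sigma> i)"
    unfolding avg_def SUP_divide_ennreal[symmetric] by simp
  moreover have "incseq (\<lambda>N. avg R (\<lambda>x. min (\<sigma> i x) (of_nat (Suc N))))"
    by (intro incseq_SucI avg_mono min.mono) auto
  ultimately show ?thesis using LIMSEQ_SUP by fastforce
qed

lemma tendsto_enn_powr_incseq:
  fixes u :: "nat \<Rightarrow> ennreal"
  assumes "0 < a" "incseq u" "u \<longlonglongrightarrow> l"
  shows "(\<lambda>n. enn_powr (u n) a) \<longlonglongrightarrow> enn_powr l a"
proof -
  have "l = (SUP n. u n)" using LIMSEQ_SUP[OF assms(2)] assms(3) LIMSEQ_unique by blast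
  then have "enn_powr l a = (SUP n. enn_powr (u n) a)" using assms(1) by (simp add: enn_powr_SUP)
  moreover have "incseq (\<lambda>n. enn_powr (u n) a)"
    using assms by (auto simp: incseq_def intro!: enn_powr_mono)
  ultimately show ?thesis using LIMSEQ_SUP by metis
qed

text \<open>Nonzero limits avoid the discontinuity of the product at
  \<open>0 * \<infinity>\<close>.\<close>

lemma tendsto_prod_ennreal:
  fixes u :: "'i \<Rightarrow> nat \<Rightarrow> ennreal"
  assumes "finite I" "\<And>i. i \<in> I \<Longrightarrow> (u i \<longlongrightarrow> l i) F" "\<And>i. i \<in> I \<Longrightarrow> l i \<noteq> 0"
  shows "((\<lambda>n. \<Prod>i\<in>I. u i n) \<longlongrightarrow> (\<Prod>i\<in>I. l i)) F"
  using assms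
proof (induction I)
  case (insert i I)
  then show ?case by (auto intro!: tendsto_mult_ennreal)
qed simp

lemma stmt3_imp_stmt1:
  assumes "multi_bounded (max_op \<alpha>) P (\<lambda>i x. w i x powr P i) q (\<lambda>x. nu w x powr q)"
  shows "A < top"
proof -
  obtain C :: real where C: "\<And>f. in_Lp f \<Longrightarrow> wnorm q (\<lambda>x. nu w x powr q) (max_op \<alpha> f)
       \<le> ennreal C * (\<Prod>i\<in>UNIV. wnorm (P i) (\<lambda>x. w i x powr P i) (\<lambda>x. ennreal \<bar>f i x\<bar>))"
    using assms unfolding multi_bounded_def by blast
  have "A \<le> ennreal C"
    unfolding A_eq
  proof (rule SUP_least)
    fix R :: "(real ^ 'n) set" assume R: "R \<in> rectangles"
    show "A_term R \<le> ennreal C"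
    \<comment> \<open>If \<open>v\<close> vanishes on \<open>R\<close> the term is 0 by convention;
      otherwise the limit of truncations meets no product of 0 and infinity, although some
      \<open>\<sigma> i\<close> may have infinite average.\<close>
    proof (cases "avg R v = 0")
      case False
      have pos: "(\<Prod>i\<in>UNIV. enn_powr (avg R (\<sigma> i)) (1 / P' i)) \<noteq> 0"
        using avg_pos[OF R \<sigma>_meas] \<sigma>_pos by (simp add: zero_less_iff_neq_zero[symmetric])
      have "(\<lambda>N. enn_powr (avg R v) (1 / q) * (\<Prod>i\<in>UNIV. enn_powr (avg R (\<lambda>x. min (\<sigma> i x) (of_nat (Suc N)))) (1 / P' i)))
         \<longlonglongrightarrow> A_term R"
        unfolding A_term_def
      proof (intro tendsto_mult_ennreal tendsto_const tendsto_prod_ennreal tendsto_enn_powr_incseq avg_truncation_tendsto R)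
        show "incseq (\<lambda>N. avg R (\<lambda>x. min (\<sigma> i x) (of_nat (Suc N))))" for i
          by (intro incseq_SucI avg_mono min.mono) auto
        show "enn_powr (avg R (\<sigma> i)) (1 / P' i) \<noteq> 0" for i
          using avg_pos[OF R \<sigma>_meas[of i]] \<sigma>_pos[of i] by simp
      qed (use pos False P'(3) in auto)
      then show ?thesis
        by (rule LIMSEQ_le_const2) (use stmt3_imp_term_bound[OF C R] in blast)
    qed (simp add: A_term_def)
  qed
  then show ?thesis by (rule le_less_trans) simp
qed

end

section \<open>Luxemburg norms against power means, and strong maximal functions\<close>

lemma log_young_le_powr:
  assumes s: "1 < s"
  obtains C where "0 < C" "\<And>t. 0 \<le> t \<Longrightarrow> log_young k t \<le> 1 / 2 + C * t powr s"
proof -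
  \<comment> \<open>\<open>C1\<close> compares \<open>ln t ^ k\<close> with
    \<open>t powr (s - 1)\<close> for \<open>t \<ge> 1\<close>. The summand 1/2 of the bound takes
    care of arguments up to 1/4, where powers above 1 are too small, and leaves another 1/2 for the
    power term in the Luxemburg condition; \<open>2 * 4 powr s\<close> covers the range from 1/4 to
    1.\<close>
  define C1 where "C1 = (real k / (s - 1)) ^ k"
  define C where "C = 1 + C1 + 2 * 4 powr s"
  have C1: "0 \<le> C1" using s by (simp add: C1_def)
  have ln_le: "ln t ^ k \<le> C1 * t powr (s - 1)" if t: "1 \<le> t" for t
  proof (cases "k = 0")
    case True
    then show ?thesis using t s by (simp add: C1_def ge_one_powr_ge_zero)
  next
    case False
    \<comment> \<open>The \<open>k\<close>-th power of \<open>t powr b\<close> is exactly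
      \<open>t powr (s - 1)\<close>.\<close>
    define b where "b = (s - 1) / real k"
    have b: "0 < b" using s False by (simp add: b_def)
    have "b * ln t = ln (t powr b)" using t by (simp add: ln_powr)
    also have "\<dots> \<le> t powr b" using ln_le_minus_one[of "t powr b"] t by simp
    finally have "ln t \<le> (1 / b) * t powr b" using b by (simp add: field_simps)
    then have "ln t ^ k \<le> ((1 / b) * t powr b) ^ k" using t by (intro power_mono) auto
    also have "\<dots> = C1 * (t powr b) ^ k"
    proof -
      have "1 / b = real k / (s - 1)" by (simp add: b_def)
      then show ?thesis by (simp only: power_mult_distrib C1_def)
    qed
    also have "(t powr b) ^ k = t powr (s - 1)"
      using t False powr_realpow[of "t powr b" k] by (simp add: powr_powr b_def)
    finally show ?thesis .
  qed
  have "log_young k t \<le> 1 / 2 + C * t powr s" if t0: "0 \<le> t" for t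
  proof (cases "t \<le> 1")
    case True
    then have "ln t \<le> 0" using t0 by (cases "t = 0") auto
    then have "log_young k t \<le> t * 2"
      unfolding log_young_def using t0 by (intro mult_left_mono) (auto simp: max_def power_0_left)
    also have "\<dots> \<le> 1 / 2 + C * t powr s"
    proof (cases "t \<le> 1 / 4")
      case True
      have "0 \<le> C * t powr s" using C1 by (simp add: C_def)
      then show ?thesis using True by simp
    next
      case False
      have "1 = (4 * (1 / 4 :: real)) powr s" by simp
      also have "\<dots> \<le> (4 * t) powr s" using False s by (intro powr_mono2) auto
      also have "\<dots> = 4 powr s * t powr s" using t0 by (simp add: powr_mult)
      finally have "2 * 1 \<le> 2 * (4 powr s * t powr s)" by simp
      also have "\<dots> \<le> C * t powr s" using C1 by (simp add: C_def algebra_simps)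
      finally show ?thesis using \<open>t \<le> 1\<close> by simp
    qed
    finally show ?thesis .
  next
    case False
    then have t1: "1 \<le> t" by simp
    have "log_young k t = t + t * ln t ^ k" using t1 by (simp add: log_young_def max_def algebra_simps)
    also have "\<dots> \<le> t powr s + t * (C1 * t powr (s - 1))"
      using t1 s powr_mono[of 1 s t] by (intro add_mono mult_left_mono ln_le) auto
    also have "t * (C1 * t powr (s - 1)) = C1 * t powr s" using t1 powr_add[of t 1 "s - 1"] by simp
    also have "t powr s + C1 * t powr s \<le> 1 / 2 + C * t powr s"
      using C1 by (simp add: C_def algebra_simps)
    finally show ?thesis .
  qed
  moreover have "0 < C" unfolding C_def using C1 by (intro add_pos_nonneg) auto
  ultimately show ?thesis using that by blast
qed

lemma luxemburg_le_powr:
  assumes s: "1 < s"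
  obtains C where "0 < C" "\<And>R f. R \<in> rectangles \<Longrightarrow> (f :: real ^ 'n \<Rightarrow> real) \<in> borel_measurable lebesgue \<Longrightarrow>
    luxemburg (log_young k) R f \<le> ennreal C * enn_powr (avg R (\<lambda>x. enn_powr (ennreal \<bar>f x\<bar>) s)) (1 / s)"
proof -
  obtain C where C: "0 < C" "\<And>t. 0 \<le> t \<Longrightarrow> log_young k t \<le> 1 / 2 + C * t powr s"
    using log_young_le_powr[OF s, of k] by blast
  show ?thesis
  proof (rule that[of "(2 * C) powr (1 / s)"])
    fix R :: "(real ^ 'n) set" and f :: "real ^ 'n \<Rightarrow> real"
    assume R: "R \<in> rectangles" and f [measurable]: "f \<in> borel_measurable lebesgue"
    define X where "X = avg R (\<lambda>x. enn_powr (ennreal \<bar>f x\<bar>) s)"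
    show "luxemburg (log_young k) R f \<le> ennreal ((2 * C) powr (1 / s)) * enn_powr X (1 / s)"
    proof (cases X)
      case (real x)
      have "luxemburg (log_young k) R f \<le> ennreal ((2 * C * x) powr (1 / s)) + ennreal e" if e: "0 < e" for e
      proof -
        \<comment> \<open>The root is the value at which the power term contributes 1/2;
          \<open>e\<close> keeps \<open>l\<close> positive when the average is 0 and is removed at
          the end.\<close>
        define l where "l = (2 * C * x) powr (1 / s) + e"
        have l: "0 < l" using e by (simp add: l_def add_nonneg_pos)
        have "2 * C * x = ((2 * C * x) powr (1 / s)) powr s" using C(1) real s by (simp add: powr_powr)
        also have "\<dots> \<le> l powr s" using e s by (intro powr_mono2) (auto simp: l_def)
        finally have lx: "C * x / l powr s \<le> 1 / 2" using l by (simp add: divide_simps)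
        have "avg R (\<lambda>y. ennreal (log_young k (\<bar>f y\<bar> / l)))
           \<le> avg R (\<lambda>y. ennreal (1 / 2) + ennreal (C / l powr s) * enn_powr (ennreal \<bar>f y\<bar>) s)"
        proof (rule avg_mono)
          fix y
          have "log_young k (\<bar>f y\<bar> / l) \<le> 1 / 2 + C / l powr s * \<bar>f y\<bar> powr s"
            using C(2)[of "\<bar>f y\<bar> / l"] l by (simp add: powr_divide)
          then show "ennreal (log_young k (\<bar>f y\<bar> / l)) \<le> ennreal (1 / 2) + ennreal (C / l powr s) * enn_powr (ennreal \<bar>f y\<bar>) s"
            using C(1) by (simp add: enn_powr_ennreal ennreal_mult[symmetric] ennreal_plus[symmetric] ennreal_leI del: ennreal_plus ennreal_half)
        qed
        also have "\<dots> = ennreal (1 / 2) + ennreal (C / l powr s) * X"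
          using R by (simp add: avg_add avg_const avg_cmult X_def)
        also have "\<dots> = ennreal (1 / 2 + C * x / l powr s)"
          using C(1) real by (simp add: ennreal_mult[symmetric] ennreal_plus[symmetric] del: ennreal_plus ennreal_half)
        also have "\<dots> \<le> ennreal 1" using lx by (intro ennreal_leI) linarith
        finally have "luxemburg (log_young k) R f \<le> ennreal l"
          unfolding luxemburg_def using l by (intro Inf_lower) auto
        then show ?thesis using e by (simp add: l_def ennreal_plus)
      qed
      then have "luxemburg (log_young k) R f \<le> ennreal ((2 * C * x) powr (1 / s))"
        by (rule ennreal_le_epsilon)
      then show ?thesis using real C(1) by (simp add: enn_powr_ennreal ennreal_mult[symmetric] powr_mult)
    qed (use C(1) in \<open>simp add: ennreal_mult_top\<close>)
  qed (use C(1) in simp)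
qed

text \<open>The supremum is uncountable, but its superlevel sets are unions of open
  rectangles.\<close>

lemma strong_max_measurable [measurable]: "strong_max f \<in> borel_measurable lebesgue"
proof (rule borel_measurableI_greater)
  fix y
  have "{x \<in> space lebesgue. y < strong_max f x} = \<Union>{R \<in> rectangles. y < avg R f}"
    by (auto simp: strong_max_def less_SUP_iff)
  moreover have "open \<dots>" by (intro open_Union) (auto simp: rectangles_def)
  ultimately show "{x \<in> space lebesgue. y < strong_max f x} \<in> sets lebesgue" by simp
qed

text \<open>Specialises the weighted maximal theorem to the unweighted one, for every exponent above
  1.\<close>

lemma strong_Ap_one: "1 < t \<Longrightarrow> strong_Ap (\<lambda>_. 1) (\<lambda>_. 1) t 1"
  by unfold_locales (auto simp: avg_const)

section \<open>The step from (1) to (4)\<close>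

context nondegenerate_weights
begin

lemma stmt1_imp_stmt4:
  "multi_bounded (max_op_young \<alpha> (log_young k)) P (\<lambda>i x. w i x powr P i) q (\<lambda>x. nu w x powr q)"
proof -
  obtain \<delta> where d: "\<And>i. 0 < \<delta> i" and rh: "\<And>i R. R \<in> rectangles \<Longrightarrow>
     enn_powr (avg R (\<lambda>x. enn_powr (\<sigma> i x) (1 + \<delta> i))) (1 / (1 + \<delta> i)) \<le> 2 * avg R (\<sigma> i)"
    using \<sigma>_reverse_Holder by blast
  \<comment> \<open>Almost everywhere \<open>\<sigma> i\<close> to the power
    \<open>1 + \<delta> i\<close> is \<open>w i powr (- e i)\<close>. As \<open>e i\<close> exceeds
    \<open>P' i\<close>, the reciprocals of \<open>P i\<close> and \<open>e i\<close> add up to less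
    than 1, which leaves room for some \<open>s > 1\<close>.\<close>
  define e where "e i = P' i * (1 + \<delta> i)" for i
  have e: "0 < e i" "1 / P i + 1 / e i < 1" for i
  proof -
    show "0 < e i" using P'(3)[of i] d[of i] by (simp add: e_def)
    have "1 / e i < 1 / P' i"
      unfolding e_def using P'(3)[of i] d[of i] by (intro divide_strict_left_mono) auto
    then show "1 / P i + 1 / e i < 1" using P'(2)[of i] by simp
  qed
  obtain s where s: "1 < s" "\<And>i. 1 / P i + 1 / e i < 1 / s"
  proof -
    have "((\<lambda>s. 1 / s) \<longlongrightarrow> 1 / 1) (at_right (1::real))" by (intro tendsto_intros) auto
    then have "\<forall>\<^sub>F s in at_right 1. 1 / P i + 1 / e i < 1 / s" for i
      using e(2)[of i] by (intro order_tendstoD(1)) auto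
    then have "\<forall>\<^sub>F s in at_right 1. \<forall>i. 1 / P i + 1 / e i < 1 / s" by (rule eventually_all_finite)
    then have "\<forall>\<^sub>F s in at_right 1. 1 < s \<and> (\<forall>i. 1 / P i + 1 / e i < 1 / s)"
      by (rule eventually_conj[OF eventually_at_right_less])
    then show ?thesis using that by (blast dest: eventually_happens'[OF trivial_limit_at_right_real])
  qed
  obtain Cs where Cs: "0 < Cs" "\<And>R f. R \<in> rectangles \<Longrightarrow> (f :: real ^ 'n \<Rightarrow> real) \<in> borel_measurable lebesgue \<Longrightarrow>
    luxemburg (log_young k) R f \<le> ennreal Cs * enn_powr (avg R (\<lambda>x. enn_powr (ennreal \<bar>f x\<bar>) s)) (1 / s)"
    using luxemburg_le_powr[OF s(1)] by blast
  \<comment> \<open>Solves \<open>s / a i + s / e i = 1\<close>, the Hoelder condition for splitting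
    \<open>\<bar>f i\<bar> powr s\<close> into powers of \<open>h i\<close> and of
    \<open>\<sigma> i\<close>. The choice of \<open>s\<close> is equivalent to
    \<open>a i < P i\<close>.\<close>
  define a where "a i = 1 / (1 / s - 1 / e i)" for i
  have a: "0 < a i" "a i < P i" "s / a i + s / e i = 1" "1 < P i / a i" for i
  proof -
    have inv: "1 / P i < 1 / s - 1 / e i" using s(2)[of i] by simp
    have pos: "0 < 1 / P i" using P[of i] by simp
    then have pos2: "0 < 1 / s - 1 / e i" using inv by linarith
    then show a0: "0 < a i" by (simp add: a_def)
    have "1 / a i = 1 / s - 1 / e i" by (simp add: a_def)
    then have "1 / P i < 1 / a i" using inv by simp
    then show aP: "a i < P i" using a0 P[of i] by (simp add: field_simps)
    show "1 < P i / a i" using aP a0 by simp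
    have "s / a i = s * (1 / s - 1 / e i)" using \<open>1 / a i = _\<close> by (metis times_divide_eq_right mult.right_neutral)
    then show "s / a i + s / e i = 1" using s(1) by (simp add: right_diff_distrib)
  qed
  define t where "t = 1 + q * \<kappa>"
  have t: "1 < t" using q \<kappa> by (simp add: t_def)
  interpret V: strong_Ap v "\<lambda>x. \<Prod>j\<in>UNIV. enn_powr (\<sigma> j x) (1 / (P' j * \<kappa>))" t "enn2real (enn_powr A q)"
    unfolding t_def by (rule v_strong_Ap)
  define C1 where "C1 = line_const t (enn2real (enn_powr A q)) ^ CARD('n) * enn2real (enn_powr A q) + 1"
  define C2 where "C2 i = line_const (P i / a i) 1 ^ CARD('n) * 1 + 1" for i
  have C1: "(\<integral>\<^sup>+x. enn_powr (strong_max G x) t * v x \<partial>lebesgue) \<le> ennreal C1 * (\<integral>\<^sup>+x. enn_powr (G x) t * v x \<partial>lebesgue)"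
    if "G \<in> borel_measurable lebesgue" for G
    unfolding C1_def by (rule V.strong_max_bound[OF that])
  have C2: "(\<integral>\<^sup>+x. enn_powr (strong_max G x) (P i / a i) \<partial>lebesgue) \<le> ennreal (C2 i) * (\<integral>\<^sup>+x. enn_powr (G x) (P i / a i) \<partial>lebesgue)"
    if "G \<in> borel_measurable lebesgue" for G :: "real ^ 'n \<Rightarrow> ennreal" and i
    using strong_Ap.strong_max_bound[OF strong_Ap_one[OF a(4)[of i]] that] by (simp add: C2_def)
  define m where "m = CARD('m)"
  define C3 where "C3 = (\<Prod>i\<in>UNIV. enn_powr (ennreal (C2 i)) (p / P i))"
  define C0 where "C0 = (2 * ennreal Cs) ^ m"
  define CC where "CC = C0 * A * enn_powr (ennreal C1 * C3) (1 / q)"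
  have CC: "CC < top"
  proof -
    have "C3 < top" unfolding C3_def less_top[symmetric] by (subst ennreal_prod_eq_top) auto
    moreover have "C0 < top" unfolding C0_def by (auto simp: power_less_top_ennreal ennreal_mult_less_top)
    ultimately show ?thesis unfolding CC_def using A_fin by (simp add: ennreal_mult_less_top)
  qed
  have main: "wnorm q (\<lambda>x. nu w x powr q) (max_op_young \<alpha> (log_young k) f)
      \<le> CC * (\<Prod>i\<in>UNIV. wnorm (P i) (\<lambda>x. w i x powr P i) (\<lambda>x. ennreal \<bar>f i x\<bar>))"
    if f: "in_Lp f" for f
  proof -
    have [measurable]: "f i \<in> borel_measurable lebesgue" for i using f by (auto simp: weighted_Lp_def)
    define h where "h i x = ennreal (\<bar>f i x\<bar> * w i x)" for i x
    have [measurable]: "h i \<in> borel_measurable lebesgue" for i unfolding h_def[abs_def] by measurable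
    define N where "N i = wnorm (P i) (\<lambda>x. w i x powr P i) (\<lambda>x. ennreal \<bar>f i x\<bar>)" for i
    have N: "N i = enn_powr (\<integral>\<^sup>+x. enn_powr (h i x) (P i) \<partial>lebesgue) (1 / P i)" for i
    proof -
      have "enn_powr (ennreal \<bar>f i x\<bar>) (P i) * ennreal (w i x powr P i) = enn_powr (h i x) (P i)" for x
        using w0[of i x] by (simp add: h_def enn_powr_ennreal powr_mult ennreal_mult[symmetric])
      then show ?thesis by (simp add: N_def wnorm_def)
    qed
    define NN where "NN = (\<Prod>i\<in>UNIV. N i)"
    define H where "H i R = enn_powr (avg R (\<lambda>x. enn_powr (h i x) (a i))) (1 / a i)" for i R
    define F where "F x = (\<Prod>i\<in>UNIV. enn_powr (strong_max (\<lambda>x. enn_powr (h i x) (a i)) x) (1 / a i))" for x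
    have F_meas [measurable]: "F \<in> borel_measurable lebesgue" unfolding F_def[abs_def] by measurable
    \<comment> \<open>Domination by \<open>s\<close>-th means, Hoelder's inequality with the
      exponents \<open>a i / s\<close> and \<open>e i / s\<close>, and the reverse Hoelder
      inequality to return to the plain average of \<open>\<sigma> i\<close>.\<close>
    have lux: "luxemburg (log_young k) R (f i) \<le> (2 * ennreal Cs) * (H i R * enn_powr (avg R (\<sigma> i)) (1 / P' i))"
      if R: "R \<in> rectangles" for R i
    proof -
      have "avg R (\<lambda>x. enn_powr (ennreal \<bar>f i x\<bar>) s)
        = avg R (\<lambda>x. enn_powr (enn_powr (h i x) (a i)) (s / a i) * enn_powr (enn_powr (\<sigma> i x) (1 + \<delta> i)) (s / e i))"
        using w_pos
      proof (intro avg_cong_AE, eventually_elim)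
        case (elim x)
        have "(1 + \<delta> i) * (s / e i) = s / P' i" using d[of i] P'(3)[of i] by (simp add: e_def)
        then have "enn_powr (enn_powr (\<sigma> i x) (1 + \<delta> i)) (s / e i) = enn_powr (\<sigma> i x) (s / P' i)"
          by (simp only: enn_powr_powr)
        also have "\<dots> = ennreal (w i x powr - s)"
          using elim P'(3)[of i] unfolding \<sigma>_def by (simp add: dual_weight_eq P'_def[symmetric] enn_powr_ennreal powr_powr del: powr_minus)
        moreover have "enn_powr (enn_powr (h i x) (a i)) (s / a i) = ennreal (\<bar>f i x\<bar> powr s * w i x powr s)"
        proof -
          have "a i * (s / a i) = s" using a(1)[of i] by simp
          then have "enn_powr (enn_powr (h i x) (a i)) (s / a i) = enn_powr (h i x) s" by (simp only: enn_powr_powr)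
          then show ?thesis using elim by (simp add: h_def enn_powr_ennreal powr_mult less_imp_le)
        qed
        moreover have "w i x powr s * w i x powr - s = 1"
        proof -
          have "0 < w i x" using elim by blast
          then show ?thesis by (simp add: powr_add[symmetric])
        qed
        ultimately show ?case
          by (simp add: enn_powr_ennreal ennreal_mult[symmetric] mult.assoc)
      qed
      also have "\<dots> \<le> enn_powr (avg R (\<lambda>x. enn_powr (h i x) (a i))) (s / a i) * enn_powr (avg R (\<lambda>x. enn_powr (\<sigma> i x) (1 + \<delta> i))) (s / e i)"
        using a[of i] e(1)[of i] s(1) by (intro avg_Holder2 R) auto
      finally have "enn_powr (avg R (\<lambda>x. enn_powr (ennreal \<bar>f i x\<bar>) s)) (1 / s)
        \<le> enn_powr (enn_powr (avg R (\<lambda>x. enn_powr (h i x) (a i))) (s / a i) * enn_powr (avg R (\<lambda>x. enn_powr (\<sigma> i x) (1 + \<delta> i))) (s / e i)) (1 / s)"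
        using s(1) by (intro enn_powr_mono) auto
      also have "\<dots> = H i R * enn_powr (enn_powr (avg R (\<lambda>x. enn_powr (\<sigma> i x) (1 + \<delta> i))) (1 / (1 + \<delta> i))) (1 / P' i)"
      proof -
        have "s / e i * (1 / s) = 1 / (1 + \<delta> i) * (1 / P' i)" using s(1) by (simp add: e_def)
        moreover have "s / a i * (1 / s) = 1 / a i" using s(1) by simp
        ultimately show ?thesis by (simp only: enn_powr_mult enn_powr_powr H_def)
      qed
      also have "\<dots> \<le> H i R * enn_powr (2 * avg R (\<sigma> i)) (1 / P' i)"
        using rh[OF R, of i] P'(3)[of i] by (intro mult_left_mono enn_powr_mono) auto
      also have "\<dots> = enn_powr 2 (1 / P' i) * (H i R * enn_powr (avg R (\<sigma> i)) (1 / P' i))"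
        by (simp add: enn_powr_mult mult_ac)
      also have "enn_powr 2 (1 / P' i) \<le> 2"
        using P'(1)[of i] by (intro enn_powr_le_self) auto
      finally have "enn_powr (avg R (\<lambda>x. enn_powr (ennreal \<bar>f i x\<bar>) s)) (1 / s) \<le> 2 * (H i R * enn_powr (avg R (\<sigma> i)) (1 / P' i))"
        by (simp add: mult_right_mono)
      then have "ennreal Cs * enn_powr (avg R (\<lambda>x. enn_powr (ennreal \<bar>f i x\<bar>) s)) (1 / s)
          \<le> ennreal Cs * (2 * (H i R * enn_powr (avg R (\<sigma> i)) (1 / P' i)))"
        by (rule mult_left_mono) simp
      with Cs(2)[OF R, of "f i"] show ?thesis by (simp add: mult_ac)
    qed
    \<comment> \<open>Hedberg's trick; the two cases avoid the junk value of \<open>0 powr 0\<close>.\<close>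
    define D where "D = (if p = q then 1 else enn_powr NN (1 - p / q))"
    have D: "D * enn_powr NN (p / q) = NN"
      using enn_powr_add[of "1 - p / q" "p / q" NN] p q pq by (auto simp: D_def)
    have hedberg: "ennreal (measure lebesgue R powr (\<alpha> / real CARD('n))) * (\<Prod>i\<in>UNIV. H i R) \<le> D * enn_powr (F y) (p / q)"
      if R: "R \<in> rectangles" and y: "y \<in> R" for R y
    proof -
      note RM = rectangles_measure[OF R]
      define \<mu> where "\<mu> = measure lebesgue R"
      have \<mu>: "0 < \<mu>" "emeasure lebesgue R = ennreal \<mu>" using RM by (auto simp: \<mu>_def)
      define Z where "Z = (\<Prod>i\<in>UNIV. H i R)"
      have ZF: "Z \<le> F y"
        unfolding Z_def F_def H_def using a(1) R y
        by (intro prod_mono_ennreal enn_powr_mono avg_le_strong_max) (auto simp: less_imp_le)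
      \<comment> \<open>\<open>ZF\<close> is independent of the size of \<open>R\<close>, while this
        bound gains for large \<open>R\<close>; together they are interpolated.\<close>
      have ZN: "Z * ennreal (\<mu> powr (1 / p)) \<le> NN"
      proof -
        have "H i R * enn_powr (ennreal \<mu>) (1 / P i) \<le> N i" for i
        proof -
          have "H i R \<le> enn_powr (avg R (\<lambda>x. enn_powr (h i x) (P i))) (1 / P i)"
            unfolding H_def using a(1,2)[of i] by (intro avg_power_mean R) auto
          then have "H i R * enn_powr (ennreal \<mu>) (1 / P i) \<le> enn_powr (avg R (\<lambda>x. enn_powr (h i x) (P i)) * ennreal \<mu>) (1 / P i)"
            unfolding enn_powr_mult by (rule mult_right_mono) simp
          also have "\<dots> \<le> N i"
            unfolding N \<mu>(2)[symmetric] nn_integral_eq_avg[OF R, symmetric] using P[of i]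
            by (intro enn_powr_mono nn_integral_mono) (auto simp: indicator_def)
          finally show ?thesis .
        qed
        then have "(\<Prod>i\<in>UNIV. H i R * enn_powr (ennreal \<mu>) (1 / P i)) \<le> NN"
          unfolding NN_def by (intro prod_mono_ennreal) auto
        moreover have "(\<Prod>i\<in>UNIV. enn_powr (ennreal \<mu>) (1 / P i)) = ennreal (\<mu> powr (1 / p))"
          using \<mu>(1) by (simp add: enn_powr_ennreal prod_ennreal p_eq powr_sum)
        ultimately show ?thesis by (simp add: Z_def prod.distrib)
      qed
      have "ennreal (\<mu> powr (\<alpha> / real CARD('n))) * Z \<le> D * enn_powr Z (p / q)"
      proof (cases "p = q")
        case True
        then have "\<alpha> = 0" using q_eq by simp
        then show ?thesis using True q \<mu>(1) by (simp add: D_def)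
      next
        case False
        then have lt: "p / q < 1" using pq q by simp
        \<comment> \<open>The interpolation weight \<open>1 - p / q\<close> is the one for which the
          measure of \<open>R\<close> appears with exponent \<open>\<alpha> / n\<close>.\<close>
        have "1 / p * (1 - p / q) = 1 / p - 1 / q" using p by (simp add: right_diff_distrib)
        then have \<alpha>_eq: "1 / p * (1 - p / q) = \<alpha> / real CARD('n)" using q_eq by simp
        have "ennreal (\<mu> powr (\<alpha> / real CARD('n))) * Z
          = enn_powr (ennreal (\<mu> powr (1 / p))) (1 - p / q) * (enn_powr Z (1 - p / q) * enn_powr Z (p / q))"
          using enn_powr_add[of "1 - p / q" "p / q" Z] lt p q
          by (simp add: enn_powr_ennreal powr_powr \<alpha>_eq del: times_divide_eq_left)
        also have "\<dots> = enn_powr (Z * ennreal (\<mu> powr (1 / p))) (1 - p / q) * enn_powr Z (p / q)"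
          by (simp only: enn_powr_mult mult_ac)
        also have "\<dots> \<le> D * enn_powr Z (p / q)"
          unfolding D_def using False ZN lt by (auto intro!: mult_right_mono enn_powr_mono)
        finally show ?thesis .
      qed
      also have "\<dots> \<le> D * enn_powr (F y) (p / q)"
        using ZF p q by (intro mult_left_mono enn_powr_mono) auto
      finally show ?thesis by (simp add: Z_def \<mu>_def)
    qed
    define \<epsilon> where "\<epsilon> = 1 / t"
    have eps: "0 < \<epsilon>" using t by (simp add: \<epsilon>_def)
    define u where "u x = inverse (enn_powr (v x) \<epsilon>)" for x
    have [measurable]: "u \<in> borel_measurable lebesgue" unfolding u_def[abs_def] by measurable
    define G where "G x = enn_powr (F x) (p * \<epsilon>) * u x" for x
    have G_meas [measurable]: "G \<in> borel_measurable lebesgue" unfolding G_def[abs_def] by measurable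
    \<comment> \<open>Hoelder's inequality for 1 as a product of powers of \<open>v\<close> and
      \<open>u\<close> shows that \<open>enn_powr (avg R v) (1 / q)\<close> times
      \<open>enn_powr (avg R u) (1 / (q * \<epsilon>))\<close> is at least 1. Multiplying by it
      completes the dual factors to \<open>A_term R\<close>.\<close>
    have \<sigma>_prod: "(\<Prod>i\<in>UNIV. enn_powr (avg R (\<sigma> i)) (1 / P' i)) \<le> A * enn_powr (avg R u) (1 / (q * \<epsilon>))"
      if R: "R \<in> rectangles" for R
    proof -
      have "1 = avg R (\<lambda>x. 1)" using R by (simp add: avg_const)
      also have "\<dots> = avg R (\<lambda>x. enn_powr (v x) (\<epsilon> / (1 + \<epsilon>)) * enn_powr (u x) (1 / (1 + \<epsilon>)))"
        using v_pos
      proof (intro avg_cong_AE, eventually_elim)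
        case (elim x)
        then obtain r where r: "v x = ennreal r" "0 < r" by (auto simp: v_def)
        have "u x = ennreal (r powr - \<epsilon>)"
          using r by (simp add: u_def enn_powr_ennreal inverse_ennreal powr_minus)
        moreover have "r powr (\<epsilon> / (1 + \<epsilon>)) * (r powr - \<epsilon>) powr (1 / (1 + \<epsilon>)) = 1"
          unfolding powr_powr using r(2) by (simp add: powr_add[symmetric])
        ultimately show ?case using r by (simp add: enn_powr_ennreal ennreal_mult[symmetric])
      qed
      also have "\<dots> \<le> enn_powr (avg R v) (\<epsilon> / (1 + \<epsilon>)) * enn_powr (avg R u) (1 / (1 + \<epsilon>))"
        using eps by (intro avg_Holder2 R) (auto simp: add_divide_distrib[symmetric])
      finally have "enn_powr 1 ((1 + \<epsilon>) / (q * \<epsilon>)) \<le> enn_powr (enn_powr (avg R v) (\<epsilon> / (1 + \<epsilon>)) * enn_powr (avg R u) (1 / (1 + \<epsilon>))) ((1 + \<epsilon>) / (q * \<epsilon>))"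
        using eps q by (intro enn_powr_mono) auto
      also have "\<dots> = enn_powr (avg R v) (1 / q) * enn_powr (avg R u) (1 / (q * \<epsilon>))"
      proof -
        have "b / (1 + \<epsilon>) * ((1 + \<epsilon>) / (q * \<epsilon>)) = b / (q * \<epsilon>)" for b
          using eps by simp
        then have "\<epsilon> / (1 + \<epsilon>) * ((1 + \<epsilon>) / (q * \<epsilon>)) = 1 / q" "1 / (1 + \<epsilon>) * ((1 + \<epsilon>) / (q * \<epsilon>)) = 1 / (q * \<epsilon>)"
          using eps by simp_all
        then show ?thesis by (simp only: enn_powr_mult enn_powr_powr)
      qed
      finally have "(\<Prod>i\<in>UNIV. enn_powr (avg R (\<sigma> i)) (1 / P' i)) * 1
        \<le> (\<Prod>i\<in>UNIV. enn_powr (avg R (\<sigma> i)) (1 / P' i)) * (enn_powr (avg R v) (1 / q) * enn_powr (avg R u) (1 / (q * \<epsilon>)))"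
        by (intro mult_left_mono) auto
      also have "\<dots> = A_term R * enn_powr (avg R u) (1 / (q * \<epsilon>))" by (simp only: A_term_def mult_ac)
      also have "\<dots> \<le> A * enn_powr (avg R u) (1 / (q * \<epsilon>))" by (intro mult_right_mono A_term_le R) auto
      finally show ?thesis by simp
    qed
    have pointwise: "max_op_young \<alpha> (log_young k) f x \<le> C0 * A * D * enn_powr (strong_max G x) (t / q)" for x
      unfolding max_op_young_def
    proof (rule SUP_least)
      fix R assume "R \<in> {R \<in> rectangles. x \<in> R}"
      then have R: "R \<in> rectangles" and x: "x \<in> R" by auto
      define Y where "Y = ennreal (measure lebesgue R powr (\<alpha> / real CARD('n))) * (\<Prod>i\<in>UNIV. H i R)"
      have qe: "q * \<epsilon> * (1 / (q * \<epsilon>)) = 1" "1 / (q * \<epsilon>) = t / q" using q eps t by (auto simp: \<epsilon>_def)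
      \<comment> \<open>\<open>Y\<close> does not depend on the point, so it enters the average of
        \<open>u\<close> and is estimated there by \<open>hedberg\<close> at each \<open>y\<close>.
        This produces an average of \<open>G\<close>, a linear maximal function.\<close>
      have "enn_powr Y (q * \<epsilon>) * avg R u = avg R (\<lambda>y. enn_powr Y (q * \<epsilon>) * u y)"
        by (rule avg_cmult[symmetric, OF R]) measurable
      also have "\<dots> \<le> avg R (\<lambda>y. enn_powr D (q * \<epsilon>) * G y)"
      proof (rule avg_mono)
        fix y assume "y \<in> R"
        then have "enn_powr Y (q * \<epsilon>) \<le> enn_powr (D * enn_powr (F y) (p / q)) (q * \<epsilon>)"
          unfolding Y_def using eps q by (intro enn_powr_mono hedberg R) auto
        also have "\<dots> = enn_powr D (q * \<epsilon>) * enn_powr (F y) (p * \<epsilon>)"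
          using q by (simp add: enn_powr_mult enn_powr_powr)
        finally show "enn_powr Y (q * \<epsilon>) * u y \<le> enn_powr D (q * \<epsilon>) * G y"
          unfolding G_def mult.assoc[symmetric] by (rule mult_right_mono) simp
      qed
      also have "\<dots> = enn_powr D (q * \<epsilon>) * avg R G" by (rule avg_cmult[OF R]) measurable
      also have "\<dots> \<le> enn_powr D (q * \<epsilon>) * strong_max G x"
        using R x by (intro mult_left_mono avg_le_strong_max) auto
      finally have "enn_powr (enn_powr Y (q * \<epsilon>) * avg R u) (1 / (q * \<epsilon>)) \<le> enn_powr (enn_powr D (q * \<epsilon>) * strong_max G x) (1 / (q * \<epsilon>))"
        using q eps by (intro enn_powr_mono) auto
      then have "Y * enn_powr (avg R u) (1 / (q * \<epsilon>)) \<le> D * enn_powr (strong_max G x) (1 / (q * \<epsilon>))"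
        by (simp only: enn_powr_mult enn_powr_powr qe(1) enn_powr_one)
      then have Yu: "Y * enn_powr (avg R u) (1 / (q * \<epsilon>)) \<le> D * enn_powr (strong_max G x) (t / q)"
        by (simp only: qe(2))
      have "ennreal (measure lebesgue R powr (\<alpha> / real CARD('n))) * (\<Prod>i\<in>UNIV. luxemburg (log_young k) R (f i))
        \<le> ennreal (measure lebesgue R powr (\<alpha> / real CARD('n))) * (\<Prod>i\<in>UNIV. (2 * ennreal Cs) * (H i R * enn_powr (avg R (\<sigma> i)) (1 / P' i)))"
        by (intro mult_left_mono prod_mono_ennreal lux R) auto
      also have "\<dots> = C0 * (Y * (\<Prod>i\<in>UNIV. enn_powr (avg R (\<sigma> i)) (1 / P' i)))"
        unfolding prod.distrib Y_def C0_def m_def prod_constant by (simp only: power_mult_distrib mult_ac)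
      also have "\<dots> \<le> C0 * (Y * (A * enn_powr (avg R u) (1 / (q * \<epsilon>))))"
        by (intro mult_left_mono \<sigma>_prod R) auto
      also have "\<dots> = C0 * A * (Y * enn_powr (avg R u) (1 / (q * \<epsilon>)))" by (simp only: mult_ac)
      also have "\<dots> \<le> C0 * A * (D * enn_powr (strong_max G x) (t / q))"
        by (intro mult_left_mono Yu) auto
      finally show "ennreal (measure lebesgue R powr (\<alpha> / real CARD('n))) * (\<Prod>i\<in>UNIV. luxemburg (log_young k) R (f i))
        \<le> C0 * A * D * enn_powr (strong_max G x) (t / q)" by (simp only: mult.assoc)
    qed
    \<comment> \<open>The exponents \<open>p / P i\<close> sum to 1, so Hoelder's inequality
      separates the factors; each is an unweighted strong maximal function in exponent
      \<open>P i / a i\<close>.\<close>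
    have F_int: "(\<integral>\<^sup>+x. enn_powr (F x) p \<partial>lebesgue) \<le> C3 * enn_powr NN p"
    proof -
      have "(\<integral>\<^sup>+x. enn_powr (F x) p \<partial>lebesgue)
        = (\<integral>\<^sup>+x. (\<Prod>i\<in>UNIV. enn_powr (enn_powr (strong_max (\<lambda>x. enn_powr (h i x) (a i)) x) (P i / a i)) (p / P i)) \<partial>lebesgue)"
      proof (intro nn_integral_cong)
        fix x
        have "1 / a i * p = P i / a i * (p / P i)" for i using P[of i] by simp
        then show "enn_powr (F x) p = (\<Prod>i\<in>UNIV. enn_powr (enn_powr (strong_max (\<lambda>x. enn_powr (h i x) (a i)) x) (P i / a i)) (p / P i))"
          by (simp only: F_def enn_powr_prod enn_powr_powr)
      qed
      also have "\<dots> \<le> (\<Prod>i\<in>UNIV. enn_powr (\<integral>\<^sup>+x. enn_powr (strong_max (\<lambda>x. enn_powr (h i x) (a i)) x) (P i / a i) \<partial>lebesgue) (p / P i))"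
      proof (rule nn_integral_Holder)
        have "(\<Sum>i\<in>UNIV. p / P i) = p * (1 / p)" unfolding p_eq sum_distrib_left by simp
        then show "(\<Sum>i\<in>UNIV. p / P i) = 1" using p by simp
        show "0 < p / P i" for i using p P[of i] by simp
      qed auto
      also have "\<dots> \<le> (\<Prod>i\<in>UNIV. enn_powr (ennreal (C2 i) * (\<integral>\<^sup>+x. enn_powr (h i x) (P i) \<partial>lebesgue)) (p / P i))"
      proof (intro prod_mono_ennreal enn_powr_mono)
        fix i
        show "0 \<le> p / P i" using p P[of i] by simp
        have "a i * (P i / a i) = P i" using a(1)[of i] by simp
        then show "(\<integral>\<^sup>+x. enn_powr (strong_max (\<lambda>x. enn_powr (h i x) (a i)) x) (P i / a i) \<partial>lebesgue)
          \<le> ennreal (C2 i) * (\<integral>\<^sup>+x. enn_powr (h i x) (P i) \<partial>lebesgue)"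
          using C2[of "\<lambda>x. enn_powr (h i x) (a i)" i] by (simp add: enn_powr_powr)
      qed
      also have "\<dots> = C3 * enn_powr NN p"
        by (simp add: C3_def NN_def N enn_powr_mult enn_powr_prod prod.distrib enn_powr_powr)
      finally show ?thesis .
    qed
    \<comment> \<open>\<open>\<epsilon> * t = 1\<close>, so \<open>u\<close> to the power
      \<open>t\<close> cancels \<open>v\<close> wherever \<open>v\<close> is positive.\<close>
    have G_int: "(\<integral>\<^sup>+x. enn_powr (G x) t * v x \<partial>lebesgue) = (\<integral>\<^sup>+x. enn_powr (F x) p \<partial>lebesgue)"
      using v_pos
    proof (intro nn_integral_cong_AE, eventually_elim)
      case (elim x)
      then obtain r where r: "v x = ennreal r" "0 < r" by (auto simp: v_def)
      have "enn_powr (u x) t * v x = 1"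
        using r t by (simp add: u_def \<epsilon>_def enn_powr_inverse enn_powr_powr inverse_ennreal ennreal_mult[symmetric])
      then show ?case using t by (simp add: G_def enn_powr_mult enn_powr_powr \<epsilon>_def mult.assoc)
    qed
    have "(\<integral>\<^sup>+x. enn_powr (max_op_young \<alpha> (log_young k) f x) q * ennreal (nu w x powr q) \<partial>lebesgue)
      \<le> (\<integral>\<^sup>+x. enn_powr (C0 * A * D) q * (enn_powr (strong_max G x) t * v x) \<partial>lebesgue)"
    proof (intro nn_integral_mono)
      fix x
      have "enn_powr (max_op_young \<alpha> (log_young k) f x) q \<le> enn_powr (C0 * A * D * enn_powr (strong_max G x) (t / q)) q"
        using q by (intro enn_powr_mono pointwise) auto
      also have "\<dots> = enn_powr (C0 * A * D) q * enn_powr (strong_max G x) t"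
        using q by (simp add: enn_powr_mult[of "C0 * A * D"] enn_powr_powr)
      finally show "enn_powr (max_op_young \<alpha> (log_young k) f x) q * ennreal (nu w x powr q)
        \<le> enn_powr (C0 * A * D) q * (enn_powr (strong_max G x) t * v x)"
        unfolding v_def mult.assoc[symmetric] by (rule mult_right_mono) simp
    qed
    also have "\<dots> = enn_powr (C0 * A * D) q * (\<integral>\<^sup>+x. enn_powr (strong_max G x) t * v x \<partial>lebesgue)"
      by (intro nn_integral_cmult) measurable
    also have "\<dots> \<le> enn_powr (C0 * A * D) q * (ennreal C1 * (C3 * enn_powr NN p))"
      using C1[OF G_meas] mult_left_mono[OF F_int, of "ennreal C1"] unfolding G_int
      by (intro mult_left_mono) (auto intro: order_trans)
    finally have "wnorm q (\<lambda>x. nu w x powr q) (max_op_young \<alpha> (log_young k) f)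
      \<le> enn_powr (enn_powr (C0 * A * D) q * (ennreal C1 * (C3 * enn_powr NN p))) (1 / q)"
      unfolding wnorm_def using q by (intro enn_powr_mono) auto
    also have "\<dots> = CC * (D * enn_powr NN (p / q))"
    proof -
      have "q * (1 / q) = 1" "p * (1 / q) = p / q" using q by simp_all
      then have "enn_powr (enn_powr (C0 * A * D) q * (ennreal C1 * (C3 * enn_powr NN p))) (1 / q)
        = C0 * A * D * (enn_powr (ennreal C1 * C3) (1 / q) * enn_powr NN (p / q))"
        by (simp only: mult.assoc[symmetric, of "ennreal C1"] enn_powr_mult[of "enn_powr (C0 * A * D) q"] enn_powr_mult[of "ennreal C1 * C3"] enn_powr_powr enn_powr_one)
      then show ?thesis by (simp only: CC_def mult_ac)
    qed
    also have "\<dots> = CC * NN" unfolding D ..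
    finally show ?thesis by (simp add: NN_def N_def)
  qed
  show ?thesis
    unfolding multi_bounded_def
  proof (intro exI conjI allI impI)
    show "0 < enn2real CC + 1" by (simp add: add_nonneg_pos)
    fix f assume f: "in_Lp f"
    have "CC \<le> ennreal (enn2real CC + 1)"
      using CC by (cases CC) (auto simp: ennreal_leI)
    then show "wnorm q (\<lambda>x. nu w x powr q) (max_op_young \<alpha> (log_young k) f)
      \<le> ennreal (enn2real CC + 1) * (\<Prod>i\<in>UNIV. wnorm (P i) (\<lambda>x. w i x powr P i) (\<lambda>x. ennreal \<bar>f i x\<bar>))"
      using main[OF f] by (elim order_trans) (intro mult_right_mono, auto)
  qed
qed

end

section \<open>The degenerate case and the equivalences\<close>

lemma (in weights) degenerate_multi_bounded:
  assumes "AE x in lebesgue. nu w x = 0"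
  shows "multi_bounded T P u q (\<lambda>x. nu w x powr q)"
proof -
  have "wnorm q (\<lambda>x. nu w x powr q) g = 0" for g
  proof -
    have "(\<integral>\<^sup>+x. enn_powr (g x) q * ennreal (nu w x powr q) \<partial>lebesgue) = (\<integral>\<^sup>+x. 0 \<partial>(lebesgue :: (real ^ 'n) measure))"
      using assms by (intro nn_integral_cong_AE, eventually_elim) simp
    then show ?thesis by (simp add: wnorm_def)
  qed
  then show ?thesis
    unfolding multi_bounded_def by (intro exI[of _ 1]) simp
qed

theorem theorem2p3:
  fixes k :: nat
    and \<alpha> p q :: real
    and P :: "'m::finite \<Rightarrow> real"
    and w :: "'m \<Rightarrow> real ^ 'n::finite \<Rightarrow> real"
  assumes "0 \<le> \<alpha>" and "\<alpha> < real CARD('m) * real CARD('n)"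
    and "\<And>i. 1 < P i"
    and "1 / p = (\<Sum>i\<in>UNIV. 1 / P i)"
    and "0 < p" and "p \<le> q"
    and "1 / q = 1 / p - \<alpha> / real CARD('n)"
    and "\<And>i x. 0 \<le> w i x"
    and "\<And>i. locally_integrable (w i)"
  defines "stmt1 \<equiv> w \<in> A_class P q"
    and "stmt2 \<equiv> \<exists>r>1. (\<forall>i. 1 \<le> P i / r) \<and>
                   (\<lambda>i x. w i x powr r) \<in> A_class (\<lambda>i. P i / r) (q / r)"
    and "stmt3 \<equiv> multi_bounded (max_op \<alpha>)
                   P (\<lambda>i x. w i x powr P i) q (\<lambda>x. nu w x powr q)"
    and "stmt4 \<equiv> multi_bounded (max_op_young \<alpha> (log_young k))
                   P (\<lambda>i x. w i x powr P i) q (\<lambda>x. nu w x powr q)"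
  shows "(stmt1 \<longleftrightarrow> stmt2) \<and> (stmt1 \<longleftrightarrow> stmt3) \<and> (stmt1 \<longleftrightarrow> stmt4)"
proof -
  interpret weights \<alpha> p q P w
    by unfold_locales (use assms(1-9) in auto)
  have "stmt1 \<Longrightarrow> stmt2 \<and> stmt4"
  proof (cases "AE x in lebesgue. nu w x = 0")
    case True
    then show ?thesis
      unfolding stmt2_def stmt4_def using stmt1_imp_stmt2_degenerate degenerate_multi_bounded by blast
  next
    case False
    assume stmt1
    then interpret nondegenerate_weights \<alpha> p q P w
      by unfold_locales (use False stmt1_iff in \<open>auto simp: stmt1_def\<close>)
    show ?thesis
      unfolding stmt2_def stmt4_def using stmt1_imp_stmt2 stmt1_imp_stmt4 by blast
  qed
  moreover have "stmt2 \<Longrightarrow> stmt1"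
    unfolding stmt1_def stmt2_def stmt1_iff using stmt2_imp_stmt1 by blast
  moreover have "stmt4 \<Longrightarrow> stmt3"
    unfolding stmt3_def stmt4_def by (rule stmt4_imp_stmt3)
  moreover have "stmt3 \<Longrightarrow> stmt1"
    unfolding stmt1_def stmt3_def stmt1_iff by (rule stmt3_imp_stmt1)
  ultimately show ?thesis by blast
qed

end
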